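(* Let $p_-:P\to B_-$ and $p_+:P\to B_+$ be cellular maps of finite CW complexes, and let $\operatorname{DMC}(p_-,p_+)=B_-\cup_{p_-}(P\times[0,1])\cup_{p_+}B_+$ be their double mapping cylinder. There is a cellular chain model $$C_*\bigl(\operatorname{DMC}(p_-,p_+)\bigr)\cong\operatorname{Cone}\!\left((p_{-\#},-p_{+\#}):C_*(P)\longrightarrow C_*(B_-)\oplus C_*(B_+)\right).$$ Consequently its raw cell inventory is $$\mathcal M_{\mathrm{DMC}}(t)=\mathcal M_{B_-}(t)+\mathcal M_{B_+}(t)+t\,\mathcal M_P(t),$$ but its homology depends on the two chain maps $p_{\pm\#}$, not only on the three polynomials $\mathcal M_{B_-},\mathcal M_{B_+},\mathcal M_P$.
   Context: $C_*$ denotes integral cellular chains, and for a finite CW complex $Y$ with the given cell structure $\mathcal M_Y(t)=\sum_k\#\{k\text{-cells of }Y\}\,t^k$. In $\operatorname{DMC}(p_-,p_+)$, $P\times\{0\}$ is glued to $B_-$ via $p_-$ and $P\times\{1\}$ is glued to $B_+$ via $p_+$. $\mathcal M_{\mathrm{DMC}}$ is the generator-count polynomial of the displayed cellular chain model. $p_{\pm\#}$ are the induced cellular chain maps; $\operatorname{Cone}(g:A\to B)$ is the algebraic mapping cone, with $\operatorname{Cone}(g)_n=A_{n-1}\oplus B_n$. *)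

theory Defs
  imports "HOL-Homology.Homology" "HOL-Computational_Algebra.Polynomial"
begin

section \<open>Finite CW complexes\<close>

record 'a cell_complex =
  underlying :: "'a topology"
  cells :: "nat \<Rightarrow> 'a set set"   \<comment> \<open>\<open>cells Y k\<close> is the set of open \<open>k\<close>-cells\<close>

text \<open>Skeleta are indexed by integers, so that the \<open>n\<close>-skeleton is empty for negative \<open>n\<close>.\<close>

definition skeleton :: "'a cell_complex \<Rightarrow> int \<Rightarrow> 'a set" where
  "skeleton Y n = \<Union>{e. \<exists>k. int k \<le> n \<and> e \<in> cells Y k}"

definition closed_disc :: "nat \<Rightarrow> (nat \<Rightarrow> real) topology" where
  "closed_disc n = subtopology (Euclidean_space n) {x. (\<Sum>i<n. (x i)\<^sup>2) \<le> 1}"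

definition open_disc :: "nat \<Rightarrow> (nat \<Rightarrow> real) topology" where
  "open_disc n = subtopology (Euclidean_space n) {x. (\<Sum>i<n. (x i)\<^sup>2) < 1}"

text \<open>The boundary of the disc; it is empty for \<open>n = 0\<close>.\<close>

definition disc_boundary :: "nat \<Rightarrow> (nat \<Rightarrow> real) set" where
  "disc_boundary n = topspace (closed_disc n) - topspace (open_disc n)"

definition characteristic_map ::
    "'a cell_complex \<Rightarrow> nat \<Rightarrow> 'a set \<Rightarrow> ((nat \<Rightarrow> real) \<Rightarrow> 'a) \<Rightarrow> bool" where
  "characteristic_map Y n e \<phi> \<longleftrightarrow>
     continuous_map (closed_disc n) (underlying Y) \<phi> \<and>
     homeomorphic_map (open_disc n) (subtopology (underlying Y) e) \<phi> \<and>
     \<phi> ` disc_boundary n \<subseteq> skeleton Y (int n - 1)"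

text \<open>
  Whitehead's definition: a Hausdorff space partitioned into open cells with characteristic maps.
  Closure finiteness and the weak topology need not be demanded, since they are automatic when
  there are only finitely many cells.
\<close>

definition finite_CW :: "'a cell_complex \<Rightarrow> bool" where
  "finite_CW Y \<longleftrightarrow>
     Hausdorff_space (underlying Y) \<and>
     finite {(k, e). e \<in> cells Y k} \<and>
     (\<forall>k l e e'. e \<in> cells Y k \<and> e' \<in> cells Y l \<and> (k, e) \<noteq> (l, e') \<longrightarrow> e \<inter> e' = {}) \<and>
     (\<Union>k. \<Union>(cells Y k)) = topspace (underlying Y) \<and>
     (\<forall>k. \<forall>e \<in> cells Y k. \<exists>\<phi>. characteristic_map Y k e \<phi>)"

definition cellular_map :: "'a cell_complex \<Rightarrow> 'b cell_complex \<Rightarrow> ('a \<Rightarrow> 'b) \<Rightarrow> bool" where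
  "cellular_map Y Z f \<longleftrightarrow>
     continuous_map (underlying Y) (underlying Z) f \<and>
     (\<forall>n. f ` skeleton Y n \<subseteq> skeleton Z n)"

definition cell_polynomial :: "'a cell_complex \<Rightarrow> nat poly" where
  "cell_polynomial Y = (\<Sum>k | cells Y k \<noteq> {}. Polynomial.monom (card (cells Y k)) k)"


section \<open>Double mapping cylinder\<close>

text \<open>
  The disjoint union of \<open>B\<^sub>-\<close>, \<open>P \<times> [0,1]\<close> and \<open>B\<^sub>+\<close>, in this order. The library's
  \<open>sum_topology\<close> needs summands of one type.
\<close>

definition dmc_summands ::
    "'a topology \<Rightarrow> 'b topology \<Rightarrow> 'c topology \<Rightarrow> ('b + ('a \<times> real) + 'c) topology" where
  "dmc_summands P B\<^sub>m B\<^sub>p = topology (\<lambda>U.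
     openin B\<^sub>m {b. Inl b \<in> U} \<and>
     openin (prod_topology P (top_of_set {0..1})) {y. Inr (Inl y) \<in> U} \<and>
     openin B\<^sub>p {c. Inr (Inr c) \<in> U})"

lemma openin_vimage_Union:
  assumes "\<And>U. U \<in> K \<Longrightarrow> openin T {y. i y \<in> U}"
  shows "openin T {y. i y \<in> \<Union>K}"
proof -
  have eq: "{y. i y \<in> \<Union>K} = \<Union>((\<lambda>U. {y. i y \<in> U}) ` K)"
    by auto
  show ?thesis
    unfolding eq using assms by (intro openin_Union) blast
qed

lemma openin_dmc_summands:
  "openin (dmc_summands P B\<^sub>m B\<^sub>p) U \<longleftrightarrow>
     openin B\<^sub>m {b. Inl b \<in> U} \<and>
     openin (prod_topology P (top_of_set {0..1})) {y. Inr (Inl y) \<in> U} \<and>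
     openin B\<^sub>p {c. Inr (Inr c) \<in> U}"
proof -
  have "istopology (\<lambda>U.
     openin B\<^sub>m {b. Inl b \<in> U} \<and>
     openin (prod_topology P (top_of_set {0..1})) {y. Inr (Inl y) \<in> U} \<and>
     openin B\<^sub>p {c. Inr (Inr c) \<in> U})"
    unfolding istopology_def
    by (auto simp: Collect_conj_eq simp del: Union_iff intro!: openin_Int openin_vimage_Union)
  then show ?thesis
    unfolding dmc_summands_def by (subst topology_inverse') auto
qed

definition quotient_topology :: "'a topology \<Rightarrow> ('a \<times> 'a) set \<Rightarrow> 'a set topology" where
  "quotient_topology X R =
     topology (\<lambda>U. U \<subseteq> topspace X // R \<and> openin X {x \<in> topspace X. R `` {x} \<in> U})"

lemma openin_quotient_topology:
  "openin (quotient_topology X R) U \<longleftrightarrow>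
     U \<subseteq> topspace X // R \<and> openin X {x \<in> topspace X. R `` {x} \<in> U}"
proof -
  have 1: "{x \<in> topspace X. R `` {x} \<in> S \<inter> T} =
      {x \<in> topspace X. R `` {x} \<in> S} \<inter> {x \<in> topspace X. R `` {x} \<in> T}" for S T
    by auto
  have 2: "{x \<in> topspace X. R `` {x} \<in> \<Union>K} = \<Union>((\<lambda>U. {x \<in> topspace X. R `` {x} \<in> U}) ` K)" for K
    by auto
  have "istopology (\<lambda>U. U \<subseteq> topspace X // R \<and> openin X {x \<in> topspace X. R `` {x} \<in> U})"
    unfolding istopology_def 1 2 by (blast intro!: openin_Int openin_Union)
  then show ?thesis
    unfolding quotient_topology_def by (subst topology_inverse') auto
qed

lemma quotient_map_quotient_topology:
  "quotient_map X (quotient_topology X R) (\<lambda>x. R `` {x})"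
proof -
  have "openin (quotient_topology X R) (topspace X // R)"
    unfolding openin_quotient_topology by (simp add: quotientI cong: conj_cong)
  then have top: "topspace (quotient_topology X R) = topspace X // R"
    by (metis openin_quotient_topology openin_subset openin_topspace subset_antisym)
  show ?thesis
    unfolding quotient_map_def top by (auto simp: openin_quotient_topology quotient_def)
qed

text \<open>
  The equivalence relation on the disjoint union generated by
  \<open>(x,0) \<sim> p\<^sub>- x\<close> and \<open>(x,1) \<sim> p\<^sub>+ x\<close>.
\<close>

definition dmc_glue ::
    "'a topology \<Rightarrow> ('a \<Rightarrow> 'b) \<Rightarrow> ('a \<Rightarrow> 'c) \<Rightarrow>
       (('b + ('a \<times> real) + 'c) \<times> ('b + ('a \<times> real) + 'c)) set" where
  "dmc_glue P p\<^sub>m p\<^sub>p =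
     (let G = (\<lambda>x. (Inr (Inl (x, 0)), Inl (p\<^sub>m x))) ` topspace P \<union>
              (\<lambda>x. (Inr (Inl (x, 1)), Inr (Inr (p\<^sub>p x)))) ` topspace P
      in (G \<union> G\<inverse>)\<^sup>*)"

text \<open>The cells are those of \<open>B\<^sub>-\<close> and \<open>B\<^sub>+\<close>, and a \<open>(k+1)\<close>-cell \<open>e \<times> (0,1)\<close> for
  each \<open>k\<close>-cell \<open>e\<close> of \<open>P\<close>.\<close>

definition DMC ::
    "'a cell_complex \<Rightarrow> 'b cell_complex \<Rightarrow> 'c cell_complex \<Rightarrow> ('a \<Rightarrow> 'b) \<Rightarrow> ('a \<Rightarrow> 'c) \<Rightarrow>
       ('b + ('a \<times> real) + 'c) set cell_complex" where
  "DMC P B\<^sub>m B\<^sub>p p\<^sub>m p\<^sub>p =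
     (let R = dmc_glue (underlying P) p\<^sub>m p\<^sub>p; q = (\<lambda>z. R `` {z}) in
      \<lparr> underlying =
          quotient_topology (dmc_summands (underlying P) (underlying B\<^sub>m) (underlying B\<^sub>p)) R,
        cells = (\<lambda>n.
          (\<lambda>e. q ` Inl ` e) ` cells B\<^sub>m n \<union>
          (\<lambda>e. q ` (Inr \<circ> Inr) ` e) ` cells B\<^sub>p n \<union>
          (case n of 0 \<Rightarrow> {}
           | Suc k \<Rightarrow> (\<lambda>e. q ` (Inr \<circ> Inl) ` (e \<times> {0<..<1})) ` cells P k)) \<rparr>)"


section \<open>Chain complexes\<close>

text \<open>
  Chain groups are abelian groups in the multiplicative notation of HOL-Algebra, as for the
  library's homology groups; \<open>boundary C n\<close> maps degree \<open>n\<close> to degree \<open>n - 1\<close>.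
\<close>

record 'g chain_complex =
  chains :: "int \<Rightarrow> 'g monoid"
  boundary :: "int \<Rightarrow> 'g \<Rightarrow> 'g"

definition chain_isomorphism ::
    "'g chain_complex \<Rightarrow> 'h chain_complex \<Rightarrow> (int \<Rightarrow> 'g \<Rightarrow> 'h) \<Rightarrow> bool" where
  "chain_isomorphism C D \<phi> \<longleftrightarrow>
     (\<forall>n. \<phi> n \<in> iso (chains C n) (chains D n)) \<and>
     (\<forall>n. \<forall>x \<in> carrier (chains C n). \<phi> (n - 1) (boundary C n x) = boundary D n (\<phi> n x))"

definition chain_complexes_isomorphic ::
    "'g chain_complex \<Rightarrow> 'h chain_complex \<Rightarrow> bool" (infix \<open>\<cong>\<^sub>c\<close> 50) where
  "C \<cong>\<^sub>c D \<longleftrightarrow> (\<exists>\<phi>. chain_isomorphism C D \<phi>)"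

definition direct_sum_complex ::
    "'g chain_complex \<Rightarrow> 'h chain_complex \<Rightarrow> ('g \<times> 'h) chain_complex" (infixr \<open>\<oplus>\<^sub>c\<close> 65) where
  "C \<oplus>\<^sub>c D =
     \<lparr> chains = (\<lambda>n. chains C n \<times>\<times> chains D n),
       boundary = (\<lambda>n (x, y). (boundary C n x, boundary D n y)) \<rparr>"

text \<open>In additive notation the boundary of the cone is \<open>d (a, b) = (- d a, g a + d b)\<close>.\<close>

definition Cone ::
    "'g chain_complex \<Rightarrow> 'h chain_complex \<Rightarrow> (int \<Rightarrow> 'g \<Rightarrow> 'h) \<Rightarrow> ('g \<times> 'h) chain_complex" where
  "Cone A B g =
     \<lparr> chains = (\<lambda>n. chains A (n - 1) \<times>\<times> chains B n),
       boundary = (\<lambda>n (a, b).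
         (inv\<^bsub>chains A (n - 2)\<^esub> (boundary A (n - 1) a),
          g (n - 1) a \<otimes>\<^bsub>chains B (n - 1)\<^esub> boundary B n b)) \<rparr>"

definition chain_homology :: "'g chain_complex \<Rightarrow> int \<Rightarrow> 'g set monoid" where
  "chain_homology C n =
     subgroup_generated (chains C n) (kernel (chains C n) (chains C (n - 1)) (boundary C n))
       Mod (boundary C (n + 1) ` carrier (chains C (n + 1)))"

definition finitely_generated_free :: "'g chain_complex \<Rightarrow> bool" where
  "finitely_generated_free C \<longleftrightarrow> (\<forall>n. \<exists>k::nat. chains C n \<cong> free_Abelian_group {..<k})"

text \<open>The rank is well defined for free abelian groups of finite rank, by
  the library theorem \<open>isomorphic_free_Abelian_groups\<close>; it is only meaningful for those.\<close>

definition free_rank :: "'g monoid \<Rightarrow> nat" where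
  "free_rank G = (THE k. G \<cong> free_Abelian_group {..<k})"

definition generator_polynomial :: "'g chain_complex \<Rightarrow> nat poly" where
  "generator_polynomial C =
     (\<Sum>k | free_rank (chains C (int k)) \<noteq> 0. Polynomial.monom (free_rank (chains C (int k))) k)"


section \<open>Cellular chains\<close>

text \<open>
  \<open>C\<^sub>n(Y) = H\<^sub>n(Y\<^sup>n, Y\<^sup>n\<^sup>-\<^sup>1)\<close> with the boundary map of the triple
  \<open>(Y\<^sup>n, Y\<^sup>n\<^sup>-\<^sup>1, Y\<^sup>n\<^sup>-\<^sup>2)\<close>.
\<close>

definition cellular_chains :: "'a cell_complex \<Rightarrow> 'a chain set chain_complex" where
  "cellular_chains Y =
     \<lparr> chains = (\<lambda>n. relative_homology_group n
         (subtopology (underlying Y) (skeleton Y n)) (skeleton Y (n - 1))),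
       boundary = (\<lambda>n. hom_relboundary n
         (subtopology (underlying Y) (skeleton Y n)) (skeleton Y (n - 1)) (skeleton Y (n - 2))) \<rparr>"

definition cellular_chain_map ::
    "'a cell_complex \<Rightarrow> 'b cell_complex \<Rightarrow> ('a \<Rightarrow> 'b) \<Rightarrow> int \<Rightarrow> 'a chain set \<Rightarrow> 'b chain set" where
  "cellular_chain_map Y Z f n = hom_induced n
     (subtopology (underlying Y) (skeleton Y n)) (skeleton Y (n - 1))
     (subtopology (underlying Z) (skeleton Z n)) (skeleton Z (n - 1)) f"

text \<open>\<open>(p\<^sub>-\<^sub>#, - p\<^sub>+\<^sub>#)\<close>\<close>

definition difference_chain_map ::
    "'a cell_complex \<Rightarrow> 'b cell_complex \<Rightarrow> 'c cell_complex \<Rightarrow> ('a \<Rightarrow> 'b) \<Rightarrow> ('a \<Rightarrow> 'c) \<Rightarrow>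
       int \<Rightarrow> 'a chain set \<Rightarrow> 'b chain set \<times> 'c chain set" where
  "difference_chain_map P B\<^sub>m B\<^sub>p p\<^sub>m p\<^sub>p n x =
     (cellular_chain_map P B\<^sub>m p\<^sub>m n x,
      inv\<^bsub>chains (cellular_chains B\<^sub>p) n\<^esub> (cellular_chain_map P B\<^sub>p p\<^sub>p n x))"

definition DMC_cone ::
    "'a cell_complex \<Rightarrow> 'b cell_complex \<Rightarrow> 'c cell_complex \<Rightarrow> ('a \<Rightarrow> 'b) \<Rightarrow> ('a \<Rightarrow> 'c) \<Rightarrow>
       ('a chain set \<times> 'b chain set \<times> 'c chain set) chain_complex" where
  "DMC_cone P B\<^sub>m B\<^sub>p p\<^sub>m p\<^sub>p =
     Cone (cellular_chains P) (cellular_chains B\<^sub>m \<oplus>\<^sub>c cellular_chains B\<^sub>p)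
       (difference_chain_map P B\<^sub>m B\<^sub>p p\<^sub>m p\<^sub>p)"

end

theory Submission
  imports Defs
begin

text \<open>
  The double mapping cylinder has one cell for every cell of \<open>B\<^sub>-\<close> and of \<open>B\<^sub>+\<close>, and a prism cell
  \<open>e \<times> (0,1)\<close> for every cell \<open>e\<close> of \<open>P\<close>. Hence its cellular chains are, degree by degree, those of
  \<open>B\<^sub>-\<close> and \<open>B\<^sub>+\<close> together with those of \<open>P\<close> raised by one degree, which are the groups of the mapping
  cone. The boundary of the prism over \<open>a\<close> consists of its bottom, which is glued to \<open>p\<^sub>-\<^sub># a\<close>, its
  top, which is glued to \<open>p\<^sub>+\<^sub># a\<close> and enters with the opposite sign, and its side, which is minus
  the prism over the boundary of \<open>a\<close>. These are the terms of the differential of the cone of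
  \<open>(p\<^sub>-\<^sub>#, - p\<^sub>+\<^sub>#)\<close>.

  The proof makes the prism a homomorphism \<open>susp\<close> from \<open>H\<^sub>n(X,A)\<close> to \<open>H\<^sub>n\<^sub>+\<^sub>1\<close> of the cylinder over \<open>X\<close>
  relative to its two ends and its side over \<open>A\<close>. It comes from a natural prism operator on singular chains,
  so \<open>susp\<close> is natural as well (\<open>susp_natural\<close>), and the description of the boundary above becomes
  \<open>hom_relboundary_susp\<close>. Pushed forward along the quotient map, suspensions of cellular chains of \<open>P\<close>
  become cellular chains of the double mapping cylinder. Together with the inclusions of
  the two bases they form \<open>cone_map\<close>, which is a chain map by \<open>cone_map_boundary\<close>.

  That \<open>cone_map\<close> is an isomorphism is checked on bases. The group \<open>H\<^sub>n(Y\<^sup>n, Y\<^sup>n\<^sup>-\<^sup>1)\<close> of a finite CW complex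
  has as basis the images of a generator of \<open>H\<^sub>n(D\<^sup>n, S\<^sup>n\<^sup>-\<^sup>1)\<close> under the characteristic maps of the \<open>n\<close>-cells
  (\<open>cellular_basis\<close>); this follows by attaching the cells one at a time. The generators are chosen
  recursively: the one for the \<open>(n + 1)\<close>-disc is the suspension of the one for the \<open>n\<close>-disc, transported
  along a homeomorphism of the cylinder over \<open>D\<^sup>n\<close> with \<open>D\<^sup>n\<^sup>+\<^sup>1\<close>. With this choice \<open>cone_map\<close> takes the basis
  of the cone exactly to the basis of the double mapping cylinder (\<open>prism_chain_disc\<close>,
  \<open>cone_map_basis\<close>), and no degrees or signs have to be computed. The counts of cells and generators
  are read off from these bases.

  The statement about singular homology combines the isomorphism of chain complexes with the fact that
  cellular homology is singular homology (\<open>cellular_homology\<close>); it requires that the double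
  mapping cylinder is a finite CW complex, where the main point is the Hausdorff property.

  For the dependence on the maps, let \<open>P\<close> and \<open>B\<^sub>-\<close> consist of the same two points and \<open>B\<^sub>+\<close> of one point.
  If \<open>p\<^sub>-\<close> is the identity, the double mapping cylinder is an arc; if \<open>p\<^sub>-\<close> is constant,
  one point of \<open>B\<^sub>-\<close> remains isolated. The groups \<open>H\<^sub>0\<close> differ, although the cells are the same.
\<close>

section \<open>Bases of free abelian groups\<close>

text \<open>The basis is a family, and not a subset of the group, because the index set is to remember which cell
  every basis element comes from.\<close>

definition is_basis :: "'g monoid \<Rightarrow> 'e set \<Rightarrow> ('e \<Rightarrow> 'g) \<Rightarrow> bool" where
  "is_basis G E b \<longleftrightarrow> (\<exists>h \<in> iso (free_Abelian_group E) G. \<forall>e\<in>E. h (frag_of e) = b e)"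

lemma hom_free_Abelian_group_unique:
  assumes "group G" and h: "h \<in> hom (free_Abelian_group E) G" and k: "k \<in> hom (free_Abelian_group E) G"
    and eq: "\<And>e. e \<in> E \<Longrightarrow> h (frag_of e) = k (frag_of e)"
    and x: "x \<in> carrier (free_Abelian_group E)"
  shows "h x = k x"
proof -
  interpret h: group_hom "free_Abelian_group E" G h
    using h \<open>group G\<close> by (simp add: group_hom_def group_hom_axioms_def)
  interpret k: group_hom "free_Abelian_group E" G k
    using k \<open>group G\<close> by (simp add: group_hom_def group_hom_axioms_def)
  show ?thesis
  proof (rule free_Abelian_group_induct [where S = E and P = "\<lambda>x. h x = k x"])
    show "Poly_Mapping.keys x \<subseteq> E" using x by simp
    show "h 0 = k 0" using h.hom_one k.hom_one by simp
  next
    fix x y assume 2: "Poly_Mapping.keys x \<subseteq> E" "Poly_Mapping.keys y \<subseteq> E" "h x = k x" "h y = k y"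
    have *: "x - y = x \<otimes>\<^bsub>free_Abelian_group E\<^esub> inv\<^bsub>free_Abelian_group E\<^esub> y"
      using 2 by simp
    have "y \<in> carrier (free_Abelian_group E)" "x \<in> carrier (free_Abelian_group E)"
      using 2 by auto
    with 2 show "h (x - y) = k (x - y)"
      unfolding * by (metis h.G.inv_closed h.hom_inv h.hom_mult k.hom_inv k.hom_mult)
  next
    fix a assume "a \<in> E"
    then show "h (frag_of a) = k (frag_of a)" by (simp add: eq)
  qed
qed

lemma is_basis_closed:
  assumes "is_basis G E b" "e \<in> E"
  shows "b e \<in> carrier G"
proof -
  obtain h where h: "h \<in> iso (free_Abelian_group E) G" "h (frag_of e) = b e"
    using assms unfolding is_basis_def by blast
  then have "h \<in> carrier (free_Abelian_group E) \<rightarrow> carrier G"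
    by (simp add: iso_def hom_def)
  then show ?thesis
    using h assms(2) by (metis PiE frag_of_in_free_Abelian_group)
qed

lemma is_basis_iso:
  assumes "is_basis G E b" "f \<in> iso G H"
  shows "is_basis H E (\<lambda>e. f (b e))"
proof -
  obtain h where h: "h \<in> iso (free_Abelian_group E) G" "\<forall>e\<in>E. h (frag_of e) = b e"
    using assms unfolding is_basis_def by blast
  have "f \<circ> h \<in> iso (free_Abelian_group E) H"
    using Group.iso_set_trans [OF h(1) assms(2)] .
  then show ?thesis
    using h unfolding is_basis_def by (metis comp_apply)
qed

text \<open>The criterion by which the cone is compared with the cellular chains of the double mapping cylinder:
  the cells of the latter index bases of both groups.\<close>

lemma hom_basis_iso:
  assumes "group G" "group H" "is_basis G E b" "is_basis H E c" "f \<in> hom G H"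
    and "\<And>e. e \<in> E \<Longrightarrow> f (b e) = c e"
  shows "f \<in> iso G H"
proof -
  obtain h where h: "h \<in> iso (free_Abelian_group E) G" "\<forall>e\<in>E. h (frag_of e) = b e"
    using assms unfolding is_basis_def by blast
  obtain k where k: "k \<in> iso (free_Abelian_group E) H" "\<forall>e\<in>E. k (frag_of e) = c e"
    using assms unfolding is_basis_def by blast
  have hk: "h \<in> hom (free_Abelian_group E) G" "k \<in> hom (free_Abelian_group E) H"
    using h k by (auto simp: iso_def)
  have eq: "(f \<circ> h) x = k x" if "x \<in> carrier (free_Abelian_group E)" for x
  proof (rule hom_free_Abelian_group_unique [OF \<open>group H\<close> _ hk(2) _ that])
    show "f \<circ> h \<in> hom (free_Abelian_group E) H"
      using hk(1) assms(5) by (rule hom_compose)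
  qed (simp add: h k assms)
  have b: "bij_betw h (carrier (free_Abelian_group E)) (carrier G)"
     "bij_betw k (carrier (free_Abelian_group E)) (carrier H)"
    using h k by (auto simp: iso_def)
  then have "bij_betw (f \<circ> h) (carrier (free_Abelian_group E)) (carrier H)"
    using bij_betw_cong [of _ "f \<circ> h" k] eq by blast
  then have "bij_betw f (carrier G) (carrier H)"
    using b(1) by (metis bij_betw_comp_iff)
  then show ?thesis using assms by (simp add: iso_def)
qed

lemma is_basis_reindex:
  assumes G: "comm_group G" and b: "is_basis G E b" and f: "bij_betw f E' E"
  shows "is_basis G E' (\<lambda>e. b (f e))"
proof -
  define g where "g = the_inv_into E' f"
  have inj: "inj_on f E'" and im: "f ` E' = E" using f by (auto simp: bij_betw_def)
  have g: "g (f e) = e" if "e \<in> E'" for e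
    using that inj by (simp add: g_def the_inv_into_f_f)
  have fg: "f (g e) = e" "g e \<in> E'" if "e \<in> E" for e
    using that inj im by (auto simp: g_def f_the_inv_into_f the_inv_into_f_f)
  obtain u where u: "u \<in> hom (free_Abelian_group E') (free_Abelian_group E)"
     "\<And>x. x \<in> E' \<Longrightarrow> u (frag_of x) = frag_of (f x)"
    by (rule comm_group.free_Abelian_group_universal
         [OF abelian_free_Abelian_group [of E], where S = E' and f = "\<lambda>x. frag_of (f x)"]) (use im in auto)
  obtain v where v: "v \<in> hom (free_Abelian_group E) (free_Abelian_group E')"
     "\<And>x. x \<in> E \<Longrightarrow> v (frag_of x) = frag_of (g x)"
    by (rule comm_group.free_Abelian_group_universal
         [OF abelian_free_Abelian_group [of E'], where S = E and f = "\<lambda>x. frag_of (g x)"]) (use fg in auto)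
  have "(v \<circ> u) x = id x" if "x \<in> carrier (free_Abelian_group E')" for x
  proof (rule hom_free_Abelian_group_unique [OF group_free_Abelian_group _ _ _ that])
    show "v \<circ> u \<in> hom (free_Abelian_group E') (free_Abelian_group E')"
      using u v hom_compose by blast
    show "id \<in> hom (free_Abelian_group E') (free_Abelian_group E')"
      by (simp add: group_hom_free_Abelian_groups_id)
  qed (use u v im g in auto)
  moreover have "(u \<circ> v) x = id x" if "x \<in> carrier (free_Abelian_group E)" for x
  proof (rule hom_free_Abelian_group_unique [OF group_free_Abelian_group _ _ _ that])
    show "u \<circ> v \<in> hom (free_Abelian_group E) (free_Abelian_group E)"
      using u v hom_compose by blast
    show "id \<in> hom (free_Abelian_group E) (free_Abelian_group E)"
      by (simp add: group_hom_free_Abelian_groups_id)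
  qed (use u v fg in auto)
  ultimately have "group_isomorphisms (free_Abelian_group E') (free_Abelian_group E) u v"
    using u(1) v(1) by (auto simp: group_isomorphisms_def)
  then have u_iso: "u \<in> iso (free_Abelian_group E') (free_Abelian_group E)"
    by (rule group_isomorphisms_imp_iso)
  obtain h where h: "h \<in> iso (free_Abelian_group E) G" "\<forall>e\<in>E. h (frag_of e) = b e"
    using b unfolding is_basis_def by blast
  have "h \<circ> u \<in> iso (free_Abelian_group E') G"
    using Group.iso_set_trans [OF u_iso h(1)] .
  moreover have "\<forall>e\<in>E'. (h \<circ> u) (frag_of e) = b (f e)"
    using u(2) h(2) im by auto
  ultimately show ?thesis unfolding is_basis_def by blast
qed

text \<open>A short exact sequence of abelian groups whose quotient is free splits, and a basis of the
  subgroup together with lifts of a basis of the quotient is a basis of the middle group. This is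
  how cells are added one at a time, and also how bases of direct sums arise.\<close>

lemma is_basis_extension:
  fixes E E' :: "'e set"
  assumes F: "group F" and G: "comm_group G" and K: "group K"
    and i: "i \<in> hom F G" "inj_on i (carrier F)"
    and p: "p \<in> hom G K"
    and ex: "kernel G K p = i ` carrier F"
    and bF: "is_basis F E b" and bK: "is_basis K E' c" and disj: "E \<inter> E' = {}"
    and d: "\<And>e. e \<in> E \<Longrightarrow> d e = i (b e)"
      "\<And>e. e \<in> E' \<Longrightarrow> d e \<in> carrier G" "\<And>e. e \<in> E' \<Longrightarrow> p (d e) = c e"
  shows "is_basis G (E \<union> E') d"
proof -
  interpret G: comm_group G by fact
  interpret i: group_hom F G i using i F by (simp add: group_hom_def group_hom_axioms_def)
  interpret p: group_hom G K p using p K by (simp add: group_hom_def group_hom_axioms_def)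
  have "d ` (E \<union> E') \<subseteq> carrier G"
    using d is_basis_closed [OF bF] i.hom_closed by fastforce
  then obtain h where h: "h \<in> hom (free_Abelian_group (E \<union> E')) G"
      "\<And>x. x \<in> E \<union> E' \<Longrightarrow> h (frag_of x) = d x"
    using G.free_Abelian_group_universal by blast
  interpret h: group_hom "free_Abelian_group (E \<union> E')" G h
    using h by (simp add: group_hom_def group_hom_axioms_def)
  obtain f where f: "f \<in> iso (free_Abelian_group E) F" "\<forall>e\<in>E. f (frag_of e) = b e"
    using bF unfolding is_basis_def by blast
  obtain k where k: "k \<in> iso (free_Abelian_group E') K" "\<forall>e\<in>E'. k (frag_of e) = c e"
    using bK unfolding is_basis_def by blast
  have sub: "id \<in> hom (free_Abelian_group E) (free_Abelian_group (E \<union> E'))"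
     "id \<in> hom (free_Abelian_group E') (free_Abelian_group (E \<union> E'))"
    by (auto simp: group_hom_free_Abelian_groups_id)
  have hE: "h y = i (f y)" if "Poly_Mapping.keys y \<subseteq> E" for y
  proof -
    have "(h \<circ> id) y = (i \<circ> f) y"
    proof (rule hom_free_Abelian_group_unique [OF G.is_group])
      show "h \<circ> id \<in> hom (free_Abelian_group E) G"
        using sub(1) h(1) by (rule hom_compose)
      show "i \<circ> f \<in> hom (free_Abelian_group E) G"
        using f i(1) by (metis iso_imp_homomorphism hom_compose)
    qed (use that h f d in auto)
    then show ?thesis by simp
  qed
  have hE': "p (h z) = k z" if "Poly_Mapping.keys z \<subseteq> E'" for z
  proof -
    have "(p \<circ> (h \<circ> id)) z = k z"
    proof (rule hom_free_Abelian_group_unique [OF K])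
      show "p \<circ> (h \<circ> id) \<in> hom (free_Abelian_group E') K"
        using sub(2) h(1) p by (metis hom_compose)
      show "k \<in> hom (free_Abelian_group E') K"
        using k by (simp add: iso_imp_homomorphism)
    qed (use that h k d in auto)
    then show ?thesis by simp
  qed
  \<comment> \<open>The free group on the union is the sum of the two free groups. Injectivity and surjectivity of
    \<open>h\<close> then follow as in the five lemma.\<close>
  have split: "\<exists>y z. Poly_Mapping.keys y \<subseteq> E \<and> Poly_Mapping.keys z \<subseteq> E' \<and> x = y + z" (is "?P x")
    if "Poly_Mapping.keys x \<subseteq> E \<union> E'" for x :: "'e \<Rightarrow>\<^sub>0 int"
  proof (rule free_Abelian_group_induct [where S = "E \<union> E'" and P = ?P, OF that])
    show "?P 0" by (metis add_0 empty_subsetI keys_zero)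
  next
    fix x y :: "'e \<Rightarrow>\<^sub>0 int" assume "?P x" "?P y"
    then obtain x1 x2 y1 y2 where "Poly_Mapping.keys x1 \<subseteq> E" "Poly_Mapping.keys x2 \<subseteq> E'"
       "Poly_Mapping.keys y1 \<subseteq> E" "Poly_Mapping.keys y2 \<subseteq> E'" and *: "x = x1 + x2" "y = y1 + y2"
      by blast
    then have "Poly_Mapping.keys (x1 - y1) \<subseteq> E" "Poly_Mapping.keys (x2 - y2) \<subseteq> E'"
      using keys_diff [of x1 y1] keys_diff [of x2 y2] by auto
    moreover from * have "x - y = (x1 - y1) + (x2 - y2)" by simp
    ultimately show "?P (x - y)" by blast
  next
    fix a assume 3: "a \<in> E \<union> E'"
    have "Poly_Mapping.keys (0 :: 'e \<Rightarrow>\<^sub>0 int) \<subseteq> E'" "Poly_Mapping.keys (0 :: 'e \<Rightarrow>\<^sub>0 int) \<subseteq> E"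
      by auto
    moreover have "frag_of a = frag_of a + 0" "frag_of a = 0 + frag_of a" by auto
    ultimately show "?P (frag_of a)"
      using 3 by (metis Un_iff empty_subsetI insert_subset keys_frag_of)
  qed
  have fbij: "bij_betw f (carrier (free_Abelian_group E)) (carrier F)"
    and kbij: "bij_betw k (carrier (free_Abelian_group E')) (carrier K)"
    using f k by (auto simp: iso_def)
  interpret f: group_hom "free_Abelian_group E" F f
    using f F by (simp add: group_hom_def group_hom_axioms_def iso_imp_homomorphism)
  interpret k: group_hom "free_Abelian_group E'" K k
    using k K by (simp add: group_hom_def group_hom_axioms_def iso_imp_homomorphism)
  have pi: "p (i a) = \<one>\<^bsub>K\<^esub>" if "a \<in> carrier F" for a
    using ex that by (auto simp: kernel_def)
  have hsplit: "h (y + z) = i (f y) \<otimes>\<^bsub>G\<^esub> h z" "f y \<in> carrier F" "h z \<in> carrier G"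
      "p (h (y + z)) = k z"
    if "Poly_Mapping.keys y \<subseteq> E" "Poly_Mapping.keys z \<subseteq> E'" for y z
  proof -
    have yz: "y \<in> carrier (free_Abelian_group (E \<union> E'))" "z \<in> carrier (free_Abelian_group (E \<union> E'))"
      using that by auto
    show fy: "f y \<in> carrier F" using that f.hom_closed by simp
    show hz: "h z \<in> carrier G" using yz h.hom_closed by blast
    show eq: "h (y + z) = i (f y) \<otimes>\<^bsub>G\<^esub> h z"
      using h.hom_mult [OF yz] hE that by simp
    show "p (h (y + z)) = k z"
      unfolding eq using fy hz pi hE' that by simp
  qed
  have inj: "inj_on h (carrier (free_Abelian_group (E \<union> E')))"
  proof -
    have "x = 0" if x: "Poly_Mapping.keys x \<subseteq> E \<union> E'" and hx: "h x = \<one>\<^bsub>G\<^esub>" for x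
    proof -
      obtain y z where yz: "Poly_Mapping.keys y \<subseteq> E" "Poly_Mapping.keys z \<subseteq> E'" "x = y + z"
        using split [OF x] by blast
      have "k z = \<one>\<^bsub>K\<^esub>"
        using hsplit(4) [OF yz(1,2)] hx yz(3) p.hom_one by metis
      also have "\<dots> = k 0" using k.hom_one by simp
      finally have z: "z = 0"
        using kbij yz(2) by (auto simp: bij_betw_def inj_on_def)
      then have "i (f y) = \<one>\<^bsub>G\<^esub>"
        using hx yz hE by simp
      then have "f y = \<one>\<^bsub>F\<^esub>"
        using i(2) hsplit(2) [OF yz(1,2)] by (metis i.hom_one i.G.one_closed inj_onD)
      also have "\<dots> = f 0" using f.hom_one by simp
      finally have "y = 0"
        using fbij yz(1) by (auto simp: bij_betw_def inj_on_def)
      with z yz show ?thesis by simp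
    qed
    then show ?thesis
      using h.inj_on_one_iff by simp
  qed
  have surj: "h ` carrier (free_Abelian_group (E \<union> E')) = carrier G"
  proof
    show "carrier G \<subseteq> h ` carrier (free_Abelian_group (E \<union> E'))"
    proof
      fix g assume g: "g \<in> carrier G"
      then have "p g \<in> carrier K" by simp
      then have "p g \<in> k ` carrier (free_Abelian_group E')"
        using kbij by (simp add: bij_betw_def)
      then obtain z where "z \<in> carrier (free_Abelian_group E')" "p g = k z"
        by (rule imageE)
      then have z: "Poly_Mapping.keys z \<subseteq> E'" "k z = p g" by simp_all
      have hz: "h z \<in> carrier G" "p (h z) = p g"
        using hsplit(3,4) [of 0 z] z by simp_all
      then have "p (g \<otimes>\<^bsub>G\<^esub> inv\<^bsub>G\<^esub> h z) = \<one>\<^bsub>K\<^esub>"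
        using g by simp
      then have "g \<otimes>\<^bsub>G\<^esub> inv\<^bsub>G\<^esub> h z \<in> i ` carrier F"
        using ex g hz by (auto simp: kernel_def)
      then obtain a where a: "a \<in> carrier F" "g \<otimes>\<^bsub>G\<^esub> inv\<^bsub>G\<^esub> h z = i a" by blast
      have "a \<in> f ` carrier (free_Abelian_group E)"
        using fbij a by (simp add: bij_betw_def)
      then obtain y where "y \<in> carrier (free_Abelian_group E)" "a = f y"
        by (rule imageE)
      then have y: "Poly_Mapping.keys y \<subseteq> E" "f y = a" by simp_all
      have "h (y + z) = g"
        unfolding hsplit(1) [OF y(1) z(1)] y(2) a(2) [symmetric]
        using g hz(1) by (simp add: G.m_assoc)
      moreover have "Poly_Mapping.keys (y + z) \<subseteq> E \<union> E'"
        using keys_add [of y z] y(1) z(1) by blast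
      ultimately show "g \<in> h ` carrier (free_Abelian_group (E \<union> E'))"
        by (metis carrier_free_Abelian_group_iff imageI)
    qed
  qed (use h.hom_closed in blast)
  have "h \<in> iso (free_Abelian_group (E \<union> E')) G"
    using h inj surj by (simp add: iso_def bij_betw_def)
  then show ?thesis
    unfolding is_basis_def using h(2) by blast
qed

lemma is_basis_empty:
  fixes G :: "'g monoid" and b :: "'e \<Rightarrow> 'g"
  assumes "group G" shows "is_basis G {} b \<longleftrightarrow> trivial_group G"
proof -
  let ?F = "free_Abelian_group {} :: ('e \<Rightarrow>\<^sub>0 int) monoid"
  interpret group G by fact
  have F: "trivial_group ?F"
    by (auto simp: trivial_group_def)
  have "trivial_group G" if "h \<in> iso ?F G" for h
    using that F assms isomorphic_group_triviality [of ?F G] by (auto simp: is_iso_def)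
  moreover have "(\<lambda>x. \<one>\<^bsub>G\<^esub>) \<in> iso ?F G" if "trivial_group G"
    using that by (auto simp: iso_def hom_def bij_betw_def trivial_group_def inj_on_def free_Abelian_group_def)
  ultimately show ?thesis
    unfolding is_basis_def by auto
qed

lemma is_basis_infinite_cyclic:
  assumes G: "group G" "g \<in> carrier G" and g: "(\<lambda>n::int. g [^]\<^bsub>G\<^esub> n) \<in> iso integer_group G"
  shows "is_basis G {e} (\<lambda>_. g)"
proof -
  have k: "(\<lambda>n. frag_cmul n (frag_of e)) \<in> iso integer_group (free_Abelian_group {e})"
  proof (rule isoI)
    show "bij_betw (\<lambda>n. frag_cmul n (frag_of e)) (carrier integer_group) (carrier (free_Abelian_group {e}))"
      apply (rule bij_betwI [where g = "\<lambda>y. Poly_Mapping.lookup y e"])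
      by (auto simp: integer_group_def in_keys_iff intro!: poly_mapping_eqI)
  qed (auto simp: hom_def frag_cmul_distrib)
  then obtain k' where k': "k' \<in> iso (free_Abelian_group {e}) integer_group"
     "\<And>n. k' (frag_cmul n (frag_of e)) = n"
  proof -
    let ?k = "\<lambda>n. frag_cmul n (frag_of e)"
    have "inv_into (carrier integer_group) ?k \<in> iso (free_Abelian_group {e}) integer_group"
      using group.iso_set_sym [OF _ k] by simp
    moreover have "inv_into (carrier integer_group) ?k (?k n) = n" for n
      using k by (intro inv_into_f_f) (auto simp: iso_def bij_betw_def integer_group_def)
    ultimately show thesis using that by blast
  qed
  have "(\<lambda>n::int. g [^]\<^bsub>G\<^esub> n) \<circ> k' \<in> iso (free_Abelian_group {e}) G"
    using Group.iso_set_trans [OF k'(1) g] .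
  moreover have "((\<lambda>n::int. g [^]\<^bsub>G\<^esub> n) \<circ> k') (frag_of e) = g"
    using k'(2) [of 1] G by (simp add: group.int_pow_1)
  ultimately show ?thesis unfolding is_basis_def by blast
qed

lemma is_basis_finite_rank:
  assumes "group G" "is_basis G E b" "finite E"
  shows "G \<cong> free_Abelian_group {..<card E}" "free_rank G = card E"
proof -
  have "free_Abelian_group E \<cong> G"
    using assms unfolding is_basis_def is_iso_def by blast
  then have 1: "G \<cong> free_Abelian_group E"
    by (simp add: group.iso_sym)
  moreover have "free_Abelian_group E \<cong> free_Abelian_group {..<card E}"
    unfolding isomorphic_free_Abelian_groups
    by (simp add: assms eqpoll_iff_card)
  ultimately show 2: "G \<cong> free_Abelian_group {..<card E}"
    using iso_trans by blast
  show "free_rank G = card E"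
    unfolding free_rank_def
  proof (rule the_equality)
    fix k :: nat assume "G \<cong> free_Abelian_group {..<k}"
    then have "free_Abelian_group {..<k} \<cong> free_Abelian_group {..<card E}"
      using 2 assms(1) by (meson group.iso_sym iso_trans)
    then show "k = card E"
      unfolding isomorphic_free_Abelian_groups by (simp add: eqpoll_iff_card)
  qed fact
qed

lemma DirProd_comm_group: "\<lbrakk>comm_group G; comm_group H\<rbrakk> \<Longrightarrow> comm_group (G \<times>\<times> H)"
  by (rule group.group_comm_groupI)
    (auto simp: DirProd_group comm_group.axioms comm_monoid.m_comm)

lemma is_basis_DirProd:
  assumes "comm_group G" "comm_group H" and b: "is_basis G E b" "is_basis H E' c" and disj: "E \<inter> E' = {}"
  shows "is_basis (G \<times>\<times> H) (E \<union> E') (\<lambda>e. if e \<in> E then (b e, \<one>\<^bsub>H\<^esub>) else (\<one>\<^bsub>G\<^esub>, c e))"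
proof -
  interpret G: comm_group G by fact
  interpret H: comm_group H by fact
  have GH: "comm_group (G \<times>\<times> H)"
    using assms(1,2) by (rule DirProd_comm_group)
  show ?thesis
  proof (rule is_basis_extension [where F = G and K = H and i = "\<lambda>x. (x, \<one>\<^bsub>H\<^esub>)" and p = snd])
    show "(\<lambda>x. (x, \<one>\<^bsub>H\<^esub>)) \<in> hom G (G \<times>\<times> H)"
      by (auto simp: hom_def)
    show "snd \<in> hom (G \<times>\<times> H) H"
      by (auto simp: hom_def DirProd_def)
    show "kernel (G \<times>\<times> H) H snd = (\<lambda>x. (x, \<one>\<^bsub>H\<^esub>)) ` carrier G"
      by (auto simp: kernel_def)
    show "is_basis H E' c" by fact
  next
    fix e assume "e \<in> E'"
    then have "e \<notin> E" using disj by blast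
    with \<open>e \<in> E'\<close> is_basis_closed [OF b(2)]
    show "(if e \<in> E then (b e, \<one>\<^bsub>H\<^esub>) else (\<one>\<^bsub>G\<^esub>, c e)) \<in> carrier (G \<times>\<times> H)"
      "snd (if e \<in> E then (b e, \<one>\<^bsub>H\<^esub>) else (\<one>\<^bsub>G\<^esub>, c e)) = c e"
      by auto
  qed (use assms GH in \<open>auto simp: inj_on_def\<close>)
qed


section \<open>Homology of chain complexes\<close>

text \<open>This is how cellular homology is compared with singular homology: there is no map between the two
  quotients at hand, but both are images of the homology of a skeleton.\<close>

lemma quotient_iso_same_kernel:
  assumes A: "group A" and B: "group B" and C: "group C"
    and f: "f \<in> hom A B" "f ` carrier A = carrier B"
    and g: "g \<in> hom A C" "g ` carrier A = carrier C"
    and ker: "kernel A B f = kernel A C g"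
  shows "B \<cong> C"
proof -
  interpret f: group_hom A B f using assms by (simp add: group_hom_def group_hom_axioms_def)
  interpret g: group_hom A C g using assms by (simp add: group_hom_def group_hom_axioms_def)
  have "A Mod kernel A B f \<cong> B" "A Mod kernel A B f \<cong> C"
    using f.FactGroup_iso [OF f(2)] g.FactGroup_iso [OF g(2)] ker by auto
  moreover have "group (A Mod kernel A B f)"
    by (simp add: f.normal_kernel normal.factorgroup_is_group)
  ultimately show ?thesis
    using group.iso_sym iso_trans by blast
qed

lemma hom_to_quotient:
  assumes "comm_group G" "subgroup H G"
  shows "group (G Mod H)" and "(\<lambda>x. H #>\<^bsub>G\<^esub> x) \<in> hom G (G Mod H)"
    and "(\<lambda>x. H #>\<^bsub>G\<^esub> x) ` carrier G = carrier (G Mod H)"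
    and "\<And>x. x \<in> carrier G \<Longrightarrow> H #>\<^bsub>G\<^esub> x = \<one>\<^bsub>G Mod H\<^esub> \<longleftrightarrow> x \<in> H"
proof -
  interpret G: comm_group G by fact
  have n: "H \<lhd> G" using assms G.normal_iff_subgroup by blast
  then show "group (G Mod H)" "(\<lambda>x. H #>\<^bsub>G\<^esub> x) \<in> hom G (G Mod H)"
    by (simp_all add: normal.factorgroup_is_group normal.r_coset_hom_Mod)
  show "(\<lambda>x. H #>\<^bsub>G\<^esub> x) ` carrier G = carrier (G Mod H)"
    by (auto simp: FactGroup_def RCOSETS_def)
  show "H #>\<^bsub>G\<^esub> x = \<one>\<^bsub>G Mod H\<^esub> \<longleftrightarrow> x \<in> H" if "x \<in> carrier G" for x
    using that assms(2)
    by (metis (no_types) FactGroup_def G.coset_join1 G.coset_join2 monoid.simps(2) subgroup.subset)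
qed

lemma subgroup_kernel:
  assumes "group G" "group H" "f \<in> hom G H"
  shows "subgroup (kernel G H f) G"
  using assms group_hom.subgroup_kernel by (auto simp: group_hom_def group_hom_axioms_def)

text \<open>The isomorphism matches cycles with cycles and boundaries with boundaries. That these form subgroups
  of \<open>C\<close> is transported from \<open>D\<close>.\<close>

lemma chain_homology_iso:
  fixes C :: "'g chain_complex" and D :: "'h chain_complex"
  assumes iso: "chain_isomorphism C D \<phi>"
    and C: "\<And>n. group (chains C n)"
      "\<And>n x. x \<in> carrier (chains C n) \<Longrightarrow> boundary C n x \<in> carrier (chains C (n - 1))"
    and D: "\<And>n. comm_group (chains D n)"
      "\<And>n. boundary D n \<in> hom (chains D n) (chains D (n - 1))"
      "\<And>n x. x \<in> carrier (chains D n) \<Longrightarrow> boundary D (n - 1) (boundary D n x) = \<one>\<^bsub>chains D (n - 2)\<^esub>"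
  shows "chain_homology D n \<cong> chain_homology C n"
proof -
  have \<phi>: "\<phi> n \<in> iso (chains C n) (chains D n)" for n
    using iso by (simp add: chain_isomorphism_def)
  have comm: "\<phi> (n - 1) (boundary C n x) = boundary D n (\<phi> n x)" if "x \<in> carrier (chains C n)" for n x
    using that iso by (simp add: chain_isomorphism_def)
  have grpD: "group (chains D n)" for n
    using D(1) by (simp add: comm_group.axioms(2))
  have \<phi>_hom: "\<phi> n \<in> hom (chains C n) (chains D n)" and
    \<phi>_bij: "bij_betw (\<phi> n) (carrier (chains C n)) (carrier (chains D n))" for n
    using \<phi> by (auto simp: iso_def)
  interpret \<phi>: group_hom "chains C k" "chains D k" "\<phi> k" for k
    using \<phi>_hom grpD C(1) by (simp add: group_hom_def group_hom_axioms_def)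
  have one_iff: "\<phi> m y = \<one>\<^bsub>chains D m\<^esub> \<longleftrightarrow> y = \<one>\<^bsub>chains C m\<^esub>" if "y \<in> carrier (chains C m)" for m y
    using that \<phi>_bij [of m] by (metis \<phi>.G.one_closed \<phi>.hom_one bij_betw_def inj_onD)
  define ZC where "ZC = kernel (chains C n) (chains C (n - 1)) (boundary C n)"
  define ZD where "ZD = kernel (chains D n) (chains D (n - 1)) (boundary D n)"
  have Z_iff: "x \<in> ZC \<longleftrightarrow> x \<in> carrier (chains C n) \<and> \<phi> n x \<in> ZD" for x
  proof (cases "x \<in> carrier (chains C n)")
    case True
    then have "boundary C n x = \<one>\<^bsub>chains C (n - 1)\<^esub> \<longleftrightarrow> boundary D n (\<phi> n x) = \<one>\<^bsub>chains D (n - 1)\<^esub>"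
      using comm [OF True] one_iff [OF C(2) [OF True]] by metis
    with True show ?thesis by (simp add: ZC_def ZD_def kernel_def)
  qed (simp add: ZC_def kernel_def)
  have \<phi>Z: "\<phi> n ` ZC = ZD"
  proof
    show "ZD \<subseteq> \<phi> n ` ZC"
    proof
      fix y assume "y \<in> ZD"
      then have "y \<in> carrier (chains D n)" by (simp add: ZD_def kernel_def)
      then obtain x where "x \<in> carrier (chains C n)" "y = \<phi> n x"
        using \<phi>_bij [of n] by (auto simp: bij_betw_def)
      then show "y \<in> \<phi> n ` ZC" using Z_iff \<open>y \<in> ZD\<close> by blast
    qed
  qed (use Z_iff in auto)
  have ZD: "subgroup ZD (chains D n)"
    unfolding ZD_def by (rule subgroup_kernel [OF grpD grpD D(2)])
  have ZC: "subgroup ZC (chains C n)"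
  proof -
    have "ZC = {x \<in> carrier (chains C n). \<phi> n x \<in> ZD}" using Z_iff by auto
    moreover have "subgroup {x \<in> carrier (chains C n). \<phi> n x \<in> ZD} (chains C n)"
    proof (rule \<phi>.G.subgroupI)
      show "{x \<in> carrier (chains C n). \<phi> n x \<in> ZD} \<noteq> {}"
        using subgroup.one_closed [OF ZD] \<phi>.G.one_closed \<phi>.hom_one by force
    qed (use ZD in \<open>auto simp: subgroup.m_inv_closed subgroup.m_closed\<close>)
    ultimately show ?thesis by simp
  qed
  define GC where "GC = subgroup_generated (chains C n) ZC"
  define GD where "GD = subgroup_generated (chains D n) ZD"
  have cGC: "carrier GC = ZC" and cGD: "carrier GD = ZD"
    unfolding GC_def GD_def
    using ZC ZD C(1) grpD by (simp_all add: subgroup.carrier_subgroup_generated_subgroup)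
  have GC: "group GC" and GD: "comm_group GD"
    unfolding GC_def GD_def
    by (auto simp: group.group_subgroup_generated C(1) grpD D(1) group.abelian_subgroup_generated)
  define BC where "BC = boundary C (n + 1) ` carrier (chains C (n + 1))"
  define BD where "BD = boundary D (n + 1) ` carrier (chains D (n + 1))"
  have dD: "boundary D (n + 1) \<in> hom (chains D (n + 1)) (chains D n)"
    using D(2) [of "n + 1"] by simp
  have BD_Z: "BD \<subseteq> ZD"
  proof -
    have "boundary D n (boundary D (n + 1) x) = \<one>\<^bsub>chains D (n - 1)\<^esub>"
       "boundary D (n + 1) x \<in> carrier (chains D n)"
      if "x \<in> carrier (chains D (n + 1))" for x
      using D(3) [OF that] dD that by (auto simp: hom_def)
    then show ?thesis unfolding BD_def ZD_def kernel_def by auto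
  qed
  have BD_sub: "subgroup BD (chains D n)"
    unfolding BD_def using dD grpD
    by (intro group_hom.img_is_subgroup) (simp add: group_hom_def group_hom_axioms_def)
  have BD: "subgroup BD GD"
    unfolding GD_def using BD_Z BD_sub grpD by (simp add: group.subgroup_of_subgroup_generated)
  have BC_iff: "x \<in> BC \<longleftrightarrow> \<phi> n x \<in> BD" if x: "x \<in> carrier (chains C n)" for x
  proof
    assume "x \<in> BC"
    then obtain y where y: "y \<in> carrier (chains C (n + 1))" "x = boundary C (n + 1) y"
      unfolding BC_def by blast
    then show "\<phi> n x \<in> BD"
      using comm [OF y(1)] by (simp add: BD_def)
  next
    assume "\<phi> n x \<in> BD"
    then obtain z where z: "z \<in> carrier (chains D (n + 1))" "\<phi> n x = boundary D (n + 1) z"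
      unfolding BD_def by blast
    obtain y where y: "y \<in> carrier (chains C (n + 1))" "z = \<phi> (n + 1) y"
      using z \<phi>_bij [of "n + 1"] by (auto simp: bij_betw_def)
    have "boundary C (n + 1) y \<in> carrier (chains C n)"
      using C(2) [OF y(1)] by simp
    moreover have "\<phi> n (boundary C (n + 1) y) = \<phi> n x"
      using comm [OF y(1)] z y by simp
    ultimately have "x = boundary C (n + 1) y"
      using x \<phi>_bij [of n] by (metis bij_betw_def inj_onD)
    then show "x \<in> BC" using y by (simp add: BC_def)
  qed
  have BC_Z: "BC \<subseteq> ZC"
  proof
    fix x assume x: "x \<in> BC"
    then have "x \<in> carrier (chains C n)"
      using C(2) [of _ "n + 1"] unfolding BC_def by auto
    then show "x \<in> ZC" using BC_iff x BD_Z Z_iff by blast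
  qed
  let ?\<pi> = "\<lambda>x. BD #>\<^bsub>GD\<^esub> x"
  note q = hom_to_quotient [OF GD BD]
  have \<phi>G: "\<phi> n \<in> hom GC GD"
    using \<phi>_hom [of n] cGC cGD \<phi>Z Z_iff unfolding hom_def GC_def GD_def by auto
  then have hom: "?\<pi> \<circ> \<phi> n \<in> hom GC (GD Mod BD)"
    using q(2) hom_compose by blast
  have surj: "(?\<pi> \<circ> \<phi> n) ` carrier GC = carrier (GD Mod BD)"
    using q(3) cGC cGD \<phi>Z by (metis image_comp)
  have ker: "kernel GC (GD Mod BD) (?\<pi> \<circ> \<phi> n) = BC"
  proof -
    have "x \<in> kernel GC (GD Mod BD) (?\<pi> \<circ> \<phi> n) \<longleftrightarrow> x \<in> BC" for x
      using q(4) [of "\<phi> n x"] BC_Z BC_iff [of x] Z_iff cGC cGD by (auto simp: kernel_def)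
    then show ?thesis by blast
  qed
  interpret q: group_hom GC "GD Mod BD" "?\<pi> \<circ> \<phi> n"
    using hom GC q(1) by (simp add: group_hom_def group_hom_axioms_def)
  have "GC Mod kernel GC (GD Mod BD) (?\<pi> \<circ> \<phi> n) \<cong> GD Mod BD"
    by (rule q.FactGroup_iso [OF surj])
  then have "GC Mod BC \<cong> GD Mod BD"
    by (simp only: ker)
  moreover have "group (GC Mod BC)"
    using normal.factorgroup_is_group [OF q.normal_kernel] by (simp only: ker)
  ultimately have "GD Mod BD \<cong> GC Mod BC"
    by (simp add: group.iso_sym)
  then show ?thesis
    unfolding chain_homology_def GC_def GD_def BC_def BD_def ZC_def ZD_def .
qed

lemma chain_isomorphism_sym:
  assumes iso: "chain_isomorphism C D \<phi>"
    and C: "\<And>n. group (chains C n)"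
      "\<And>n x. x \<in> carrier (chains C n) \<Longrightarrow> boundary C n x \<in> carrier (chains C (n - 1))"
  shows "D \<cong>\<^sub>c C"
proof -
  define \<psi> where "\<psi> n = inv_into (carrier (chains C n)) (\<phi> n)" for n
  have \<phi>: "\<phi> n \<in> iso (chains C n) (chains D n)" for n
    using iso by (simp add: chain_isomorphism_def)
  have \<psi>: "\<psi> n \<in> iso (chains D n) (chains C n)" for n
    unfolding \<psi>_def using C(1) \<phi> by (rule group.iso_set_sym)
  have bij: "bij_betw (\<phi> n) (carrier (chains C n)) (carrier (chains D n))" for n
    using \<phi> by (auto simp: iso_def)
  have \<psi>\<phi>: "\<psi> n (\<phi> n x) = x" if "x \<in> carrier (chains C n)" for n x
    unfolding \<psi>_def using bij that by (simp add: bij_betw_def)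
  have "\<psi> (n - 1) (boundary D n y) = boundary C n (\<psi> n y)" if "y \<in> carrier (chains D n)" for n y
  proof -
    have "y \<in> \<phi> n ` carrier (chains C n)"
      using bij [of n] that by (simp add: bij_betw_def)
    then obtain x where x: "y = \<phi> n x" "x \<in> carrier (chains C n)"
      by (rule imageE)
    then have "boundary D n y = \<phi> (n - 1) (boundary C n x)"
      using iso by (metis chain_isomorphism_def)
    then show ?thesis
      using \<psi>\<phi> [OF x(2)] \<psi>\<phi> [OF C(2) [OF x(2)]] x(1) by argo
  qed
  then have "chain_isomorphism D C \<psi>"
    using \<psi> by (simp add: chain_isomorphism_def)
  then show ?thesis unfolding chain_complexes_isomorphic_def by blast
qed

section \<open>Prisms and the suspension of a relative homology class\<close>

abbreviation cylinder :: "'a topology \<Rightarrow> ('a \<times> real) topology" where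
  "cylinder X \<equiv> prod_topology X (top_of_set {0..1})"

abbreviation simplex_space :: "nat \<Rightarrow> (nat \<Rightarrow> real) topology" where
  "simplex_space p \<equiv> subtopology (powertop_real UNIV) (standard_simplex p)"

definition identity_simplex :: "nat \<Rightarrow> (nat \<Rightarrow> real) chain" where
  "identity_simplex p = frag_of (restrict id (standard_simplex p))"

lemma continuous_map_cylinder:
  "continuous_map X Y f \<Longrightarrow> continuous_map (cylinder X) (cylinder Y) (map_prod f id)"
  by (simp add: map_prod_def continuous_map_prod_top)

lemma continuous_map_bottom: "continuous_map X (cylinder X) (\<lambda>x. (x, 0))"
  and continuous_map_top: "continuous_map X (cylinder X) (\<lambda>x. (x, 1))"
  by (auto simp: continuous_map_pairwise comp_def)

text \<open>A chain \<open>m\<close> on the cylinder over the standard simplex can be pushed forward along every singular simplex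
  of \<open>X\<close>. This turns \<open>p\<close>-chains on \<open>X\<close> into \<open>(p + 1)\<close>-chains on the cylinder over \<open>X\<close>, naturally in
  \<open>X\<close>.\<close>

definition prism_of :: "nat \<Rightarrow> ((nat \<Rightarrow> real) \<times> real) chain \<Rightarrow> 'a chain \<Rightarrow> ('a \<times> real) chain" where
  "prism_of p m c = frag_extend (\<lambda>\<sigma>. chain_map (Suc p) (map_prod \<sigma> id) m) c"

definition prism_ends :: "nat \<Rightarrow> ((nat \<Rightarrow> real) \<times> real) chain" where
  "prism_ends p = chain_map p (\<lambda>x. (x, 1)) (identity_simplex p) - chain_map p (\<lambda>x. (x, 0)) (identity_simplex p)"

text \<open>Acyclic models take the place of an explicit triangulation of the prism. The right-hand sides are
  cycles on the contractible cylinder over a simplex, hence boundaries, and any filling will do.\<close>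

primrec prism_model :: "nat \<Rightarrow> ((nat \<Rightarrow> real) \<times> real) chain" where
  "prism_model 0 = (SOME m. singular_chain (Suc 0) (cylinder (simplex_space 0)) m \<and>
     chain_boundary (Suc 0) m = prism_ends 0)"
| "prism_model (Suc p) = (SOME m. singular_chain (Suc (Suc p)) (cylinder (simplex_space (Suc p))) m \<and>
     chain_boundary (Suc (Suc p)) m = prism_ends (Suc p) -
       prism_of p (prism_model p) (chain_boundary (Suc p) (identity_simplex (Suc p))))"

definition prism :: "nat \<Rightarrow> 'a chain \<Rightarrow> ('a \<times> real) chain" where
  "prism p = prism_of p (prism_model p)"

lemma prism_of_0 [simp]: "prism_of p m 0 = 0"
  and prism_of_add: "prism_of p m (a + b) = prism_of p m a + prism_of p m b"
  and prism_of_diff: "prism_of p m (a - b) = prism_of p m a - prism_of p m b"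
  and prism_of_frag_of: "prism_of p m (frag_of \<sigma>) = chain_map (Suc p) (map_prod \<sigma> id) m"
  by (simp_all add: prism_of_def frag_extend_add frag_extend_diff)

lemma singular_simplex_imp_continuous:
  "singular_simplex p X \<sigma> \<Longrightarrow> continuous_map (simplex_space p) X \<sigma>"
  by (simp add: singular_simplex_def)

lemma singular_chain_prism_of:
  assumes m: "singular_chain (Suc p) (cylinder (simplex_space p)) m" and c: "singular_chain p X c"
  shows "singular_chain (Suc p) (cylinder X) (prism_of p m c)"
  unfolding prism_of_def
proof (rule singular_chain_extend)
  fix \<sigma> assume "\<sigma> \<in> Poly_Mapping.keys c"
  then have "singular_simplex p X \<sigma>" using c by (auto simp: singular_chain_def)
  then show "singular_chain (Suc p) (cylinder X) (chain_map (Suc p) (map_prod \<sigma> id) m)"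
    by (intro singular_chain_chain_map [OF m] continuous_map_cylinder singular_simplex_imp_continuous)
qed

lemma prism_of_chain_map:
  assumes m: "singular_chain (Suc p) (cylinder (simplex_space p)) m" and c: "singular_chain p X c"
  shows "prism_of p m (chain_map p f c) = chain_map (Suc p) (map_prod f id) (prism_of p m c)"
  using c unfolding singular_chain_def
proof (induction c rule: frag_induction)
  case (one \<sigma>)
  have "chain_map (Suc p) (map_prod (simplex_map p f \<sigma>) id) m = chain_map (Suc p) (map_prod f id \<circ> map_prod \<sigma> id) m"
    by (rule chain_map_eq [OF m]) (auto simp: simplex_map_def)
  then show ?case
    by (simp only: prism_of_frag_of chain_map_of chain_map_compose comp_apply)
qed (simp_all add: prism_of_diff chain_map_diff)

lemma identity_simplex_chain: "singular_chain p (simplex_space p) (identity_simplex p)"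
  by (auto simp: identity_simplex_def singular_chain_of singular_simplex_def)

text \<open>The prism formula for one simplex follows from the formula for the identity simplex by
  naturality.\<close>

lemma chain_boundary_prism_of:
  assumes m: "singular_chain (Suc p) (cylinder (simplex_space p)) m"
    and m': "p > 0 \<Longrightarrow> singular_chain p (cylinder (simplex_space (p - 1))) m'"
    and bd: "chain_boundary (Suc p) m = prism_ends p - prism_of (p - 1) m' (chain_boundary p (identity_simplex p))"
    and c: "singular_chain p X c"
  shows "chain_boundary (Suc p) (prism_of p m c) =
    chain_map p (\<lambda>x. (x, 1)) c - chain_map p (\<lambda>x. (x, 0)) c - prism_of (p - 1) m' (chain_boundary p c)"
  using c unfolding singular_chain_def
proof (induction c rule: frag_induction)
  case (one \<sigma>)
  then have \<sigma>: "singular_simplex p X \<sigma>" by simp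
  let ?\<iota> = "identity_simplex p"
  have \<sigma>\<iota>: "chain_map p \<sigma> ?\<iota> = frag_of \<sigma>"
    unfolding identity_simplex_def by (rule singular_simplex_chain_map_id [OF \<sigma>])
  have ends: "chain_map p (map_prod \<sigma> id) (chain_map p (\<lambda>x. (x, t)) ?\<iota>) = chain_map p (\<lambda>x. (x, t)) (frag_of \<sigma>)" for t :: real
  proof -
    have "map_prod \<sigma> id \<circ> (\<lambda>x. (x, t)) = (\<lambda>x. (x, t)) \<circ> \<sigma>"
      by (simp add: fun_eq_iff)
    then have "(chain_map p (map_prod \<sigma> id) \<circ> chain_map p (\<lambda>x. (x, t))) ?\<iota> = (chain_map p (\<lambda>x. (x, t)) \<circ> chain_map p \<sigma>) ?\<iota>"
      by (simp only: chain_map_compose [symmetric])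
    then show ?thesis by (simp only: comp_apply \<sigma>\<iota>)
  qed
  have side: "chain_map p (map_prod \<sigma> id) (prism_of (p - 1) m' (chain_boundary p ?\<iota>)) =
      prism_of (p - 1) m' (chain_boundary p (frag_of \<sigma>))"
  proof (cases "p = 0")
    case True
    then show ?thesis by (simp add: chain_boundary_def)
  next
    case False
    then have p: "Suc (p - 1) = p" by simp
    have "prism_of (p - 1) m' (chain_map (p - 1) \<sigma> (chain_boundary p ?\<iota>)) =
       chain_map (Suc (p - 1)) (map_prod \<sigma> id) (prism_of (p - 1) m' (chain_boundary p ?\<iota>))"
      using m' False singular_chain_boundary [OF identity_simplex_chain]
      by (intro prism_of_chain_map [where X = "simplex_space p"]) auto
    moreover have "chain_map (p - 1) \<sigma> (chain_boundary p ?\<iota>) = chain_boundary p (frag_of \<sigma>)"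
      using chain_boundary_chain_map [OF identity_simplex_chain [of p], where g = \<sigma>] \<sigma>\<iota> by simp
    ultimately show ?thesis unfolding p by simp
  qed
  have "chain_boundary (Suc p) (prism_of p m (frag_of \<sigma>)) = chain_map p (map_prod \<sigma> id) (chain_boundary (Suc p) m)"
    unfolding prism_of_frag_of using chain_boundary_chain_map [OF m] by simp
  then show ?case
    unfolding bd prism_ends_def chain_map_diff ends side .
qed (simp_all add: prism_of_diff chain_map_diff chain_boundary_diff)

lemma contractible_simplex_space: "contractible_space (simplex_space p)"
proof -
  obtain v where v: "v \<in> standard_simplex p" using nonempty_standard_simplex by blast
  define h where "h = (\<lambda>(t::real, x::nat \<Rightarrow> real) i. (1 - t) * x i + t * v i)"
  have "continuous_map (prod_topology (top_of_set {0..1}) (simplex_space p)) (powertop_real UNIV) h"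
    unfolding continuous_map_componentwise_UNIV
  proof
    fix k
    have [simp]: "continuous_map (prod_topology (top_of_set {0..1::real}) (simplex_space p)) euclideanreal (\<lambda>z. snd z k)"
      using continuous_map_compose [OF continuous_map_snd [of "top_of_set {0..1::real}" "simplex_space p"],
          of euclideanreal "\<lambda>x. x k"]
        continuous_map_product_projection [of k UNIV "\<lambda>_. euclideanreal"]
      by (simp add: comp_def continuous_map_from_subtopology)
    have [simp]: "continuous_map (prod_topology (top_of_set {0..1}) (simplex_space p)) euclideanreal (fst :: real \<times> (nat \<Rightarrow> real) \<Rightarrow> real)"
      by (meson continuous_map_fst continuous_map_in_subtopology)
    show "continuous_map (prod_topology (top_of_set {0..1}) (simplex_space p)) euclideanreal (\<lambda>z. h z k)"
      unfolding h_def case_prod_unfold by (intro continuous_intros) auto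
  qed
  moreover have "h (t, x) \<in> standard_simplex p" if "t \<in> {0..1}" "x \<in> standard_simplex p" for t x
    using convex_standard_simplex [OF that(2) v] that(1) by (simp add: h_def)
  ultimately have "continuous_map (prod_topology (top_of_set {0..1}) (simplex_space p)) (simplex_space p) h"
    by (auto simp: continuous_map_in_subtopology)
  moreover have "h (0, x) = id x" "h (1, x) = v" for x
    by (auto simp: h_def)
  ultimately have "homotopic_with (\<lambda>x. True) (simplex_space p) (simplex_space p) id (\<lambda>x. v)"
    unfolding homotopic_with_def by blast
  then show ?thesis unfolding contractible_space_def by blast
qed

lemma contractible_simplex_cylinder: "contractible_space (cylinder (simplex_space p))"
proof -
  have "contractible_space (top_of_set {0..1::real})"
    by (simp only: contractible_space_top_of_set convex_imp_contractible convex_real_interval)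
  then show ?thesis
    by (simp only: contractible_space_prod_topology contractible_simplex_space simp_thms)
qed

text \<open>In degree \<open>0\<close> this fails, as the homology of a point is not trivial there; the base case of the
  recursion rests on path-connectedness instead.\<close>

lemma contractible_cycle_is_boundary:
  assumes X: "contractible_space X" and p: "p > 0" and z: "singular_chain p X z" "chain_boundary p z = 0"
  obtains d where "singular_chain (Suc p) X d" "chain_boundary (Suc p) d = z"
proof -
  have "trivial_group (homology_group (int p) X)"
  proof (cases "topspace X = {}")
    case True
    then show ?thesis by (rule trivial_homology_group_empty)
  next
    case False
    then obtain a where "X homotopy_equivalent_space subtopology X {a}" "a \<in> topspace X"
      using X by (auto simp: contractible_eq_homotopy_equivalent_singleton_subtopology)
    then have "homology_group (int p) X \<cong> homology_group (int p) (subtopology X {a})"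
      and "trivial_group (homology_group (int p) (subtopology X {a}))"
      using p by (auto simp: homotopy_equivalent_space_imp_isomorphic_homology_groups
           intro!: homology_dimension_axiom)
    then show ?thesis
      by (metis group_relative_homology_group isomorphic_group_triviality)
  qed
  moreover have "homologous_rel_set p X {} z \<in> carrier (homology_group (int p) X)"
    using z by (simp add: carrier_relative_homology_group singular_cycle)
  ultimately have "homologous_rel_set p X {} z = singular_relboundary_set p X {}"
    by (simp only: trivial_group_def one_relative_homology_group singleton_iff)
  then have "singular_relboundary p X {} z"
    by (simp only: homologous_rel_set_eq_relboundary)
  then show ?thesis using that by (auto simp: singular_boundary)
qed

lemma prism_ends_chain: "singular_chain p (cylinder (simplex_space p)) (prism_ends p)"
  unfolding prism_ends_def
  by (intro singular_chain_diff singular_chain_chain_map [OF identity_simplex_chain]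
       continuous_map_bottom continuous_map_top)

text \<open>The chain to be filled is a cycle, because by the formula in the previous degree the prism over the
  boundary of the simplex has the same boundary as the difference of the two ends.\<close>

lemma prism_model:
  "singular_chain (Suc p) (cylinder (simplex_space p)) (prism_model p) \<and>
   chain_boundary (Suc p) (prism_model p) =
     prism_ends p - prism_of (p - 1) (prism_model (p - 1)) (chain_boundary p (identity_simplex p))"
proof (induction p rule: less_induct)
  case (less p)
  show ?case
  proof (cases p)
    case 0
    let ?X = "cylinder (simplex_space 0)"
    have "homologous_rel 0 ?X {} (frag_of (simplex_map 0 (\<lambda>x. (x, 1)) (restrict id (standard_simplex 0))))
        (frag_of (simplex_map 0 (\<lambda>x. (x, 0)) (restrict id (standard_simplex 0))))"
    proof (rule iso_integer_zeroth_homology_group_aux)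
      show "path_connected_space ?X"
        by (simp add: contractible_imp_path_connected_space contractible_simplex_cylinder)
    qed (rule singular_simplex_simplex_map [of 0 "simplex_space 0"];
        auto simp: singular_simplex_def continuous_map_bottom continuous_map_top)+
    then have "\<exists>m. singular_chain (Suc 0) ?X m \<and> chain_boundary (Suc 0) m = prism_ends 0"
      by (simp add: homologous_rel_def singular_boundary prism_ends_def identity_simplex_def)
    from someI_ex [OF this] show ?thesis
      unfolding 0 by (simp add: chain_boundary_def)
  next
    case (Suc q)
    let ?X = "cylinder (simplex_space (Suc q))" and ?\<iota> = "identity_simplex (Suc q)"
    let ?z = "prism_ends (Suc q) - prism_of q (prism_model q) (chain_boundary (Suc q) ?\<iota>)"
    have IH: "singular_chain (Suc q) (cylinder (simplex_space q)) (prism_model q)"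
      "chain_boundary (Suc q) (prism_model q) =
         prism_ends q - prism_of (q - 1) (prism_model (q - 1)) (chain_boundary q (identity_simplex q))"
      "q > 0 \<Longrightarrow> singular_chain q (cylinder (simplex_space (q - 1))) (prism_model (q - 1))"
      using less.IH [of q] less.IH [of "q - 1"] Suc by auto
    have b\<iota>: "singular_chain q (simplex_space (Suc q)) (chain_boundary (Suc q) ?\<iota>)"
      using singular_chain_boundary [OF identity_simplex_chain [of "Suc q"]] by simp
    have z: "singular_chain (Suc q) ?X ?z"
      by (intro singular_chain_diff prism_ends_chain singular_chain_prism_of IH b\<iota>)
    have "chain_boundary (Suc q) (prism_of q (prism_model q) (chain_boundary (Suc q) ?\<iota>)) =
       chain_map q (\<lambda>x. (x, 1)) (chain_boundary (Suc q) ?\<iota>) - chain_map q (\<lambda>x. (x, 0)) (chain_boundary (Suc q) ?\<iota>)"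
      using chain_boundary_prism_of [OF IH(1,3,2) b\<iota>]
        chain_boundary_boundary_alt [OF identity_simplex_chain [of "Suc q"]] by simp
    moreover have "chain_boundary (Suc q) (prism_ends (Suc q)) =
       chain_map q (\<lambda>x. (x, 1)) (chain_boundary (Suc q) ?\<iota>) - chain_map q (\<lambda>x. (x, 0)) (chain_boundary (Suc q) ?\<iota>)"
      unfolding prism_ends_def chain_boundary_diff
      using chain_boundary_chain_map [OF identity_simplex_chain [of "Suc q"], where g = "\<lambda>x. (x, 1::real)"]
        chain_boundary_chain_map [OF identity_simplex_chain [of "Suc q"], where g = "\<lambda>x. (x, 0::real)"] by simp
    ultimately have "chain_boundary (Suc q) ?z = 0"
      by (simp add: chain_boundary_diff)
    then obtain m where "singular_chain (Suc (Suc q)) ?X m" "chain_boundary (Suc (Suc q)) m = ?z"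
      using contractible_cycle_is_boundary [OF contractible_simplex_cylinder _ z] by auto
    then have "\<exists>m. singular_chain (Suc (Suc q)) ?X m \<and> chain_boundary (Suc (Suc q)) m = ?z" by blast
    from someI_ex [OF this] show ?thesis
      unfolding Suc by simp
  qed
qed

lemma prism_0 [simp]: "prism p 0 = 0"
  and prism_add: "prism p (a + b) = prism p a + prism p b"
  and prism_diff: "prism p (a - b) = prism p a - prism p b"
  by (simp_all add: prism_def prism_of_add prism_of_diff)

lemma singular_chain_prism:
  "singular_chain p X c \<Longrightarrow> singular_chain (Suc p) (cylinder X) (prism p c)"
  unfolding prism_def using singular_chain_prism_of prism_model by blast

lemma prism_chain_map:
  "singular_chain p X c \<Longrightarrow> prism p (chain_map p f c) = chain_map (Suc p) (map_prod f id) (prism p c)"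
  unfolding prism_def using prism_of_chain_map prism_model by blast

text \<open>The prism operator is a chain homotopy between the two ends. In degree \<open>0\<close> the last term vanishes together with
  \<open>chain_boundary 0\<close>, so the truncated difference does no harm.\<close>

lemma chain_boundary_prism:
  assumes "singular_chain p X c"
  shows "chain_boundary (Suc p) (prism p c) =
    chain_map p (\<lambda>x. (x, 1)) c - chain_map p (\<lambda>x. (x, 0)) c - prism (p - 1) (chain_boundary p c)"
  unfolding prism_def
proof (rule chain_boundary_prism_of [OF _ _ _ assms])
  show "singular_chain p (cylinder (simplex_space (p - 1))) (prism_model (p - 1))" if "p > 0"
    using prism_model [of "p - 1"] that by simp
qed (use prism_model in auto)

text \<open>The two ends and the side over \<open>A\<close>. For \<open>X\<close> a disc and \<open>A\<close> its boundary sphere, this is the boundary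
  sphere of the cylinder as a disc of one dimension more.\<close>

definition cylinder_boundary :: "'a topology \<Rightarrow> 'a set \<Rightarrow> ('a \<times> real) set" where
  "cylinder_boundary X A = {(x, t). x \<in> topspace X \<and> t \<in> {0..1} \<and> (t = 0 \<or> t = 1 \<or> x \<in> A)}"

lemma singular_chain_continuous_id:
  "\<lbrakk>singular_chain p X c; continuous_map X Y id\<rbrakk> \<Longrightarrow> singular_chain p Y c"
  by (metis chain_map_ident singular_chain_chain_map)

lemma continuous_map_cylinder_boundary:
  "continuous_map X (subtopology (cylinder X) (cylinder_boundary X A)) (\<lambda>x. (x, 0))"
  "continuous_map X (subtopology (cylinder X) (cylinder_boundary X A)) (\<lambda>x. (x, 1))"
  "continuous_map (cylinder (subtopology X A)) (subtopology (cylinder X) (cylinder_boundary X A)) id"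
proof -
  have "continuous_map (cylinder (subtopology X A)) (cylinder X) (map_prod id id)"
    by (rule continuous_map_cylinder) (simp add: continuous_map_from_subtopology)
  then show "continuous_map (cylinder (subtopology X A)) (subtopology (cylinder X) (cylinder_boundary X A)) id"
    by (auto simp: continuous_map_in_subtopology cylinder_boundary_def map_prod.id)
qed (auto simp: continuous_map_in_subtopology continuous_map_bottom continuous_map_top cylinder_boundary_def)

lemma singular_chain_prism_side:
  assumes "singular_chain (p - 1) (subtopology X A) (chain_boundary p c)"
  shows "singular_chain p (subtopology (cylinder X) (cylinder_boundary X A)) (prism (p - 1) (chain_boundary p c))"
proof (cases "p = 0")
  case False
  then show ?thesis
    using singular_chain_continuous_id [OF singular_chain_prism [OF assms] continuous_map_cylinder_boundary(3)]
    by simp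
qed (simp add: chain_boundary_def)

lemma singular_relcycle_prism:
  assumes c: "singular_relcycle p X A c"
  shows "singular_relcycle (Suc p) (cylinder X) (cylinder_boundary X A) (prism p c)"
proof -
  have c': "singular_chain p X c" "singular_chain (p - 1) (subtopology X A) (chain_boundary p c)"
    using c by (auto simp: singular_relcycle)
  have "singular_chain p (subtopology (cylinder X) (cylinder_boundary X A)) (chain_boundary (Suc p) (prism p c))"
    unfolding chain_boundary_prism [OF c'(1)]
    by (intro singular_chain_diff singular_chain_prism_side
        singular_chain_chain_map [OF c'(1) continuous_map_cylinder_boundary(1)]
        singular_chain_chain_map [OF c'(1) continuous_map_cylinder_boundary(2)] c')
  then show ?thesis
    using singular_chain_prism [OF c'(1)] by (simp add: singular_relcycle)
qed

lemma singular_relboundary_prism: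
  assumes "singular_relboundary p X A c"
  shows "singular_relboundary (Suc p) (cylinder X) (cylinder_boundary X A) (prism p c)"
proof -
  obtain d e where d: "singular_chain (Suc p) X d" and e: "singular_chain p (subtopology X A) e"
    and c: "chain_boundary (Suc p) d + e = c"
    using assms by (auto simp: singular_relboundary)
  let ?e = "chain_map (Suc p) (\<lambda>x. (x, 1)) d - chain_map (Suc p) (\<lambda>x. (x, 0)) d + prism p e"
  have "prism p c = chain_boundary (Suc (Suc p)) (- prism (Suc p) d) + ?e"
    unfolding c [symmetric] prism_add chain_boundary_minus chain_boundary_prism [OF d] by simp
  moreover have "singular_chain (Suc (Suc p)) (cylinder X) (- prism (Suc p) d)"
    using singular_chain_prism [OF d] by (simp add: singular_chain_minus)
  moreover have "singular_chain (Suc p) (subtopology (cylinder X) (cylinder_boundary X A)) ?e"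
    by (intro singular_chain_add singular_chain_diff
        singular_chain_continuous_id [OF singular_chain_prism [OF e] continuous_map_cylinder_boundary(3)]
        singular_chain_chain_map [OF d continuous_map_cylinder_boundary(1)]
        singular_chain_chain_map [OF d continuous_map_cylinder_boundary(2)])
  ultimately show ?thesis unfolding singular_relboundary by metis
qed

lemma homologous_rel_set_hom:
  "homologous_rel_set p X A \<in> hom (relcycle_group p X A) (relative_homology_group (int p) X A)"
  using normal.r_coset_hom_Mod [OF normal_subgroup_singular_relboundary_relcycle, of p X A]
  by (simp add: relative_homology_group_def right_coset_singular_relboundary)

lemma homologous_rel_set_closed:
  "singular_relcycle p X A c \<Longrightarrow> homologous_rel_set p X A c \<in> carrier (relative_homology_group (int p) X A)"
  by (auto simp: carrier_relative_homology_group)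

lemma homologous_rel_set_add:
  "\<lbrakk>singular_relcycle p X A a; singular_relcycle p X A b\<rbrakk> \<Longrightarrow>
    homologous_rel_set p X A (a + b) =
      homologous_rel_set p X A a \<otimes>\<^bsub>relative_homology_group (int p) X A\<^esub> homologous_rel_set p X A b"
  using homologous_rel_set_hom [of p X A] by (auto simp: hom_def)

lemma homologous_rel_set_0:
  "homologous_rel_set p X A 0 = \<one>\<^bsub>relative_homology_group (int p) X A\<^esub>"
  by (simp add: homologous_rel_set_eq_relboundary)

lemma homologous_rel_set_minus:
  assumes "singular_relcycle p X A a"
  shows "homologous_rel_set p X A (- a) = inv\<^bsub>relative_homology_group (int p) X A\<^esub> (homologous_rel_set p X A a)"
proof -
  have "homologous_rel_set p X A (- a) \<otimes>\<^bsub>relative_homology_group (int p) X A\<^esub> homologous_rel_set p X A a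
    = \<one>\<^bsub>relative_homology_group (int p) X A\<^esub>"
    using homologous_rel_set_add [of p X A "- a" a] assms
    by (simp add: singular_relcycle_minus homologous_rel_set_0 del: one_relative_homology_group)
  then show ?thesis
    using assms group.inv_equality [OF group_relative_homology_group]
    by (metis homologous_rel_set_closed singular_relcycle_minus)
qed

lemma homologous_rel_set_combination:
  assumes "singular_relcycle p X A a" "singular_relcycle p X A b" "singular_relcycle p X A d"
  shows "homologous_rel_set p X A ((a + - b) + - d) =
    (homologous_rel_set p X A a \<otimes>\<^bsub>relative_homology_group (int p) X A\<^esub>
      inv\<^bsub>relative_homology_group (int p) X A\<^esub> homologous_rel_set p X A b)
    \<otimes>\<^bsub>relative_homology_group (int p) X A\<^esub> inv\<^bsub>relative_homology_group (int p) X A\<^esub> homologous_rel_set p X A d"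
  using assms
  by (simp only: homologous_rel_set_add homologous_rel_set_minus singular_relcycle_add singular_relcycle_minus)

lemma relative_homology_class_cases:
  assumes "u \<in> carrier (relative_homology_group (int p) X A)"
  obtains c where "singular_relcycle p X A c" "u = homologous_rel_set p X A c"
  using assms by (auto simp: carrier_relative_homology_group)

lemma hom_relboundary_class:
  assumes c: "singular_relcycle (Suc p) X S c"
  shows "hom_relboundary (1 + int p) X S T (homologous_rel_set (Suc p) X S c) =
    homologous_rel_set p (subtopology X S) T (chain_boundary (Suc p) c)"
proof -
  have b: "singular_relcycle p (subtopology X S) {} (chain_boundary (Suc p) c)"
    unfolding singular_cycle using c chain_boundary_boundary_alt [of p X c] by (auto simp: singular_relcycle)
  have "hom_boundary (int (Suc p)) X S (homologous_rel_set (Suc p) X S c) =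
     homologous_rel_set p (subtopology X S) {} (chain_boundary (Suc p) c)"
    using hom_boundary_chain_boundary [OF c] by simp
  moreover have "hom_induced (int p) (subtopology X S) {} (subtopology X S) T id
      (homologous_rel_set p (subtopology X S) {} (chain_boundary (Suc p) c)) =
      homologous_rel_set p (subtopology X S) T (chain_map p id (chain_boundary (Suc p) c))"
    by (rule hom_induced_chain_map) (use b in auto)
  moreover have "chain_map p id (chain_boundary (Suc p) c) = chain_boundary (Suc p) c"
    using b by (intro chain_map_ident [where X = "subtopology X S"]) (simp add: singular_cycle)
  ultimately show ?thesis
    by (simp add: hom_relboundary_def)
qed

text \<open>The minus sign makes the bottom end appear with a plus and the top with a minus in
  \<open>hom_relboundary_susp\<close>, as in the cone of \<open>(p\<^sub>-\<^sub>#, - p\<^sub>+\<^sub>#)\<close>. In negative degrees the group to be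
  suspended is trivial, and the value is chosen so that \<open>susp\<close> is a homomorphism there too.\<close>

definition susp :: "int \<Rightarrow> 'a topology \<Rightarrow> 'a set \<Rightarrow> 'a chain set \<Rightarrow> ('a \<times> real) chain set" where
  "susp n X A u =
    (if n < 0 then \<one>\<^bsub>relative_homology_group (n + 1) (cylinder X) (cylinder_boundary X A)\<^esub>
     else homologous_rel_set (Suc (nat n)) (cylinder X) (cylinder_boundary X A)
       (- prism (nat n) (SOME c. singular_relcycle (nat n) X A c \<and> u = homologous_rel_set (nat n) X A c)))"

lemma susp_class:
  assumes c: "singular_relcycle p X A c"
  shows "susp (int p) X A (homologous_rel_set p X A c) =
    homologous_rel_set (Suc p) (cylinder X) (cylinder_boundary X A) (- prism p c)"
proof -
  define c' where "c' = (SOME c'. singular_relcycle p X A c' \<and> homologous_rel_set p X A c = homologous_rel_set p X A c')"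
  have c': "singular_relcycle p X A c'" "homologous_rel_set p X A c = homologous_rel_set p X A c'"
    using someI_ex [of "\<lambda>c'. singular_relcycle p X A c' \<and> homologous_rel_set p X A c = homologous_rel_set p X A c'"] c
    unfolding c'_def by blast+
  have "homologous_rel p X A c c'"
    using c'(2) by (simp only: homologous_rel_set_eq)
  then have "singular_relboundary p X A (c - c')"
    by (simp only: homologous_rel_def)
  then have "homologous_rel (Suc p) (cylinder X) (cylinder_boundary X A) (- prism p c') (- prism p c)"
    using singular_relboundary_prism by (fastforce simp: homologous_rel_def prism_diff)
  then show ?thesis
    unfolding susp_def c'_def by (simp add: homologous_rel_set_eq)
qed

lemma susp_hom:
  "susp n X A \<in> hom (relative_homology_group n X A) (relative_homology_group (n + 1) (cylinder X) (cylinder_boundary X A))"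
proof (cases "n < 0")
  case True
  then have "susp n X A = (\<lambda>u. \<one>\<^bsub>relative_homology_group (n + 1) (cylinder X) (cylinder_boundary X A)\<^esub>)"
    by (auto simp: susp_def)
  then show ?thesis by (simp add: trivial_hom)
next
  case False
  then obtain p where n: "n = int p" by (metis int_nat_eq not_le)
  have n1: "n + 1 = int (Suc p)" using n by simp
  note rel = singular_relcycle_prism singular_relcycle_minus singular_relcycle_add
  show ?thesis
    unfolding n1
  proof (rule homI)
    fix u assume "u \<in> carrier (relative_homology_group n X A)"
    then obtain c where c: "singular_relcycle p X A c" "u = homologous_rel_set p X A c"
      unfolding n by (rule relative_homology_class_cases)
    show "susp n X A u \<in> carrier (relative_homology_group (int (Suc p)) (cylinder X) (cylinder_boundary X A))"
      unfolding n c(2) susp_class [OF c(1)] using c(1)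
      by (intro homologous_rel_set_closed) (simp add: rel)
    fix v assume "v \<in> carrier (relative_homology_group n X A)"
    then obtain d where d: "singular_relcycle p X A d" "v = homologous_rel_set p X A d"
      unfolding n by (rule relative_homology_class_cases)
    have "susp n X A (u \<otimes>\<^bsub>relative_homology_group n X A\<^esub> v) = susp n X A (homologous_rel_set p X A (c + d))"
      unfolding n using homologous_rel_set_add [OF c(1) d(1)] c(2) d(2) by simp
    also have "\<dots> = homologous_rel_set (Suc p) (cylinder X) (cylinder_boundary X A) (- prism p c + - prism p d)"
      unfolding n using susp_class [OF singular_relcycle_add [OF c(1) d(1)]] by (simp add: prism_add)
    also have "\<dots> = susp n X A u \<otimes>\<^bsub>relative_homology_group (int (Suc p)) (cylinder X) (cylinder_boundary X A)\<^esub> susp n X A v"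
      unfolding n c(2) d(2) susp_class [OF c(1)] susp_class [OF d(1)] using c(1) d(1)
      by (intro homologous_rel_set_add) (simp_all add: rel)
    finally show "susp n X A (u \<otimes>\<^bsub>relative_homology_group n X A\<^esub> v) =
       susp n X A u \<otimes>\<^bsub>relative_homology_group (int (Suc p)) (cylinder X) (cylinder_boundary X A)\<^esub> susp n X A v" .
  qed
qed

lemma hom_induced_one:
  "hom_induced n X A Y B f \<one>\<^bsub>relative_homology_group n X A\<^esub> = \<one>\<^bsub>relative_homology_group n Y B\<^esub>"
  using hom_one [OF hom_induced_hom] by simp

lemma map_prod_cylinder_boundary:
  "\<lbrakk>continuous_map X Y f; f \<in> A \<rightarrow> B\<rbrakk> \<Longrightarrow> map_prod f id \<in> cylinder_boundary X A \<rightarrow> cylinder_boundary Y B"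
  by (auto simp: cylinder_boundary_def continuous_map_def)

lemma susp_natural:
  assumes f: "continuous_map X Y f" "f \<in> A \<rightarrow> B" and u: "u \<in> carrier (relative_homology_group n X A)"
  shows "hom_induced (n + 1) (cylinder X) (cylinder_boundary X A) (cylinder Y) (cylinder_boundary Y B) (map_prod f id)
      (susp n X A u) = susp n Y B (hom_induced n X A Y B f u)"
proof (cases "n < 0")
  case True
  then show ?thesis by (simp add: susp_def hom_induced_one)
next
  case False
  then obtain p where n: "n = int p" by (metis int_nat_eq not_le)
  have n1: "n + 1 = int (Suc p)" using n by simp
  obtain c where c: "singular_relcycle p X A c" "u = homologous_rel_set p X A c"
    using u unfolding n by (rule relative_homology_class_cases)
  then have ch: "singular_chain p X c" by (simp add: singular_relcycle)
  have fc: "singular_relcycle p Y B (chain_map p f c)"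
    using c(1) f by (rule singular_relcycle_chain_map)
  have "hom_induced n X A Y B f u = homologous_rel_set p Y B (chain_map p f c)"
    unfolding n c(2) by (rule hom_induced_chain_map [OF f c(1)])
  then have "susp n Y B (hom_induced n X A Y B f u) =
     homologous_rel_set (Suc p) (cylinder Y) (cylinder_boundary Y B) (- prism p (chain_map p f c))"
    unfolding n using susp_class [OF fc] by simp
  moreover have "hom_induced (n + 1) (cylinder X) (cylinder_boundary X A) (cylinder Y) (cylinder_boundary Y B) (map_prod f id)
      (susp n X A u) = homologous_rel_set (Suc p) (cylinder Y) (cylinder_boundary Y B)
        (chain_map (Suc p) (map_prod f id) (- prism p c))"
    unfolding n1 unfolding n c(2) susp_class [OF c(1)]
    by (rule hom_induced_chain_map [OF continuous_map_cylinder [OF f(1)] map_prod_cylinder_boundary [OF f]])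
      (simp add: singular_relcycle_minus singular_relcycle_prism c)
  ultimately show ?thesis
    by (simp only: prism_chain_map [OF ch] chain_map_minus)
qed

text \<open>This is the boundary formula of the mapping cone: the boundary of the suspension of a class
  consists of its two ends and, with the opposite sign, the suspension of its boundary.\<close>

lemma hom_relboundary_susp:
  fixes A A' :: "'a set"
  assumes AA: "A' \<subseteq> A" "A \<subseteq> topspace X" and u: "u \<in> carrier (relative_homology_group n X A)"
  defines "W \<equiv> subtopology (cylinder X) (cylinder_boundary X A)"
    and "T \<equiv> cylinder_boundary (subtopology X A) A'"
  shows "hom_relboundary (n + 1) (cylinder X) (cylinder_boundary X A) T (susp n X A u) =
    (hom_induced n X A W T (\<lambda>x. (x, 0)) u
      \<otimes>\<^bsub>relative_homology_group n W T\<^esub>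
      inv\<^bsub>relative_homology_group n W T\<^esub> (hom_induced n X A W T (\<lambda>x. (x, 1)) u))
    \<otimes>\<^bsub>relative_homology_group n W T\<^esub>
      inv\<^bsub>relative_homology_group n W T\<^esub>
        (hom_induced n (cylinder (subtopology X A)) T W T id
          (susp (n - 1) (subtopology X A) A' (hom_relboundary n X A A' u)))"
proof (cases "n < 0")
  case True
  let ?G = "relative_homology_group n W T"
  have "hom_relboundary (n + 1) (cylinder X) (cylinder_boundary X A) T (susp n X A u) \<in> carrier ?G"
    using hom_relboundary [of "n + 1" "cylinder X" "cylinder_boundary X A" T] by (simp add: W_def)
  moreover have "(a \<otimes>\<^bsub>?G\<^esub> inv\<^bsub>?G\<^esub> b) \<otimes>\<^bsub>?G\<^esub> inv\<^bsub>?G\<^esub> d \<in> carrier ?G"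
    if "a \<in> carrier ?G" "b \<in> carrier ?G" "d \<in> carrier ?G" for a b d
    using that by (simp add: group.is_monoid monoid.m_closed group.inv_closed)
  moreover have "x = y" if "x \<in> carrier ?G" "y \<in> carrier ?G" for x y
    using that True trivial_relative_homology_group [of n W T] by (simp add: trivial_group_def)
  ultimately show ?thesis
    by (meson hom_induced_carrier)
next
  case False
  then obtain p where n: "n = int p" by (metis int_nat_eq not_le)
  have n1: "n + 1 = 1 + int p" using n by simp
  obtain c where c: "singular_relcycle p X A c" "u = homologous_rel_set p X A c"
    using u unfolding n by (rule relative_homology_class_cases)
  then have ch: "singular_chain p X c" "singular_chain (p - 1) (subtopology X A) (chain_boundary p c)"
    by (auto simp: singular_relcycle)
  have id: "continuous_map (cylinder (subtopology X A)) W id"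
    unfolding W_def by (rule continuous_map_cylinder_boundary(3))
  have ends: "continuous_map X W (\<lambda>x. (x, t))" "(\<lambda>x. (x, t)) \<in> A \<rightarrow> T"
    if "t = 0 \<or> t = 1" for t
    using that AA continuous_map_cylinder_boundary(1,2) [of X A]
    by (auto simp: W_def T_def cylinder_boundary_def)
  have e_rel: "singular_relcycle p W T (chain_map p (\<lambda>x. (x, t)) c)" if "t = 0 \<or> t = 1" for t
    by (rule singular_relcycle_chain_map [OF c(1) ends [OF that]])
  have e: "hom_induced n X A W T (\<lambda>x. (x, t)) u = homologous_rel_set p W T (chain_map p (\<lambda>x. (x, t)) c)"
    if "t = 0 \<or> t = 1" for t
    unfolding n c(2) by (rule hom_induced_chain_map [OF ends [OF that] c(1)])
  define s where "s = prism (p - 1) (chain_boundary p c)"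
  \<comment> \<open>In degree \<open>0\<close> there is no side: both the boundary of a chain and the suspension of a class of
    degree \<open>-1\<close> vanish.\<close>
  have s: "hom_induced n (cylinder (subtopology X A)) T W T id
          (susp (n - 1) (subtopology X A) A' (hom_relboundary n X A A' u)) = homologous_rel_set p W T (- s)
        \<and> singular_relcycle p W T (- s)"
  proof (cases p)
    case 0
    then have "s = 0" by (simp add: s_def chain_boundary_def)
    moreover have "susp (n - 1) (subtopology X A) A' (hom_relboundary n X A A' u) =
        \<one>\<^bsub>relative_homology_group n (cylinder (subtopology X A)) T\<^esub>"
      using 0 n by (simp add: susp_def T_def)
    ultimately show ?thesis
      using n by (simp add: hom_induced_one homologous_rel_set_0 del: one_relative_homology_group)
  next
    case (Suc q)
    have bc: "singular_relcycle q (subtopology X A) A' (chain_boundary p c)"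
      using c(1) chain_boundary_boundary_alt [of q X c] unfolding Suc by (auto simp: singular_relcycle)
    have rel: "singular_relcycle p (cylinder (subtopology X A)) T (- s)"
      using singular_relcycle_prism [OF bc] by (simp add: Suc s_def T_def singular_relcycle_minus)
    have "hom_relboundary n X A A' u = homologous_rel_set q (subtopology X A) A' (chain_boundary p c)"
      using hom_relboundary_class [of q X A c A'] c n Suc by simp
    then have "susp (n - 1) (subtopology X A) A' (hom_relboundary n X A A' u) =
       homologous_rel_set p (cylinder (subtopology X A)) T (- s)"
      using susp_class [OF bc] n Suc by (simp add: s_def T_def)
    moreover have "hom_induced n (cylinder (subtopology X A)) T W T id (homologous_rel_set p (cylinder (subtopology X A)) T (- s))
       = homologous_rel_set p W T (chain_map p id (- s))"
      unfolding n by (rule hom_induced_chain_map [OF id _ rel]) auto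
    moreover have "chain_map p id (- s) = - s"
      using rel by (intro chain_map_ident) (auto simp: singular_relcycle)
    moreover have "singular_relcycle p W T (chain_map p id (- s))"
      by (rule singular_relcycle_chain_map [OF rel id]) auto
    ultimately show ?thesis by simp
  qed
  have "hom_relboundary (n + 1) (cylinder X) (cylinder_boundary X A) T (susp n X A u) =
     homologous_rel_set p W T (chain_boundary (Suc p) (- prism p c))"
    unfolding n1 unfolding n c(2) susp_class [OF c(1)] W_def
    by (rule hom_relboundary_class) (simp add: singular_relcycle_minus singular_relcycle_prism c)
  also have "chain_boundary (Suc p) (- prism p c) =
      (chain_map p (\<lambda>x. (x, 0)) c + - chain_map p (\<lambda>x. (x, 1)) c) + - (- s)"
    unfolding chain_boundary_minus chain_boundary_prism [OF ch(1)] s_def by simp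
  also have "homologous_rel_set p W T \<dots> =
    (homologous_rel_set p W T (chain_map p (\<lambda>x. (x, 0)) c) \<otimes>\<^bsub>relative_homology_group n W T\<^esub>
     inv\<^bsub>relative_homology_group n W T\<^esub> homologous_rel_set p W T (chain_map p (\<lambda>x. (x, 1)) c))
     \<otimes>\<^bsub>relative_homology_group n W T\<^esub> inv\<^bsub>relative_homology_group n W T\<^esub> homologous_rel_set p W T (- s)"
    unfolding n by (rule homologous_rel_set_combination) (use e_rel s in auto)
  finally show ?thesis
    using e [of 0] e [of 1] s by simp
qed

section \<open>The suspension isomorphism\<close>

lemma iso_from_kernel:
  assumes "group G" "group H" "f \<in> hom G H"
    and inj: "\<And>x. \<lbrakk>x \<in> carrier G; f x = \<one>\<^bsub>H\<^esub>\<rbrakk> \<Longrightarrow> x = \<one>\<^bsub>G\<^esub>"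
    and surj: "carrier H \<subseteq> f ` carrier G"
  shows "f \<in> iso G H"
proof -
  interpret group_hom G H f
    using assms by (simp add: group_hom_def group_hom_axioms_def)
  have "inj_on f (carrier G)"
    using inj inj_on_one_iff by blast
  moreover have "f ` carrier G = carrier H"
    using surj hom_closed by blast
  ultimately show ?thesis
    using assms by (simp add: iso_def bij_betw_def)
qed

lemma iso_cancel_left:
  assumes "f \<in> iso A B" "g \<in> hom B C" "h \<in> iso A C" "\<And>x. x \<in> carrier A \<Longrightarrow> g (f x) = h x"
  shows "g \<in> iso B C"
proof -
  have "bij_betw (g \<circ> f) (carrier A) (carrier C)"
    using assms bij_betw_cong [of "carrier A" "g \<circ> f" h "carrier C"] by (simp add: iso_def)
  then show ?thesis
    using assms by (simp add: iso_def bij_betw_comp_iff [of f "carrier A" "carrier B"])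
qed

lemma iso_cancel_right:
  assumes "f \<in> hom A B" "g \<in> iso B C" "h \<in> iso A C" "\<And>x. x \<in> carrier A \<Longrightarrow> g (f x) = h x"
  shows "f \<in> iso A B"
proof -
  have "bij_betw (g \<circ> f) (carrier A) (carrier C)"
    using assms bij_betw_cong [of "carrier A" "g \<circ> f" h "carrier C"] by (simp add: iso_def)
  moreover have "f ` carrier A \<subseteq> carrier B" using assms(1) by (auto simp: hom_def)
  ultimately show ?thesis
    using assms bij_betw_comp_iff2 [of g "carrier B" "carrier C" f "carrier A"] by (simp add: iso_def)
qed

lemma iso_trivial_groups:
  assumes "trivial_group G" "trivial_group H" "f \<in> hom G H"
  shows "f \<in> iso G H"
  using assms by (intro iso_from_kernel) (auto simp: trivial_group_def hom_def Pi_iff)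

lemma triple_kernels:
  assumes "T \<subseteq> S"
  shows "kernel (relative_homology_group n X T) (relative_homology_group n X S) (hom_induced n X T X S id) =
      hom_induced n (subtopology X S) T X T id ` carrier (relative_homology_group n (subtopology X S) T)"
    and "kernel (relative_homology_group n X S) (relative_homology_group (n - 1) (subtopology X S) T) (hom_relboundary n X S T) =
      hom_induced n X T X S id ` carrier (relative_homology_group n X T)"
    and "kernel (relative_homology_group (n - 1) (subtopology X S) T) (relative_homology_group (n - 1) X T)
      (hom_induced (n - 1) (subtopology X S) T X T id) =
      hom_relboundary n X S T ` carrier (relative_homology_group n X S)"
  using homology_exactness_triple_1 [OF assms, of n X] homology_exactness_triple_2 [OF assms, of n X]
    homology_exactness_triple_3 [OF assms, of n X]
  by simp_all

lemma inj_by_exactness: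
  assumes TS: "T \<subseteq> S" and triv: "trivial_group (relative_homology_group n (subtopology X S) T)"
    and x: "x \<in> carrier (relative_homology_group n X T)" "hom_induced n X T X S id x = \<one>\<^bsub>relative_homology_group n X S\<^esub>"
  shows "x = \<one>\<^bsub>relative_homology_group n X T\<^esub>"
proof -
  have "x \<in> hom_induced n (subtopology X S) T X T id ` carrier (relative_homology_group n (subtopology X S) T)"
    unfolding triple_kernels(1) [OF TS, symmetric] using x by (simp add: kernel_def)
  then obtain y where y: "x = hom_induced n (subtopology X S) T X T id y" "y \<in> carrier (relative_homology_group n (subtopology X S) T)"
    by (rule imageE)
  then have "y = \<one>\<^bsub>relative_homology_group n (subtopology X S) T\<^esub>"
    using triv by (simp add: trivial_group_def)
  then show ?thesis
    unfolding y(1) by (simp only: hom_induced_one)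
qed

lemma trivial_by_exactness:
  assumes TS: "T \<subseteq> S" and triv: "trivial_group (relative_homology_group n (subtopology X S) T)"
    "trivial_group (relative_homology_group n X S)"
  shows "trivial_group (relative_homology_group n X T)"
proof -
  have "x = \<one>\<^bsub>relative_homology_group n X T\<^esub>" if "x \<in> carrier (relative_homology_group n X T)" for x
    using inj_by_exactness [OF TS triv(1) that] triv(2) hom_induced_carrier [of n X T X S id x]
    by (simp add: trivial_group_def)
  then show ?thesis
    by (auto simp: trivial_group_def group.is_monoid monoid.one_closed)
qed

lemma surj_by_exactness:
  assumes TS: "T \<subseteq> S" and triv: "trivial_group (relative_homology_group n X S)"
  shows "hom_induced n (subtopology X S) T X T id ` carrier (relative_homology_group n (subtopology X S) T) =
    carrier (relative_homology_group n X T)"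
proof -
  have "hom_induced n X T X S id x = \<one>\<^bsub>relative_homology_group n X S\<^esub>" for x
    using triv hom_induced_carrier [of n X T X S id x] by (simp add: trivial_group_def)
  then show ?thesis
    unfolding triple_kernels(1) [OF TS, symmetric] by (auto simp: kernel_def)
qed

lemma trivial_triple_iso:
  assumes TS: "T \<subseteq> S" and triv: "\<And>k. trivial_group (relative_homology_group k (subtopology X S) T)"
  shows "hom_induced n X T X S id \<in> iso (relative_homology_group n X T) (relative_homology_group n X S)"
proof (rule iso_from_kernel)
  show "x = \<one>\<^bsub>relative_homology_group n X T\<^esub>"
    if "x \<in> carrier (relative_homology_group n X T)"
       "hom_induced n X T X S id x = \<one>\<^bsub>relative_homology_group n X S\<^esub>" for x
    by (rule inj_by_exactness [OF TS triv that])
  show "carrier (relative_homology_group n X S) \<subseteq> hom_induced n X T X S id ` carrier (relative_homology_group n X T)"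
  proof
    fix x assume "x \<in> carrier (relative_homology_group n X S)"
    moreover have "hom_relboundary n X S T x = \<one>\<^bsub>relative_homology_group (n - 1) (subtopology X S) T\<^esub>"
      using hom_relboundary [of n X S T x] triv [of "n - 1"] by (simp add: trivial_group_def)
    ultimately show "x \<in> hom_induced n X T X S id ` carrier (relative_homology_group n X T)"
      unfolding triple_kernels(2) [OF TS, symmetric] by (simp add: kernel_def)
  qed
qed (auto simp: hom_induced_hom)

lemma hom_relboundary_iso:
  assumes TS: "T \<subseteq> S" and triv: "\<And>k. trivial_group (relative_homology_group k X T)"
  shows "hom_relboundary n X S T \<in> iso (relative_homology_group n X S) (relative_homology_group (n - 1) (subtopology X S) T)"
proof (rule iso_from_kernel)
  have one: "carrier (relative_homology_group k X T) = {\<one>\<^bsub>relative_homology_group k X T\<^esub>}" for k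
    using triv by (simp add: trivial_group_def)
  show "x = \<one>\<^bsub>relative_homology_group n X S\<^esub>"
    if "x \<in> carrier (relative_homology_group n X S)"
       "hom_relboundary n X S T x = \<one>\<^bsub>relative_homology_group (n - 1) (subtopology X S) T\<^esub>" for x
  proof -
    have "x \<in> kernel (relative_homology_group n X S) (relative_homology_group (n - 1) (subtopology X S) T) (hom_relboundary n X S T)"
      using that by (simp add: kernel_def)
    then show ?thesis
      unfolding triple_kernels(2) [OF TS] one by (simp add: hom_induced_one)
  qed
  show "carrier (relative_homology_group (n - 1) (subtopology X S) T) \<subseteq> hom_relboundary n X S T ` carrier (relative_homology_group n X S)"
  proof
    fix x assume x: "x \<in> carrier (relative_homology_group (n - 1) (subtopology X S) T)"
    have "hom_induced (n - 1) (subtopology X S) T X T id x \<in> carrier (relative_homology_group (n - 1) X T)"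
      by (rule hom_induced_carrier)
    then show "x \<in> hom_relboundary n X S T ` carrier (relative_homology_group n X S)"
      unfolding triple_kernels(3) [OF TS, symmetric] one using x by (simp add: kernel_def)
  qed
qed (auto simp: group_homomorphism_hom_relboundary)

text \<open>Homotopies that move points of a cylinder along its generating segments.\<close>

lemma cylinder_homotopy:
  fixes r :: "real \<Rightarrow> real \<Rightarrow> real"
  assumes cont: "continuous_on ({0..1} \<times> {0..1}) (\<lambda>(s, t). r s t)"
    and r: "\<And>s t. \<lbrakk>s \<in> {0..1}; t \<in> {0..1}\<rbrakk> \<Longrightarrow> r s t \<in> {0..1}"
    and S: "\<And>s x t. \<lbrakk>s \<in> {0..1}; t \<in> {0..1}; x \<in> topspace X; (x, t) \<in> S\<rbrakk> \<Longrightarrow> (x, r s t) \<in> S"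
    and T: "\<And>s x t. \<lbrakk>s \<in> {0..1}; (x, t) \<in> T\<rbrakk> \<Longrightarrow> (x, r s t) \<in> T"
    and f: "\<And>x t. f (x, t) = (x, r 0 t)" and g: "\<And>x t. g (x, t) = (x, r 1 t)"
  shows "homotopic_with (\<lambda>h. h \<in> T \<rightarrow> T) (subtopology (cylinder X) S) (subtopology (cylinder X) S) f g"
proof -
  let ?C = "subtopology (cylinder X) S"
  let ?D = "prod_topology (top_of_set {0..1::real}) ?C"
  define h where "h = (\<lambda>(s, x :: 'a, t). (x, r s t))"
  have x: "continuous_map ?D X (\<lambda>z. fst (snd z))"
    by (intro continuous_map_fst_of [unfolded comp_def] continuous_map_compose [OF continuous_map_snd, unfolded comp_def]
          continuous_map_from_subtopology continuous_map_fst)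
  have t: "continuous_map ?D (top_of_set {0..1}) (\<lambda>z. snd (snd z))"
    by (intro continuous_map_compose [OF continuous_map_snd, unfolded comp_def]
          continuous_map_from_subtopology continuous_map_snd)
  have "continuous_map ?D (prod_topology (top_of_set {0..1}) (top_of_set {0..1})) (\<lambda>z. (fst z, snd (snd z)))"
    using t by (simp only: continuous_map_pairwise comp_def fst_conv snd_conv continuous_map_fst eta_contract_eq simp_thms)
  moreover have "continuous_map (prod_topology (top_of_set {0..1}) (top_of_set {0..1})) (top_of_set {0..1}) (\<lambda>(s, t). r s t)"
    using cont r by (auto simp: continuous_map_in_subtopology)
  ultimately have "continuous_map ?D (top_of_set {0..1}) ((\<lambda>(s, t). r s t) \<circ> (\<lambda>z. (fst z, snd (snd z))))"
    by (rule continuous_map_compose)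
  with x have "continuous_map ?D (cylinder X) h"
    by (simp add: continuous_map_pairwise comp_def h_def case_prod_unfold)
  moreover have "h \<in> topspace ?D \<rightarrow> S"
    using S by (auto simp: h_def)
  ultimately have "continuous_map ?D ?C h"
    by (simp add: continuous_map_in_subtopology)
  moreover have "h (0, z) = f z" "h (1, z) = g z" for z
    using f g by (cases z; simp add: h_def)+
  ultimately show ?thesis
    unfolding homotopic_with_def using T by (intro exI [of _ h]) (auto simp: h_def)
qed

definition cylinder_cap :: "'a topology \<Rightarrow> 'a set \<Rightarrow> ('a \<times> real) set" where
  "cylinder_cap X A = {(x, t). x \<in> topspace X \<and> t \<in> {0..1} \<and> (t = 1 \<or> x \<in> A)}"

text \<open>Moving all points up along the segments retracts both the cylinder and its cap to the top.\<close>

lemma trivial_cylinder_cap: "trivial_group (relative_homology_group n (cylinder X) (cylinder_cap X A))"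
proof (rule trivial_relative_homology_group_gen)
  let ?f = "\<lambda>(x :: 'a, t :: real). (x, 1 :: real)"
  let ?r = "\<lambda>s t :: real. 1 - s * (1 - t)"
  have r: "?r s t \<in> {0..1}" if "s \<in> {0..1}" "t \<in> {0..1}" for s t
    using that by (simp add: mult_le_one)
  have cont: "continuous_on ({0..1} \<times> {0..1}) (\<lambda>(s, t). ?r s t)"
    by (auto simp: case_prod_unfold intro!: continuous_intros)
  have "homotopic_with (\<lambda>h. h \<in> UNIV \<rightarrow> UNIV) (subtopology (cylinder X) (cylinder_cap X A)) (subtopology (cylinder X) (cylinder_cap X A)) ?f id"
    by (rule cylinder_homotopy [where r = ?r, OF cont r]) (auto simp: cylinder_cap_def mult_le_one)
  then show "homotopic_with (\<lambda>h. True) (subtopology (cylinder X) (cylinder_cap X A)) (subtopology (cylinder X) (cylinder_cap X A)) ?f id"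
    by simp
  have "homotopic_with (\<lambda>h. h \<in> UNIV \<rightarrow> UNIV) (subtopology (cylinder X) UNIV) (subtopology (cylinder X) UNIV) ?f id"
    by (rule cylinder_homotopy [where r = ?r, OF cont r]) (auto simp: mult_le_one)
  then show *: "homotopic_with (\<lambda>h. True) (cylinder X) (cylinder X) ?f id"
    by simp
  show "continuous_map (cylinder X) (subtopology (cylinder X) (cylinder_cap X A)) ?f"
    using homotopic_with_imp_continuous_maps [OF *] by (auto simp: continuous_map_in_subtopology cylinder_cap_def)
qed

text \<open>Relative to the cap, the upper half of the boundary of the cylinder can be excised, and what remains
  retracts to the bottom, where it is the pair \<open>(X, A)\<close>.\<close>

lemma cylinder_bottom_iso:
  assumes A: "A \<subseteq> topspace X"
  defines "W \<equiv> subtopology (cylinder X) (cylinder_boundary X A)"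
  shows "hom_induced n X A W (cylinder_cap X A) (\<lambda>x. (x, 0)) \<in>
    iso (relative_homology_group n X A) (relative_homology_group n W (cylinder_cap X A))"
proof -
  let ?W = "cylinder_boundary X A" and ?V = "cylinder_cap X A"
  define U where "U = {z \<in> ?W. snd z > 1/2}"
  have topW: "topspace W = ?W"
    by (auto simp: W_def cylinder_boundary_def)
  have snd: "continuous_map W euclideanreal snd"
    unfolding W_def by (meson continuous_map_from_subtopology continuous_map_into_fulltopology continuous_map_snd)
  have "W closure_of U \<subseteq> {z \<in> topspace W. snd z \<in> {1/2..}}"
  proof (rule closure_of_minimal)
    show "closedin W {z \<in> topspace W. snd z \<in> {1/2..}}"
      by (rule closedin_continuous_map_preimage [OF snd]) simp
  qed (auto simp: U_def topW)
  moreover have "{z \<in> topspace W. snd z \<in> {0<..}} \<subseteq> W interior_of ?V"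
  proof (rule interior_of_maximal)
    show "openin W {z \<in> topspace W. snd z \<in> {0<..}}"
      by (rule openin_continuous_map_preimage [OF snd]) simp
  qed (auto simp: topW cylinder_cap_def cylinder_boundary_def)
  ultimately have "W closure_of U \<subseteq> W interior_of ?V" by force
  then have exc: "hom_induced n (subtopology W (?W - U)) (?V - U) (subtopology W ?W) ?V id
    \<in> iso (relative_homology_group n (subtopology W (?W - U)) (?V - U)) (relative_homology_group n (subtopology W ?W) ?V)"
    by (rule homology_excision_axiom) (auto simp: cylinder_cap_def cylinder_boundary_def)
  have WW: "subtopology W ?W = W"
    by (simp add: W_def subtopology_subtopology)
  have WU: "subtopology W (?W - U) = subtopology (cylinder X) (?W - U)"
    by (simp add: W_def subtopology_subtopology Int_absorb1 Diff_subset)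
  let ?i = "\<lambda>x. (x, 0 :: real)"
  have i: "continuous_map X (subtopology (cylinder X) (?W - U)) ?i"
    by (auto simp: continuous_map_in_subtopology continuous_map_bottom cylinder_boundary_def U_def)
  have iA: "?i \<in> A \<rightarrow> ?V - U"
    using A by (auto simp: cylinder_cap_def U_def)
  have "hom_induced n X A (subtopology (cylinder X) (?W - U)) (?V - U) ?i \<in>
    iso (relative_homology_group n X A) (relative_homology_group n (subtopology (cylinder X) (?W - U)) (?V - U))"
  proof (rule homotopy_equivalence_relative_homology_group_isomorphism [where g = fst, OF i iA])
    show "continuous_map (subtopology (cylinder X) (?W - U)) X fst"
      by (simp add: continuous_map_from_subtopology continuous_map_fst)
    show "fst \<in> ?V - U \<rightarrow> A"
      by (auto simp: cylinder_cap_def U_def cylinder_boundary_def)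
    have "fst \<circ> ?i = (id :: 'a \<Rightarrow> 'a)" by auto
    then show "homotopic_with (\<lambda>h. h \<in> A \<rightarrow> A) X X (fst \<circ> ?i) id"
      by simp
    show "homotopic_with (\<lambda>k. k \<in> ?V - U \<rightarrow> ?V - U) (subtopology (cylinder X) (?W - U)) (subtopology (cylinder X) (?W - U)) (?i \<circ> fst) id"
    proof (rule cylinder_homotopy [where r = "\<lambda>s t. s * t"])
      have le: "s * t \<le> t" "0 \<le> s * t" if "s \<in> {0..1}" "t \<in> {0..1}" for s t :: real
        using that by (auto simp: mult_left_le_one_le)
      show "(x, s * t) \<in> ?W - U" if "s \<in> {0..1}" "t \<in> {0..1}" "x \<in> topspace X" "(x, t) \<in> ?W - U" for s t x
        using that le [OF that(1,2)] by (auto simp: cylinder_boundary_def U_def)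
      show "(x, s * t) \<in> ?V - U" if "s \<in> {0..1}" "(x, t) \<in> ?V - U" for s t x
        using that le [OF that(1), of t] by (auto simp: cylinder_boundary_def cylinder_cap_def U_def)
      show "s * t \<in> {0..1}" if "s \<in> {0..1}" "t \<in> {0..1}" for s t :: real
        using that by (auto simp: mult_le_one)
      show "continuous_on ({0..1} \<times> {0..1}) (\<lambda>(s, t). s * t :: real)"
        by (auto simp: case_prod_unfold intro!: continuous_intros)
    qed auto
  qed
  then have 1: "hom_induced n X A (subtopology W (?W - U)) (?V - U) ?i \<in>
    iso (relative_homology_group n X A) (relative_homology_group n (subtopology W (?W - U)) (?V - U))"
    by (simp only: WU)
  have 2: "hom_induced n (subtopology W (?W - U)) (?V - U) W ?V id
    \<in> iso (relative_homology_group n (subtopology W (?W - U)) (?V - U)) (relative_homology_group n W ?V)"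
    using exc by (simp only: WW)
  have "hom_induced n (subtopology W (?W - U)) (?V - U) W ?V id \<circ> hom_induced n X A (subtopology W (?W - U)) (?V - U) ?i
    = hom_induced n X A W ?V (id \<circ> ?i)"
    using i iA by (intro hom_induced_compose [symmetric]) (auto simp: WU [symmetric] continuous_map_from_subtopology)
  then show ?thesis
    using Group.iso_set_trans [OF 1 2] by simp
qed

text \<open>In the triple formed by the cylinder, its boundary and its cap, the connecting map is an isomorphism,
  since the cylinder has no homology relative to the cap. It takes the suspension of a class to the same
  class at the bottom, because the top and the side of the prism lie in the cap.\<close>

theorem susp_iso:
  assumes A: "A \<subseteq> topspace X"
  shows "susp n X A \<in> iso (relative_homology_group n X A) (relative_homology_group (n + 1) (cylinder X) (cylinder_boundary X A))"
proof -
  let ?W = "cylinder_boundary X A" and ?V = "cylinder_cap X A"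
  let ?WT = "subtopology (cylinder X) ?W"
  have VW: "?V \<subseteq> ?W" by (auto simp: cylinder_cap_def cylinder_boundary_def)
  have b: "hom_relboundary (n + 1) (cylinder X) ?W ?V \<in>
     iso (relative_homology_group (n + 1) (cylinder X) ?W) (relative_homology_group n ?WT ?V)"
    using hom_relboundary_iso [OF VW trivial_cylinder_cap, of "n + 1"] by simp
  note i0 = cylinder_bottom_iso [OF A, of n]
  show ?thesis
  proof (cases "n < 0")
    case True
    have "trivial_group (relative_homology_group (n + 1) (cylinder X) ?W)"
      using b True isomorphic_group_triviality trivial_relative_homology_group group_relative_homology_group
      unfolding is_iso_def by blast
    then show ?thesis
      using True susp_hom iso_trivial_groups trivial_relative_homology_group by blast
  next
    case False
    then obtain p where n: "n = int p" by (metis int_nat_eq not_le)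
    have n1: "n + 1 = 1 + int p" using n by simp
    show ?thesis
    proof (rule iso_cancel_right [OF susp_hom b i0])
      fix u assume "u \<in> carrier (relative_homology_group n X A)"
      then obtain c where c: "singular_relcycle p X A c" "u = homologous_rel_set p X A c"
        unfolding n by (rule relative_homology_class_cases)
      then have ch: "singular_chain p X c" "singular_chain (p - 1) (subtopology X A) (chain_boundary p c)"
        by (auto simp: singular_relcycle)
      have i0: "continuous_map X ?WT (\<lambda>x. (x, 0))" "(\<lambda>x. (x, 0)) \<in> A \<rightarrow> ?V"
        using A by (auto simp: continuous_map_cylinder_boundary cylinder_cap_def)
      have WV: "subtopology ?WT ?V = subtopology (cylinder X) ?V"
        using VW by (simp add: subtopology_subtopology Int_absorb1)
      have i1: "continuous_map X (subtopology ?WT ?V) (\<lambda>x. (x, 1))"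
        unfolding WV by (auto simp: continuous_map_in_subtopology continuous_map_top cylinder_cap_def)
      have "continuous_map (cylinder (subtopology X A)) (cylinder X) (map_prod id id)"
        by (rule continuous_map_cylinder) (simp add: continuous_map_from_subtopology)
      then have side: "continuous_map (cylinder (subtopology X A)) (subtopology ?WT ?V) id"
        unfolding WV by (auto simp: continuous_map_in_subtopology cylinder_cap_def map_prod.id)
      have s: "singular_chain p (subtopology ?WT ?V) (prism (p - 1) (chain_boundary p c))"
      proof (cases p)
        case (Suc q)
        then show ?thesis
          using singular_chain_continuous_id [OF singular_chain_prism [OF ch(2)] side] by simp
      qed (simp add: chain_boundary_def)
      have "hom_relboundary (n + 1) (cylinder X) ?W ?V (susp n X A u) =
         homologous_rel_set p ?WT ?V (chain_boundary (Suc p) (- prism p c))"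
        unfolding n1 unfolding n c(2) susp_class [OF c(1)]
        by (rule hom_relboundary_class) (simp add: singular_relcycle_minus singular_relcycle_prism c)
      also have "\<dots> = homologous_rel_set p ?WT ?V (chain_map p (\<lambda>x. (x, 0)) c)"
      proof -
        have "chain_boundary (Suc p) (- prism p c) - chain_map p (\<lambda>x. (x, 0)) c =
            - chain_map p (\<lambda>x. (x, 1)) c + prism (p - 1) (chain_boundary p c)"
          unfolding chain_boundary_minus chain_boundary_prism [OF ch(1)] by simp
        moreover have "singular_chain p (subtopology ?WT ?V) \<dots>"
          by (intro singular_chain_add singular_chain_minus [THEN iffD2] singular_chain_chain_map [OF ch(1) i1] s)
        ultimately have "homologous_rel p ?WT ?V (chain_boundary (Suc p) (- prism p c)) (chain_map p (\<lambda>x. (x, 0)) c)"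
          unfolding homologous_rel_def by (metis singular_chain_imp_relboundary)
        then show ?thesis by (simp only: homologous_rel_set_eq)
      qed
      also have "\<dots> = hom_induced n X A ?WT ?V (\<lambda>x. (x, 0)) u"
        unfolding n c(2) by (rule hom_induced_chain_map [OF i0 c(1), symmetric])
      finally show "hom_relboundary (n + 1) (cylinder X) ?W ?V (susp n X A u) = hom_induced n X A ?WT ?V (\<lambda>x. (x, 0)) u" .
    qed
  qed
qed


section \<open>Homology of discs\<close>

definition disc_set :: "nat \<Rightarrow> (nat \<Rightarrow> real) set" where
  "disc_set n = {x. (\<forall>i\<ge>n. x i = 0) \<and> (\<Sum>i<n. (x i)\<^sup>2) \<le> 1}"

definition norm_upto :: "nat \<Rightarrow> (nat \<Rightarrow> real) \<Rightarrow> real" where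
  "norm_upto n x = sqrt (\<Sum>i<n. (x i)\<^sup>2)"

text \<open>Discs become subspaces of the function type with its product topology, for which continuity is a
  matter of \<open>continuous_on\<close> and coordinates.\<close>

lemma Euclidean_space_top_of_set: "Euclidean_space n = top_of_set {x. \<forall>i\<ge>n. x i = 0}"
  by (simp add: Euclidean_space_def euclidean_product_topology)

lemma closed_disc_top_of_set: "closed_disc n = top_of_set (disc_set n)"
  by (simp add: closed_disc_def Euclidean_space_top_of_set subtopology_subtopology disc_set_def Collect_conj_eq)

lemma topspace_closed_disc [simp]: "topspace (closed_disc n) = disc_set n"
  by (simp add: closed_disc_top_of_set)

lemma topspace_open_disc: "topspace (open_disc n) = {x \<in> disc_set n. (\<Sum>i<n. (x i)\<^sup>2) < 1}"
  by (auto simp: open_disc_def Euclidean_space_top_of_set disc_set_def)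

lemma open_disc_subtopology: "open_disc n = subtopology (closed_disc n) (topspace (open_disc n))"
proof -
  have "{x. \<forall>i\<ge>n. x i = 0} \<inter> {x. (\<Sum>i<n. (x i)\<^sup>2) < 1} = disc_set n \<inter> {x \<in> disc_set n. (\<Sum>i<n. (x i)\<^sup>2) < 1}"
    by (auto simp: disc_set_def)
  then show ?thesis
    unfolding closed_disc_top_of_set topspace_open_disc subtopology_subtopology
    by (simp add: open_disc_def Euclidean_space_top_of_set subtopology_subtopology)
qed

lemma disc_boundary_alt: "disc_boundary n = {x \<in> disc_set n. (\<Sum>i<n. (x i)\<^sup>2) = 1}"
  unfolding disc_boundary_def topspace_open_disc by (auto simp: disc_set_def)

lemma disc_boundary_subset: "disc_boundary n \<subseteq> topspace (closed_disc n)"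
  by (auto simp: disc_boundary_alt)

lemma continuous_on_norm_upto: "continuous_on UNIV (norm_upto n)"
  unfolding norm_upto_def [abs_def]
  by (intro continuous_on_real_sqrt continuous_on_sum continuous_on_power continuous_on_product_coordinates)

lemma compact_disc_set: "compact (disc_set n)"
proof -
  let ?box = "PiE UNIV (\<lambda>_. {-1..1}) :: (nat \<Rightarrow> real) set"
  have "compactin (powertop_real UNIV) ?box"
    by (simp add: compactin_PiE)
  then have box: "compact ?box"
    by (simp add: euclidean_product_topology)
  have "continuous_on UNIV (\<lambda>x :: nat \<Rightarrow> real. \<Sum>i<n. (x i)\<^sup>2)"
    by (intro continuous_on_sum continuous_on_power continuous_on_product_coordinates)
  then have "closed {x :: nat \<Rightarrow> real. (\<Sum>i<n. (x i)\<^sup>2) \<le> 1}"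
    by (intro closed_Collect_le) auto
  moreover have "closed {x :: nat \<Rightarrow> real. \<forall>i\<ge>n. x i = 0}"
    by (intro closed_Collect_all closed_Collect_imp closed_Collect_eq open_Collect_const continuous_on_product_coordinates continuous_on_const)
  ultimately have "closed (disc_set n)"
    unfolding disc_set_def Collect_conj_eq by (rule closed_Int [rotated])
  moreover have "disc_set n \<subseteq> ?box"
  proof
    fix x assume x: "x \<in> disc_set n"
    have "\<bar>x i\<bar> \<le> 1" for i
    proof (cases "i < n")
      case True
      then have "(x i)\<^sup>2 \<le> (\<Sum>i<n. (x i)\<^sup>2)"
        by (intro member_le_sum) auto
      then have "(x i)\<^sup>2 \<le> 1" using x by (simp add: disc_set_def)
      then show ?thesis by (simp add: abs_square_le_1)
    qed (use x in \<open>auto simp: disc_set_def\<close>)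
    then show "x \<in> ?box" by (auto simp: abs_le_iff minus_le_iff)
  qed
  ultimately show ?thesis
    using box by (metis compact_Int_closed inf.absorb_iff2)
qed

lemma compact_closed_disc: "compact_space (closed_disc n)"
  by (simp add: closed_disc_top_of_set compact_space_subtopology compact_disc_set)

lemma Hausdorff_closed_disc: "Hausdorff_space (closed_disc n)"
  by (simp add: closed_disc_top_of_set Hausdorff_space_subtopology)

text \<open>The homeomorphism from the cylinder over the \<open>n\<close>-disc to the \<open>(n + 1)\<close>-disc rescales every ray,
  turning the maximum of the norm of the disc coordinate and the modulus of the height into the
  Euclidean norm.\<close>

definition box_norm :: "nat \<Rightarrow> (nat \<Rightarrow> real) \<Rightarrow> real" where
  "box_norm n w = max (norm_upto n w) \<bar>w n\<bar>"

definition box_to_disc :: "nat \<Rightarrow> (nat \<Rightarrow> real) \<Rightarrow> nat \<Rightarrow> real" where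
  "box_to_disc n w = (\<lambda>i. if i \<le> n then box_norm n w / norm_upto (Suc n) w * w i else 0)"

definition disc_to_box :: "nat \<Rightarrow> (nat \<Rightarrow> real) \<Rightarrow> nat \<Rightarrow> real" where
  "disc_to_box n w = (\<lambda>i. if i \<le> n then norm_upto (Suc n) w / box_norm n w * w i else 0)"

text \<open>The height \<open>t\<close> becomes the coordinate \<open>2 * t - 1\<close> between \<open>-1\<close> and \<open>1\<close>, at the index \<open>n\<close>, which is zero
  for the points of the \<open>n\<close>-disc.\<close>

definition cylinder_to_disc :: "nat \<Rightarrow> (nat \<Rightarrow> real) \<times> real \<Rightarrow> nat \<Rightarrow> real" where
  "cylinder_to_disc n = (\<lambda>(x, t). box_to_disc n (x(n := 2 * t - 1)))"

lemma norm_upto_nonneg [simp]: "0 \<le> norm_upto n w"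
  by (simp add: norm_upto_def sum_nonneg)

lemma norm_upto_cong: "(\<And>i. i < n \<Longrightarrow> w i = v i) \<Longrightarrow> norm_upto n w = norm_upto n v"
  by (simp add: norm_upto_def)

lemma norm_upto_scale: "norm_upto n (\<lambda>i. c * w i) = \<bar>c\<bar> * norm_upto n w"
  by (simp add: norm_upto_def power_mult_distrib flip: sum_distrib_left) (simp add: real_sqrt_mult)

lemma norm_upto_Suc: "norm_upto (Suc n) w = sqrt ((norm_upto n w)\<^sup>2 + (w n)\<^sup>2)"
  by (simp add: norm_upto_def sum_nonneg)

lemma box_norm_le: "box_norm n w \<le> norm_upto (Suc n) w"
  by (auto simp: box_norm_def norm_upto_Suc real_le_rsqrt)

lemma box_norm_nonneg [simp]: "0 \<le> box_norm n w"
  by (simp add: box_norm_def)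

lemma abs_le_norm_upto: "i < n \<Longrightarrow> \<bar>w i\<bar> \<le> norm_upto n w"
  unfolding norm_upto_def by (intro real_le_rsqrt) (auto intro: member_le_sum)

lemma norm_zero_iff: "norm_upto (Suc n) w = 0 \<longleftrightarrow> box_norm n w = 0"
proof
  assume "box_norm n w = 0"
  then have "norm_upto n w = 0" "w n = 0"
    by (auto simp: box_norm_def max_def split: if_splits) (use norm_upto_nonneg [of n w] in linarith)+
  then show "norm_upto (Suc n) w = 0" by (simp add: norm_upto_Suc)
qed (use box_norm_le [of n w] box_norm_nonneg [of n w] in linarith)

lemma box_norm_scale: "box_norm n (\<lambda>i. c * w i) = \<bar>c\<bar> * box_norm n w"
  by (simp add: box_norm_def norm_upto_scale abs_mult max_mult_distrib_left)

lemma norms_restrict: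
  "norm_upto (Suc n) (\<lambda>i. if i \<le> n then w i else 0) = norm_upto (Suc n) w"
  "box_norm n (\<lambda>i. if i \<le> n then w i else 0) = box_norm n w"
  by (auto simp: box_norm_def intro!: norm_upto_cong arg_cong2 [of _ _ _ _ max])

lemma norm_box_to_disc: "norm_upto (Suc n) (box_to_disc n w) = box_norm n w"
  unfolding box_to_disc_def norms_restrict norm_upto_scale
  using norm_zero_iff [of n w] by (cases "norm_upto (Suc n) w = 0") auto

lemma box_norm_disc_to_box: "box_norm n (disc_to_box n w) = norm_upto (Suc n) w"
  unfolding disc_to_box_def norms_restrict box_norm_scale
  using norm_zero_iff [of n w] by (cases "norm_upto (Suc n) w = 0") auto

lemma box_norm_box_to_disc: "box_norm n (box_to_disc n w) = box_norm n w / norm_upto (Suc n) w * box_norm n w"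
  unfolding box_to_disc_def norms_restrict box_norm_scale by simp

lemma norm_disc_to_box: "norm_upto (Suc n) (disc_to_box n w) = norm_upto (Suc n) w / box_norm n w * norm_upto (Suc n) w"
  unfolding disc_to_box_def norms_restrict norm_upto_scale by simp

lemma disc_to_box_inverse:
  assumes "\<And>i. i > n \<Longrightarrow> w i = 0"
  shows "disc_to_box n (box_to_disc n w) = w" and "box_to_disc n (disc_to_box n w) = w"
proof -
  have zero: "w i = 0" if "norm_upto (Suc n) w = 0" for i
    using abs_le_norm_upto [of i "Suc n" w] that assms by (cases "i \<le> n") auto
  show "disc_to_box n (box_to_disc n w) = w"
  proof
    fix i
    show "disc_to_box n (box_to_disc n w) i = w i"
      using zero [of i] norm_zero_iff [of n w] assms [of i]
      unfolding disc_to_box_def norm_box_to_disc box_norm_box_to_disc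
      by (cases "norm_upto (Suc n) w = 0") (auto simp: box_to_disc_def)
  qed
  show "box_to_disc n (disc_to_box n w) = w"
  proof
    fix i
    show "box_to_disc n (disc_to_box n w) i = w i"
      using zero [of i] norm_zero_iff [of n w] assms [of i]
      unfolding box_to_disc_def norm_disc_to_box box_norm_disc_to_box
      by (cases "norm_upto (Suc n) w = 0") (auto simp: disc_to_box_def)
  qed
qed

lemma continuous_on_box_to_disc: "continuous_on UNIV (box_to_disc n)"
proof (rule continuous_on_coordinatewise_then_product)
  fix i
  note cont = continuous_on_norm_upto
  have cont_box: "continuous_on UNIV (box_norm n)"
    unfolding box_norm_def [abs_def] by (intro continuous_on_max continuous_on_rabs cont continuous_on_product_coordinates)
  have "isCont (\<lambda>w. box_to_disc n w i) v" for v
  proof (cases "i \<le> n \<and> norm_upto (Suc n) v = 0")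
    case True
    \<comment> \<open>At the origin the scaling factor is not continuous, but the values are bounded by the norm.\<close>
    have "(norm_upto (Suc n) \<longlongrightarrow> 0) (at v)"
      using cont [of "Suc n"] True by (metis UNIV_I continuous_on_eq_continuous_at isCont_def open_UNIV)
    then have "((\<lambda>w. box_to_disc n w i) \<longlongrightarrow> 0) (at v)"
    proof (rule Lim_null_comparison [rotated])
      have "norm (box_to_disc n w i) \<le> norm_upto (Suc n) w" for w
        using abs_le_norm_upto [of i "Suc n" "box_to_disc n w"] True box_norm_le [of n w]
        by (simp add: norm_box_to_disc)
      then show "\<forall>\<^sub>F w in at v. norm (box_to_disc n w i) \<le> norm_upto (Suc n) w" by simp
    qed
    moreover have "box_to_disc n v i = 0" using True by (simp add: box_to_disc_def)
    ultimately show ?thesis by (simp add: isCont_def)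
  next
    case False
    have i: "isCont (\<lambda>w. w i) v"
      using continuous_on_product_coordinates [of i] continuous_on_eq_continuous_at open_UNIV UNIV_I by blast
    have "isCont (norm_upto (Suc n)) v" "isCont (box_norm n) v"
      using cont [of "Suc n"] cont_box by (simp_all add: continuous_on_eq_continuous_at)
    with i False show ?thesis
      unfolding box_to_disc_def by (cases "i \<le> n") (auto intro!: continuous_intros)
  qed
  then show "continuous_on UNIV (\<lambda>w. box_to_disc n w i)"
    by (simp add: continuous_on_eq_continuous_at)
qed

lemma disc_set_norm: "disc_set n = {x. (\<forall>i\<ge>n. x i = 0) \<and> norm_upto n x \<le> 1}"
  by (simp add: disc_set_def norm_upto_def)

lemma disc_boundary_norm: "disc_boundary n = {x \<in> disc_set n. norm_upto n x = 1}"
  by (simp add: disc_boundary_alt norm_upto_def)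

lemma cylinder_to_disc:
  "homeomorphic_map (cylinder (closed_disc n)) (closed_disc (Suc n)) (cylinder_to_disc n)"
  "cylinder_to_disc n ` cylinder_boundary (closed_disc n) (disc_boundary n) = disc_boundary (Suc n)"
proof -
  let ?flat = "\<lambda>(x, t). x(n := 2 * t - 1) :: nat \<Rightarrow> real"
  let ?B = "{w. (\<forall>i>n. w i = 0) \<and> box_norm n w \<le> 1}"
  have flat_bn: "box_norm n (?flat (x, t)) = max (norm_upto n x) \<bar>2 * t - 1\<bar>" for x t
    by (auto simp: box_norm_def intro!: arg_cong2 [of _ _ _ _ max] norm_upto_cong)
  have flat: "?flat ` (disc_set n \<times> {0..1}) = ?B"
  proof
    show "?flat ` (disc_set n \<times> {0..1}) \<subseteq> ?B"
      using flat_bn by (force simp: disc_set_norm)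
    show "?B \<subseteq> ?flat ` (disc_set n \<times> {0..1})"
    proof
      fix w assume w: "w \<in> ?B"
      then have "norm_upto n w \<le> 1" "\<bar>w n\<bar> \<le> 1" by (auto simp: box_norm_def)
      moreover have "norm_upto n (w(n := 0)) = norm_upto n w"
        by (rule norm_upto_cong) simp
      ultimately have "(w(n := 0), (1 + w n) / 2) \<in> disc_set n \<times> {0..1}"
        using w by (auto simp: disc_set_norm)
      moreover have "?flat (w(n := 0), (1 + w n) / 2) = w" by (auto simp: field_simps)
      ultimately show "w \<in> ?flat ` (disc_set n \<times> {0..1})" by (rule image_eqI [OF sym, rotated])
    qed
  qed
  have flat_inj: "inj_on ?flat (disc_set n \<times> {0..1})"
  proof (rule inj_on_inverseI [where g = "\<lambda>w. (w(n := 0), (1 + w n) / 2)"])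
    fix z assume "z \<in> disc_set n \<times> {0..1::real}"
    then show "((?flat z)(n := 0), (1 + (?flat z) n) / 2) = z"
      by (auto simp: disc_set_def)
  qed
  have box: "box_to_disc n ` ?B = disc_set (Suc n)"
  proof
    show "box_to_disc n ` ?B \<subseteq> disc_set (Suc n)"
      using norm_box_to_disc by (auto simp: disc_set_norm box_to_disc_def)
    show "disc_set (Suc n) \<subseteq> box_to_disc n ` ?B"
    proof
      fix y assume y: "y \<in> disc_set (Suc n)"
      then have "disc_to_box n y \<in> ?B"
        using box_norm_disc_to_box [of n y] by (auto simp: disc_set_norm) (simp add: disc_to_box_def)
      moreover have "box_to_disc n (disc_to_box n y) = y"
        using y by (intro disc_to_box_inverse) (auto simp: disc_set_def)
      ultimately show "y \<in> box_to_disc n ` ?B"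
        using imageI [of "disc_to_box n y" ?B "box_to_disc n"] by argo
    qed
  qed
  have box_inj: "inj_on (box_to_disc n) ?B"
    by (rule inj_on_inverseI [where g = "disc_to_box n"]) (simp add: disc_to_box_inverse)
  have eq: "cylinder_to_disc n = box_to_disc n \<circ> ?flat"
    by (auto simp: cylinder_to_disc_def)
  have cyl: "cylinder (closed_disc n) = top_of_set (disc_set n \<times> {0..1})"
    by (simp add: closed_disc_top_of_set)
  show hom: "homeomorphic_map (cylinder (closed_disc n)) (closed_disc (Suc n)) (cylinder_to_disc n)"
  proof (rule continuous_imp_homeomorphic_map)
    have "continuous_on (disc_set n \<times> {0..1}) ?flat"
    proof (rule continuous_on_coordinatewise_then_product)
      fix i show "continuous_on (disc_set n \<times> {0..1}) (\<lambda>z. ?flat z i)"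
        using continuous_on_product_then_coordinatewise [OF continuous_on_fst [OF continuous_on_id], of "disc_set n \<times> {0..1}" i]
        by (cases "i = n") (auto simp: case_prod_unfold intro!: continuous_intros)
    qed
    then have "continuous_on (disc_set n \<times> {0..1}) (cylinder_to_disc n)"
      unfolding eq by (rule continuous_on_compose) (meson continuous_on_box_to_disc continuous_on_subset subset_UNIV)
    moreover have im: "cylinder_to_disc n ` (disc_set n \<times> {0..1}) = disc_set (Suc n)"
      unfolding eq image_comp [symmetric] flat box ..
    ultimately show "continuous_map (cylinder (closed_disc n)) (closed_disc (Suc n)) (cylinder_to_disc n)"
      unfolding cyl closed_disc_top_of_set by (auto simp: continuous_map_in_subtopology)
    show "cylinder_to_disc n ` topspace (cylinder (closed_disc n)) = topspace (closed_disc (Suc n))"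
      using im by simp
    show "inj_on (cylinder_to_disc n) (topspace (cylinder (closed_disc n)))"
      unfolding eq using comp_inj_on [OF flat_inj] box_inj flat by simp
    show "compact_space (cylinder (closed_disc n))"
      by (simp add: compact_space_prod_topology compact_closed_disc compact_space_subtopology)
  qed (rule Hausdorff_closed_disc)
  have on_boundary: "cylinder_to_disc n z \<in> disc_boundary (Suc n) \<longleftrightarrow> z \<in> cylinder_boundary (closed_disc n) (disc_boundary n)"
    if "z \<in> disc_set n \<times> {0..1}" for z
  proof (cases z)
    case (Pair x t)
    have "cylinder_to_disc n z \<in> disc_set (Suc n)"
      using imageI [OF imageI [OF that, of ?flat], of "box_to_disc n"]
      unfolding flat box eq by (simp only: comp_apply)
    then have "cylinder_to_disc n z \<in> disc_boundary (Suc n) \<longleftrightarrow> max (norm_upto n x) \<bar>2 * t - 1\<bar> = 1"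
      using flat_bn [of x t] unfolding disc_boundary_norm by (simp add: Pair cylinder_to_disc_def norm_box_to_disc)
    also have "\<dots> \<longleftrightarrow> norm_upto n x = 1 \<or> t = 0 \<or> t = 1"
      using that unfolding Pair disc_set_norm by (auto simp: max_def abs_if)
    finally show ?thesis
      using that unfolding Pair cylinder_boundary_def disc_boundary_norm by auto
  qed
  show "cylinder_to_disc n ` cylinder_boundary (closed_disc n) (disc_boundary n) = disc_boundary (Suc n)"
  proof
    have "cylinder_boundary (closed_disc n) (disc_boundary n) \<subseteq> disc_set n \<times> {0..1}"
      by (auto simp: cylinder_boundary_def)
    then show "cylinder_to_disc n ` cylinder_boundary (closed_disc n) (disc_boundary n) \<subseteq> disc_boundary (Suc n)"
      using on_boundary by blast
    show "disc_boundary (Suc n) \<subseteq> cylinder_to_disc n ` cylinder_boundary (closed_disc n) (disc_boundary n)"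
    proof
      fix y assume y: "y \<in> disc_boundary (Suc n)"
      then have "y \<in> cylinder_to_disc n ` (disc_set n \<times> {0..1})"
        unfolding eq image_comp [symmetric] flat box by (simp add: disc_boundary_norm)
      then show "y \<in> cylinder_to_disc n ` cylinder_boundary (closed_disc n) (disc_boundary n)"
        using on_boundary y by blast
    qed
  qed
qed

text \<open>A generator of \<open>H\<^sub>n(D\<^sup>n, S\<^sup>n\<^sup>-\<^sup>1)\<close> for every \<open>n\<close>. Taking suspensions as generators fixes all signs such that
  the prism over a cell carries the suspended generator.\<close>

primrec disc_class :: "nat \<Rightarrow> (nat \<Rightarrow> real) chain set" where
  "disc_class 0 = homologous_rel_set 0 (closed_disc 0) {} (frag_of (restrict (\<lambda>x i. 0) (standard_simplex 0)))"
| "disc_class (Suc n) =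
    hom_induced (int n + 1) (cylinder (closed_disc n)) (cylinder_boundary (closed_disc n) (disc_boundary n))
      (closed_disc (Suc n)) (disc_boundary (Suc n)) (cylinder_to_disc n)
      (susp (int n) (closed_disc n) (disc_boundary n) (disc_class n))"

lemma closed_disc_0: "closed_disc 0 = top_of_set {\<lambda>_. 0}" and disc_boundary_0: "disc_boundary 0 = {}"
proof -
  have "disc_set 0 = {\<lambda>_. 0}" by (auto simp: disc_set_def)
  then show "closed_disc 0 = top_of_set {\<lambda>_. 0}" "disc_boundary 0 = {}"
    by (auto simp: closed_disc_top_of_set disc_boundary_norm norm_upto_def)
qed

lemma cylinder_to_disc_iso:
  "hom_induced m (cylinder (closed_disc n)) (cylinder_boundary (closed_disc n) (disc_boundary n))
      (closed_disc (Suc n)) (disc_boundary (Suc n)) (cylinder_to_disc n) \<in>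
   iso (relative_homology_group m (cylinder (closed_disc n)) (cylinder_boundary (closed_disc n) (disc_boundary n)))
     (relative_homology_group m (closed_disc (Suc n)) (disc_boundary (Suc n)))"
  by (rule homeomorphic_map_relative_homology_iso [OF cylinder_to_disc(1) _ cylinder_to_disc(2)])
    (auto simp: cylinder_boundary_def)

theorem disc_homology:
  "is_basis (relative_homology_group (int n) (closed_disc n) (disc_boundary n)) {e} (\<lambda>_. disc_class n) \<and>
   (\<forall>m. m \<noteq> int n \<longrightarrow> trivial_group (relative_homology_group m (closed_disc n) (disc_boundary n)))"
proof (induction n)
  case 0
  let ?X = "closed_disc 0"
  let ?\<sigma> = "restrict (\<lambda>x i. 0 :: real) (standard_simplex 0)"
  have top: "topspace ?X = {\<lambda>_. 0}" by (simp add: closed_disc_0)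
  have \<sigma>: "singular_simplex 0 ?X ?\<sigma>"
    unfolding singular_simplex_def closed_disc_0 by (auto simp: continuous_map_in_subtopology)
  have "path_connected_space ?X"
    using top path_connected_space_topspace_empty
    by (metis path_connectedin_singleton path_connectedin_topspace singletonI)
  then have "pow (homology_group 0 ?X) (homologous_rel_set 0 ?X {} (frag_of ?\<sigma>)) \<in> iso integer_group (homology_group 0 ?X)"
    using \<sigma> by (rule iso_integer_zeroth_homology_group)
  moreover have "homologous_rel_set 0 ?X {} (frag_of ?\<sigma>) \<in> carrier (homology_group 0 ?X)"
    using homologous_rel_set_closed [of 0 ?X "{}" "frag_of ?\<sigma>"] \<sigma>
    by (simp add: singular_cycle singular_chain_of chain_boundary_def)
  ultimately have "is_basis (homology_group 0 ?X) {e} (\<lambda>_. disc_class 0)"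
    using is_basis_infinite_cyclic [OF group_relative_homology_group] by simp
  moreover have "trivial_group (homology_group m ?X)" if "m \<noteq> 0" for m
    using homology_dimension_axiom [OF top that] .
  ultimately show ?case by (simp add: disc_boundary_0)
next
  case (Suc n)
  let ?X = "closed_disc n" and ?A = "disc_boundary n"
  note S = susp_iso [OF disc_boundary_subset, of _ n]
  have iso: "(\<lambda>u. hom_induced (m + 1) (cylinder ?X) (cylinder_boundary ?X ?A) (closed_disc (Suc n)) (disc_boundary (Suc n))
      (cylinder_to_disc n) (susp m ?X ?A u)) \<in>
     iso (relative_homology_group m ?X ?A) (relative_homology_group (m + 1) (closed_disc (Suc n)) (disc_boundary (Suc n)))" for m
    using Group.iso_set_trans [OF S cylinder_to_disc_iso] by (simp add: comp_def)
  have "is_basis (relative_homology_group (int n + 1) (closed_disc (Suc n)) (disc_boundary (Suc n))) {e} (\<lambda>_. disc_class (Suc n))"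
    using is_basis_iso [OF conjunct1 [OF Suc.IH] iso] by simp
  moreover have "trivial_group (relative_homology_group m (closed_disc (Suc n)) (disc_boundary (Suc n)))" if "m \<noteq> int (Suc n)" for m
  proof -
    have "trivial_group (relative_homology_group (m - 1) ?X ?A)"
      using Suc.IH that by simp
    moreover have "relative_homology_group (m - 1) ?X ?A \<cong> relative_homology_group m (closed_disc (Suc n)) (disc_boundary (Suc n))"
      using iso [of "m - 1"] unfolding is_iso_def by auto
    ultimately show ?thesis
      using isomorphic_group_triviality by fastforce
  qed
  ultimately show ?case by (simp add: add.commute)
qed

section \<open>Attaching cells\<close>

text \<open>No quotient topology appears: as the disc is compact and \<open>Y\<close> is Hausdorff, \<open>Y\<close> is automatically the
  adjunction space.\<close>

definition attaches :: "'a topology \<Rightarrow> nat \<Rightarrow> 'a set \<Rightarrow> 'a set \<Rightarrow> ((nat \<Rightarrow> real) \<Rightarrow> 'a) \<Rightarrow> bool" where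
  "attaches Y n B e \<phi> \<longleftrightarrow>
     Hausdorff_space Y \<and> closedin Y B \<and> B \<inter> e = {} \<and> topspace Y = B \<union> e \<and>
     continuous_map (closed_disc n) Y \<phi> \<and> homeomorphic_map (open_disc n) (subtopology Y e) \<phi> \<and>
     \<phi> ` disc_boundary n \<subseteq> B"

lemma continuous_map_closed_cover:
  assumes S: "closedin X S" "continuous_map (subtopology X S) Y f"
    and T: "closedin X T" "continuous_map (subtopology X T) Y f"
    and cover: "topspace X \<subseteq> S \<union> T"
  shows "continuous_map X Y f"
proof -
  have sub: "S \<subseteq> topspace X" "T \<subseteq> topspace X" using S T by (auto dest: closedin_subset)
  have "f x \<in> topspace Y" if "x \<in> topspace X" for x
    using that cover sub S(2) T(2) by (auto simp: continuous_map_def)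
  moreover have "closedin X {x \<in> topspace X. f x \<in> C}" if C: "closedin Y C" for C
  proof -
    have c: "closedin X {x \<in> topspace (subtopology X S). f x \<in> C}" "closedin X {x \<in> topspace (subtopology X T). f x \<in> C}"
      using closedin_continuous_map_preimage [OF S(2) C] closedin_continuous_map_preimage [OF T(2) C] S(1) T(1)
      by (auto intro: closedin_trans_full)
    have "{x \<in> topspace X. f x \<in> C} =
       {x \<in> topspace (subtopology X S). f x \<in> C} \<union> {x \<in> topspace (subtopology X T). f x \<in> C}"
      using cover sub by auto
    then show ?thesis using closedin_Un [OF c] by (simp only:)
  qed
  ultimately show ?thesis
    unfolding continuous_map_closedin by auto
qed

lemma disc_set_cases:
  assumes "x \<in> disc_set n"
  obtains "x \<in> topspace (open_disc n)" "x \<notin> disc_boundary n" | "x \<in> disc_boundary n" "x \<notin> topspace (open_disc n)"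
  using assms by (auto simp: disc_boundary_def)

lemma zero_in_open_disc: "(\<lambda>_. 0) \<in> topspace (open_disc n)"
  by (simp add: topspace_open_disc disc_set_def)

text \<open>Applied to this attachment, \<open>attachment_excision\<close> describes the source of a characteristic map
  in the same way as its target.\<close>

lemma attaches_disc: "attaches (closed_disc n) n (disc_boundary n) (topspace (open_disc n)) id"
proof -
  have sub: "topspace (open_disc n) \<subseteq> disc_set n" by (auto simp: topspace_open_disc)
  have "disc_boundary n = {x \<in> disc_set n. norm_upto n x \<in> {1}}"
    by (simp add: disc_boundary_norm)
  moreover have "continuous_map (closed_disc n) euclideanreal (norm_upto n)"
    unfolding closed_disc_top_of_set using continuous_on_subset [OF continuous_on_norm_upto] by auto
  ultimately have "closedin (closed_disc n) (disc_boundary n)"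
    using closedin_continuous_map_preimage [of "closed_disc n" euclideanreal "norm_upto n" "{1}"] by simp
  then show ?thesis
    unfolding attaches_def open_disc_subtopology [symmetric]
    using sub by (auto simp: Hausdorff_closed_disc disc_boundary_def)
qed

lemma attaches_image:
  assumes "attaches Y n B e \<phi>"
  shows "\<phi> ` topspace (open_disc n) = e" "inj_on \<phi> (topspace (open_disc n))"
    "x \<in> disc_set n \<Longrightarrow> \<phi> x \<in> B \<longleftrightarrow> x \<in> disc_boundary n"
    "x \<in> disc_set n \<Longrightarrow> \<phi> x = \<phi> (\<lambda>_. 0) \<longleftrightarrow> x = (\<lambda>_. 0)"
proof -
  have h: "homeomorphic_map (open_disc n) (subtopology Y e) \<phi>" and e: "e \<subseteq> topspace Y" "B \<inter> e = {}"
    and b: "\<phi> ` disc_boundary n \<subseteq> B"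
    using assms by (auto simp: attaches_def)
  show im: "\<phi> ` topspace (open_disc n) = e"
    using homeomorphic_imp_surjective_map [OF h] e by auto
  show inj: "inj_on \<phi> (topspace (open_disc n))"
    by (rule homeomorphic_imp_injective_map [OF h])
  show 3: "\<phi> x \<in> B \<longleftrightarrow> x \<in> disc_boundary n" if "x \<in> disc_set n" for x
    using that im e b by (cases rule: disc_set_cases) auto
  show "\<phi> x = \<phi> (\<lambda>_. 0) \<longleftrightarrow> x = (\<lambda>_. 0)" if x: "x \<in> disc_set n"
    using x
  proof (cases rule: disc_set_cases)
    case 1
    then show ?thesis using inj zero_in_open_disc by (meson inj_onD)
  next
    case 2
    then have "\<phi> x \<in> B" using b by blast
    moreover have "\<phi> (\<lambda>_. 0) \<notin> B" using im e zero_in_open_disc by blast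
    ultimately show ?thesis by auto
  qed
qed

text \<open>The point at time \<open>s\<close> on the way from \<open>x\<close> radially to the boundary of the disc.\<close>

definition stretch :: "nat \<Rightarrow> real \<Rightarrow> (nat \<Rightarrow> real) \<Rightarrow> nat \<Rightarrow> real" where
  "stretch n s x = (\<lambda>i. ((1 - s) + s / norm_upto n x) * x i)"

lemma norm_upto_eq_0: "x \<in> disc_set n \<Longrightarrow> norm_upto n x = 0 \<longleftrightarrow> x = (\<lambda>_. 0)"
proof
  assume x: "x \<in> disc_set n" "norm_upto n x = 0"
  have "x i = 0" for i
    using x abs_le_norm_upto [of i n x] by (cases "i < n") (auto simp: disc_set_def)
  then show "x = (\<lambda>_. 0)" by auto
qed (simp add: norm_upto_def)

lemma stretch:
  assumes x: "x \<in> disc_set n" "x \<noteq> (\<lambda>_. 0)" and s: "s \<in> {0..1}"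
  shows "stretch n s x \<in> disc_set n" "stretch n s x \<noteq> (\<lambda>_. 0)" "stretch n 0 x = x"
    "stretch n 1 x \<in> disc_boundary n" "x \<in> disc_boundary n \<Longrightarrow> stretch n s x = x"
proof -
  have pos: "norm_upto n x > 0"
    using norm_upto_eq_0 [OF x(1)] x(2) norm_upto_nonneg [of n x] by linarith
  have le: "norm_upto n x \<le> 1" using x by (simp add: disc_set_norm)
  have nrm: "norm_upto n (stretch n s x) = (1 - s) * norm_upto n x + s" if "s \<in> {0..1}" for s
  proof -
    have "0 \<le> (1 - s) + s / norm_upto n x" using that pos by simp
    then show ?thesis
      unfolding stretch_def norm_upto_scale using pos by (simp add: field_simps)
  qed
  have z: "\<forall>i\<ge>n. stretch n s x i = 0" for s
    using x by (simp add: stretch_def disc_set_def)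
  have "(1 - s) * norm_upto n x + s \<le> 1"
    using mult_left_mono [OF le, of "1 - s"] s by simp
  then show 1: "stretch n s x \<in> disc_set n"
    using nrm [OF s] z by (simp add: disc_set_norm)
  have "(1 - s) * norm_upto n x + s > 0"
    using pos s by (cases "s = 0") (auto simp: add_nonneg_pos)
  then show "stretch n s x \<noteq> (\<lambda>_. 0)"
    using nrm [OF s] norm_upto_eq_0 [OF 1] by auto
  show "stretch n 0 x = x" by (simp add: stretch_def)
  show "stretch n 1 x \<in> disc_boundary n"
    using nrm [of 1] z by (simp add: disc_boundary_norm disc_set_norm)
  show "stretch n s x = x" if "x \<in> disc_boundary n"
    using that by (simp add: stretch_def disc_boundary_norm)
qed

lemma continuous_map_stretch:
  "continuous_map (subtopology (prod_topology (top_of_set {0..1}) (closed_disc n)) ({0..1} \<times> (disc_set n - {\<lambda>_. 0})))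
     (closed_disc n) (\<lambda>(s, x). stretch n s x)"
proof -
  let ?S = "{0..1} \<times> (disc_set n - {\<lambda>_. 0}) :: (real \<times> (nat \<Rightarrow> real)) set"
  have "continuous_on ?S (\<lambda>(s, x). stretch n s x)"
  proof (rule continuous_on_coordinatewise_then_product)
    fix i
    have "continuous_on ?S (\<lambda>z. norm_upto n (snd z))"
      by (rule continuous_on_compose2 [OF continuous_on_norm_upto continuous_on_snd [OF continuous_on_id]]) auto
    moreover have "continuous_on ?S (\<lambda>z. snd z i)"
      by (rule continuous_on_product_then_coordinatewise [OF continuous_on_snd [OF continuous_on_id]])
    ultimately show "continuous_on ?S (\<lambda>z. (case z of (s, x) \<Rightarrow> stretch n s x) i)"
      unfolding stretch_def case_prod_unfold
      using norm_upto_eq_0 by (intro continuous_intros) auto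
  qed
  moreover have "(\<lambda>(s, x). stretch n s x) \<in> ?S \<rightarrow> disc_set n"
  proof
    fix z :: "real \<times> (nat \<Rightarrow> real)" assume "z \<in> ?S"
    then obtain s x where "z = (s, x)" "s \<in> {0..1}" "x \<in> disc_set n" "x \<noteq> (\<lambda>_. 0)" by blast
    then show "(case z of (s, x) \<Rightarrow> stretch n s x) \<in> disc_set n"
      using stretch(1) [of x n s] by simp
  qed
  moreover have "subtopology (prod_topology (top_of_set {0..1}) (closed_disc n)) ?S = top_of_set ?S"
  proof -
    have "({0..1} \<times> disc_set n) \<inter> ?S = ?S" by auto
    then show ?thesis
      by (simp add: closed_disc_top_of_set subtopology_subtopology)
  qed
  ultimately show ?thesis
    by (simp add: closed_disc_top_of_set continuous_map_in_subtopology)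
qed

text \<open>Away from its centre, an attached cell can be pushed radially onto the subspace to which it is
  attached. The push is continuous because the closed disc is compact, so that the characteristic
  map times the identity of the interval is a closed map and hence a quotient map.\<close>

lemma trivial_punctured_attachment:
  assumes att: "attaches Y n B e \<phi>"
  shows "trivial_group (relative_homology_group m (subtopology Y (topspace Y - {\<phi> (\<lambda>_. 0)})) B)"
proof -
  define ctr where "ctr = \<phi> (\<lambda>_. 0)"
  define Z0 where "Z0 = topspace Y - {ctr}"
  let ?D = "closed_disc n" and ?I = "top_of_set {0..1::real}"
  have Y: "Hausdorff_space Y" "closedin Y B" "B \<inter> e = {}" "topspace Y = B \<union> e"
    and cont: "continuous_map ?D Y \<phi>" and bd: "\<phi> ` disc_boundary n \<subseteq> B"
    using att by (auto simp: attaches_def)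
  note im = attaches_image [OF att]
  have ctr: "ctr \<in> e" "ctr \<notin> B"
    using im(1) zero_in_open_disc Y by (auto simp: ctr_def)
  have B: "B \<subseteq> Z0" using Y ctr by (auto simp: Z0_def)
  define \<psi> where "\<psi> = inv_into (topspace (open_disc n)) \<phi>"
  have \<psi>: "\<psi> (\<phi> x) = x" if "x \<in> topspace (open_disc n)" for x
    using that im(2) by (simp add: \<psi>_def)
  define F where "F = (\<lambda>(s, z). if z \<in> B then z else \<phi> (stretch n s (\<psi> z)))"
  have F\<phi>: "F (s, \<phi> x) = \<phi> (stretch n s x)" if "x \<in> disc_set n" "x \<noteq> (\<lambda>_. 0)" "s \<in> {0..1}" for s x
    using that(1)
  proof (cases rule: disc_set_cases)
    case 1
    then show ?thesis using im(3) [OF that(1)] \<psi> by (simp add: F_def)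
  next
    case 2
    then show ?thesis using im(3) [OF that(1)] stretch(5) [OF that] by (simp add: F_def)
  qed
  have FB: "F (s, z) = z" if "z \<in> B" for s z using that by (simp add: F_def)
  have pre: "\<exists>x \<in> disc_set n. x \<noteq> (\<lambda>_. 0) \<and> z = \<phi> x" if "z \<in> Z0" "z \<notin> B" for z
  proof -
    have "z \<in> \<phi> ` topspace (open_disc n)" using that im(1) Y by (auto simp: Z0_def)
    then obtain x where "x \<in> topspace (open_disc n)" "z = \<phi> x" by blast
    then show ?thesis using that by (intro bexI [of _ x]) (auto simp: Z0_def ctr_def topspace_open_disc)
  qed
  have FZ0: "F (s, z) \<in> Z0" if z: "z \<in> Z0" and s: "s \<in> {0..1}" for s z
  proof (cases "z \<in> B")
    case False
    then obtain x where x: "x \<in> disc_set n" "x \<noteq> (\<lambda>_. 0)" "z = \<phi> x" using pre z by blast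
    have "\<phi> (stretch n s x) \<noteq> ctr"
      unfolding ctr_def using im(4) stretch(1,2) [OF x(1,2) s] by blast
    moreover have "\<phi> (stretch n s x) \<in> topspace Y"
      using cont stretch(1) [OF x(1,2) s] by (auto simp: continuous_map_def)
    ultimately show ?thesis using F\<phi> [OF x(1,2) s] x(3) by (simp add: Z0_def)
  qed (use FB z in auto)
  have F0: "F (0, z) = z" if "z \<in> Z0" for z
  proof (cases "z \<in> B")
    case False
    then obtain x where x: "x \<in> disc_set n" "x \<noteq> (\<lambda>_. 0)" "z = \<phi> x" using pre [OF \<open>z \<in> Z0\<close>] by blast
    then show ?thesis using F\<phi> [of x 0] stretch(3) [of x n 0] by simp
  qed (use FB in auto)
  have F1: "F (1, z) \<in> B" if "z \<in> Z0" for z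
  proof (cases "z \<in> B")
    case False
    then obtain x where x: "x \<in> disc_set n" "x \<noteq> (\<lambda>_. 0)" "z = \<phi> x" using pre [OF \<open>z \<in> Z0\<close>] by blast
    then show ?thesis using F\<phi> [of x 1] stretch(4) [of x n 1] bd by auto
  qed (use FB in auto)
  let ?X = "subtopology Y Z0"
  let ?G = "prod_topology ?I Y"
  let ?P = "prod_topology ?I ?X"
  have P: "?P = subtopology ?G ({0..1} \<times> Z0)"
    by (simp add: prod_topology_subtopology)
  have topP: "topspace ?P = {0..1} \<times> Z0" by (auto simp: Z0_def)
  \<comment> \<open>\<open>B\<close> and the closed cell \<open>K\<close> are a closed cover. On the part over \<open>B\<close> the push is constant, and
    on the part over \<open>K\<close> it descends from the punctured disc.\<close>
  define K where "K = \<phi> ` disc_set n"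
  have K: "closedin Y K"
    unfolding K_def using image_compactin [OF _ cont, of "disc_set n"] compact_closed_disc [of n] Y(1)
    by (simp add: compact_space_def compactin_imp_closedin)
  have F_cont: "continuous_map ?P Y F"
  proof (rule continuous_map_closed_cover [where S = "{0..1} \<times> B" and T = "{0..1} \<times> (K \<inter> Z0)"])
    show "closedin ?P ({0..1} \<times> B)"
      using Y(2) B by (auto simp: closedin_prod_Times_iff closedin_subtopology)
    show "closedin ?P ({0..1} \<times> (K \<inter> Z0))"
      using K by (auto simp: closedin_prod_Times_iff closedin_subtopology)
    show "topspace ?P \<subseteq> {0..1} \<times> B \<union> {0..1} \<times> (K \<inter> Z0)"
      unfolding topP K_def using pre by auto
    have "continuous_map ?P Y snd"
      by (meson continuous_map_into_fulltopology continuous_map_snd)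
    then show "continuous_map (subtopology ?P ({0..1} \<times> B)) Y F"
      by (intro continuous_map_eq [OF continuous_map_from_subtopology [of ?P Y snd]]) (auto simp: FB)
    let ?q = "map_prod (id :: real \<Rightarrow> real) \<phi>"
    let ?E = "prod_topology ?I ?D" and ?U = "{0..1} \<times> (disc_set n - {\<lambda>_. 0}) :: (real \<times> (nat \<Rightarrow> real)) set"
    have q: "continuous_map ?E ?G ?q"
      using cont by (simp add: map_prod_def continuous_map_prod_top)
    have "compact_space ?E"
      by (simp add: compact_space_prod_topology compact_closed_disc compact_space_subtopology)
    moreover have "Hausdorff_space ?G"
      by (simp add: Hausdorff_space_prod_topology Y Hausdorff_space_subtopology)
    ultimately have "closed_map ?E ?G ?q"
      using q by (rule continuous_imp_closed_map [rotated])
    moreover have U: "{z \<in> topspace ?E. ?q z \<in> {0..1} \<times> (K \<inter> Z0)} = ?U"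
    proof -
      have "\<phi> x \<in> K \<inter> Z0 \<longleftrightarrow> x \<noteq> (\<lambda>_. 0)" if "x \<in> disc_set n" for x
        using im(4) [OF that] that cont by (auto simp: K_def Z0_def ctr_def continuous_map_def)
      moreover have "\<phi> (\<lambda>_. 0) \<notin> Z0" by (simp add: Z0_def ctr_def)
      ultimately show ?thesis by (auto simp del: Int_iff)
    qed
    ultimately have closed: "closed_map (subtopology ?E ?U) (subtopology ?G ({0..1} \<times> (K \<inter> Z0))) ?q"
      by (rule closed_map_restriction)
    have PK: "subtopology ?P ({0..1} \<times> (K \<inter> Z0)) = subtopology ?G ({0..1} \<times> (K \<inter> Z0))"
      unfolding P subtopology_subtopology by (rule arg_cong [of _ _ "subtopology ?G"]) auto
    have topE: "topspace (subtopology ?E ?U) = ?U" by auto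
    have "quotient_map (subtopology ?E ?U) (subtopology ?G ({0..1} \<times> (K \<inter> Z0))) ?q"
    proof (rule continuous_closed_imp_quotient_map [OF _ closed])
      show "continuous_map (subtopology ?E ?U) (subtopology ?G ({0..1} \<times> (K \<inter> Z0))) ?q"
        using q U by (auto simp: continuous_map_in_subtopology continuous_map_from_subtopology)
      show "?q ` topspace (subtopology ?E ?U) = topspace (subtopology ?G ({0..1} \<times> (K \<inter> Z0)))"
      proof
        show "topspace (subtopology ?G ({0..1} \<times> (K \<inter> Z0))) \<subseteq> ?q ` topspace (subtopology ?E ?U)"
          unfolding topE
        proof
          fix z assume "z \<in> topspace (subtopology ?G ({0..1} \<times> (K \<inter> Z0)))"
          then obtain s x where "z = (s, \<phi> x)" "s \<in> {0..1}" "x \<in> disc_set n" "\<phi> x \<in> Z0"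
            by (auto simp: K_def)
          moreover from this have "x \<noteq> (\<lambda>_. 0)" by (auto simp: Z0_def ctr_def)
          ultimately show "z \<in> ?q ` ?U" by (intro image_eqI [where x = "(s, x)"]) auto
        qed
        show "?q ` topspace (subtopology ?E ?U) \<subseteq> topspace (subtopology ?G ({0..1} \<times> (K \<inter> Z0)))"
        proof -
          have "topspace (subtopology ?G ({0..1} \<times> (K \<inter> Z0))) = {0..1} \<times> (K \<inter> Z0)"
            by (auto simp: Z0_def)
          moreover have "?q z \<in> {0..1} \<times> (K \<inter> Z0)" if "z \<in> ?U" for z
          proof -
            from that have "z \<in> {z \<in> topspace ?E. ?q z \<in> {0..1} \<times> (K \<inter> Z0)}"
              by (simp only: U)
            then show ?thesis by (simp only: mem_Collect_eq)
          qed
          ultimately show ?thesis unfolding topE by (metis (no_types) image_subsetI)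
        qed
      qed
    qed
    moreover have "continuous_map (subtopology ?E ?U) Y (F \<circ> ?q)"
    proof (rule continuous_map_eq)
      show "continuous_map (subtopology ?E ?U) Y (\<phi> \<circ> (\<lambda>(s, x). stretch n s x))"
        by (rule continuous_map_compose [OF continuous_map_stretch cont])
      fix z assume "z \<in> topspace (subtopology ?E ?U)"
      then obtain s x where z: "z = (s, x)" "s \<in> {0..1}" "x \<in> disc_set n" "x \<noteq> (\<lambda>_. 0)"
        unfolding topE by blast
      then show "(\<phi> \<circ> (\<lambda>(s, x). stretch n s x)) z = (F \<circ> ?q) z"
        using F\<phi> [OF z(3,4,2)] by simp
    qed
    ultimately show "continuous_map (subtopology ?P ({0..1} \<times> (K \<inter> Z0))) Y F"
      unfolding PK by (rule continuous_compose_quotient_map)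
  qed
  then have F_cont: "continuous_map ?P ?X F"
    using FZ0 topP by (auto simp: continuous_map_in_subtopology)
  define f where "f = (\<lambda>z. F (1, z))"
  have "homotopic_with (\<lambda>x. True) ?X ?X id f"
    using F_cont F0 f_def by (subst homotopic_with) (auto simp: Z0_def intro!: exI [of _ F])
  then have hom: "homotopic_with (\<lambda>x. True) ?X ?X f id"
    by (simp add: homotopic_with_sym)
  have XB: "subtopology ?X B = subtopology Y B"
    using B by (simp add: subtopology_subtopology Int_absorb1)
  have "trivial_group (relative_homology_group m ?X B)"
  proof (rule trivial_relative_homology_group_gen [OF _ _ hom])
    show f: "continuous_map ?X (subtopology ?X B) f"
      using homotopic_with_imp_continuous_maps [OF hom] F1
      by (auto simp: continuous_map_in_subtopology f_def Z0_def)
    show "homotopic_with (\<lambda>h. True) (subtopology ?X B) (subtopology ?X B) f id"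
    proof (rule homotopic_with_equal)
      show "continuous_map (subtopology ?X B) (subtopology ?X B) f"
        using f by (rule continuous_map_from_subtopology)
    qed (auto simp: f_def FB)
  qed
  then show ?thesis by (simp add: Z0_def ctr_def)
qed

text \<open>Enlarging \<open>B\<close> to the complement of the centre of the cell does not change the relative homology, and
  afterwards \<open>B\<close> can be excised, which leaves the open cell.\<close>

lemma attachment_excision:
  assumes att: "attaches Y n B e \<phi>"
  defines "ctr \<equiv> \<phi> (\<lambda>_. 0)"
  shows "hom_induced m Y B Y (topspace Y - {ctr}) id \<in>
      iso (relative_homology_group m Y B) (relative_homology_group m Y (topspace Y - {ctr}))"
    and "hom_induced m (subtopology Y e) (e - {ctr}) Y (topspace Y - {ctr}) id \<in>
      iso (relative_homology_group m (subtopology Y e) (e - {ctr})) (relative_homology_group m Y (topspace Y - {ctr}))"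
proof -
  have Y: "Hausdorff_space Y" "closedin Y B" "B \<inter> e = {}" "topspace Y = B \<union> e"
    using att by (auto simp: attaches_def)
  have ctr: "ctr \<in> e" "ctr \<notin> B"
    using attaches_image(1) [OF att] zero_in_open_disc Y by (auto simp: ctr_def)
  show "hom_induced m Y B Y (topspace Y - {ctr}) id \<in>
      iso (relative_homology_group m Y B) (relative_homology_group m Y (topspace Y - {ctr}))"
    using trivial_punctured_attachment [OF att] ctr Y unfolding ctr_def by (intro trivial_triple_iso) auto
  have "closedin Y {ctr}"
    using Y ctr by (simp add: closedin_Hausdorff_singleton)
  then have "openin Y (topspace Y - {ctr})" by blast
  then have "Y closure_of B \<subseteq> Y interior_of (topspace Y - {ctr})"
    using Y ctr by (auto simp: closure_of_closedin interior_of_openin)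
  then have "hom_induced m (subtopology Y (topspace Y - B)) (topspace Y - {ctr} - B) (subtopology Y (topspace Y)) (topspace Y - {ctr}) id
    \<in> iso (relative_homology_group m (subtopology Y (topspace Y - B)) (topspace Y - {ctr} - B))
        (relative_homology_group m (subtopology Y (topspace Y)) (topspace Y - {ctr}))"
    by (rule homology_excision_axiom) auto
  moreover have "topspace Y - B = e" "topspace Y - {ctr} - B = e - {ctr}" using Y by auto
  ultimately show "hom_induced m (subtopology Y e) (e - {ctr}) Y (topspace Y - {ctr}) id \<in>
      iso (relative_homology_group m (subtopology Y e) (e - {ctr})) (relative_homology_group m Y (topspace Y - {ctr}))"
    by simp
qed

text \<open>The open disc and the open cell are homeomorphic, and \<open>attachment_excision\<close> identifies the relative
  homology of the closed disc and of \<open>Y\<close> with theirs.\<close>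

theorem attachment_iso:
  assumes att: "attaches Y n B e \<phi>"
  shows "hom_induced m (closed_disc n) (disc_boundary n) Y B \<phi> \<in>
    iso (relative_homology_group m (closed_disc n) (disc_boundary n)) (relative_homology_group m Y B)"
proof -
  define ctr where "ctr = \<phi> (\<lambda>_. 0)"
  define Z0 where "Z0 = topspace Y - {ctr}"
  let ?D = "closed_disc n" and ?S = "disc_boundary n" and ?z = "\<lambda>_. 0 :: real" and ?O = "topspace (open_disc n)"
  let ?DP = "topspace ?D - {?z}"
  have cont: "continuous_map ?D Y \<phi>" and bd: "\<phi> \<in> ?S \<rightarrow> B" and
    hom: "homeomorphic_map (open_disc n) (subtopology Y e) \<phi>"
    using att by (auto simp: attaches_def)
  note im = attaches_image [OF att]
  note Y = attachment_excision [OF att, folded ctr_def, folded Z0_def]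
  have D: "hom_induced m ?D ?S ?D ?DP id \<in> iso (relative_homology_group m ?D ?S) (relative_homology_group m ?D ?DP)"
    "hom_induced m (open_disc n) (?O - {?z}) ?D ?DP id \<in>
      iso (relative_homology_group m (open_disc n) (?O - {?z})) (relative_homology_group m ?D ?DP)"
    using attachment_excision [OF attaches_disc, of m n] by (simp_all add: open_disc_subtopology [symmetric])
  have z: "?z \<notin> ?S" using zero_in_open_disc by (auto simp: disc_boundary_def)
  have \<phi>0: "\<phi> \<in> ?DP \<rightarrow> Z0"
    using im(4) cont by (auto simp: Z0_def ctr_def continuous_map_def)
  have O: "hom_induced m (open_disc n) (?O - {?z}) (subtopology Y e) (e - {ctr}) \<phi> \<in>
     iso (relative_homology_group m (open_disc n) (?O - {?z})) (relative_homology_group m (subtopology Y e) (e - {ctr}))"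
  proof (rule homeomorphic_map_relative_homology_iso [OF hom])
    show "\<phi> ` (?O - {?z}) = e - {ctr}"
      using im(1,2) zero_in_open_disc [of n] by (auto simp: ctr_def inj_on_def)
  qed auto
  have comm: "hom_induced m ?D ?DP Y Z0 \<phi> (hom_induced m (open_disc n) (?O - {?z}) ?D ?DP id x) =
      (hom_induced m (subtopology Y e) (e - {ctr}) Y Z0 id \<circ> hom_induced m (open_disc n) (?O - {?z}) (subtopology Y e) (e - {ctr}) \<phi>) x" for x
  proof -
    have c1: "continuous_map (open_disc n) ?D id"
      by (subst open_disc_subtopology) (simp add: continuous_map_from_subtopology)
    have c2: "continuous_map (subtopology Y e) Y id" "continuous_map (open_disc n) (subtopology Y e) \<phi>"
      using hom by (auto simp: homeomorphic_imp_continuous_map continuous_map_from_subtopology)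
    have s: "id \<in> ?O - {?z} \<rightarrow> ?DP" "\<phi> \<in> ?O - {?z} \<rightarrow> e - {ctr}" "id \<in> e - {ctr} \<rightarrow> Z0"
      using im(1,2) zero_in_open_disc [of n] att
      by (auto simp: topspace_open_disc ctr_def inj_on_def Z0_def attaches_def)
    show ?thesis
      unfolding comp_apply hom_induced_compose' [OF c1 s(1) cont \<phi>0] hom_induced_compose' [OF c2(2) s(2) c2(1) s(3)]
      by simp
  qed
  have iso1: "hom_induced m ?D ?DP Y Z0 \<phi> \<in> iso (relative_homology_group m ?D ?DP) (relative_homology_group m Y Z0)"
    by (rule iso_cancel_left [OF D(2) hom_induced_hom Group.iso_set_trans [OF O Y(2)] comm])
  note iso0 = Group.iso_set_trans [OF D(1) iso1]
  show ?thesis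
  proof (rule iso_cancel_right [OF hom_induced_hom Y(1) iso0])
    fix x assume "x \<in> carrier (relative_homology_group m ?D ?S)"
    have s: "id \<in> ?S \<rightarrow> ?DP" "id \<in> B \<rightarrow> Z0"
      using z disc_boundary_subset [of n] im(1) zero_in_open_disc [of n] att
      by (auto simp: Z0_def attaches_def ctr_def)
    have idD: "continuous_map ?D ?D id" and idY: "continuous_map Y Y id" by auto
    show "hom_induced m Y B Y Z0 id (hom_induced m ?D ?S Y B \<phi> x) =
      (hom_induced m ?D ?DP Y Z0 \<phi> \<circ> hom_induced m ?D ?S ?D ?DP id) x"
      unfolding comp_apply hom_induced_compose' [OF cont bd idY s(2)] hom_induced_compose' [OF idD s(1) cont \<phi>0]
      by simp
  qed
qed

text \<open>Attaching one more cell of the same dimension extends the group by an infinite cyclic one,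
  because the homology of the new pair vanishes in the next higher degree.\<close>

theorem attached_cells_basis:
  fixes Y :: "'a topology" and \<phi> :: "'a set \<Rightarrow> (nat \<Rightarrow> real) \<Rightarrow> 'a"
  assumes Y: "Hausdorff_space Y" "closedin Y B" and "finite T"
    and cell: "\<And>e. e \<in> T \<Longrightarrow> e \<subseteq> topspace Y \<and> e \<inter> B = {} \<and> continuous_map (closed_disc n) Y (\<phi> e) \<and>
      homeomorphic_map (open_disc n) (subtopology Y e) (\<phi> e) \<and> \<phi> e ` disc_boundary n \<subseteq> B"
    and disj: "pairwise disjnt T"
  shows "is_basis (relative_homology_group (int n) (subtopology Y (B \<union> \<Union>T)) B) T
      (\<lambda>e. hom_induced (int n) (closed_disc n) (disc_boundary n) (subtopology Y (B \<union> \<Union>T)) B (\<phi> e) (disc_class n)) \<and>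
    (\<forall>m. m \<noteq> int n \<longrightarrow> trivial_group (relative_homology_group m (subtopology Y (B \<union> \<Union>T)) B)) \<and>
    closedin Y (B \<union> \<Union>T)"
  using \<open>finite T\<close> cell disj
proof (induction T rule: finite_induct)
  case empty
  have "trivial_group (relative_homology_group m (subtopology Y B) B)" for m
    using trivial_relative_homology_group_topspace [of m "subtopology Y B"] closedin_subset [OF Y(2)]
    by (simp add: Int_absorb1)
  then show ?case by (simp add: is_basis_empty Y)
next
  case (insert e T)
  let ?D = "closed_disc n" and ?S = "disc_boundary n"
  define B1 where "B1 = B \<union> \<Union>T"
  define Z where "Z = subtopology Y (B1 \<union> e)"
  have Zeq: "subtopology Y (B \<union> \<Union>(insert e T)) = Z" and seteq: "B \<union> \<Union>(insert e T) = B1 \<union> e"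
    by (auto simp: Z_def B1_def ac_simps)
  have IH: "is_basis (relative_homology_group (int n) (subtopology Y B1) B) T
      (\<lambda>e. hom_induced (int n) ?D ?S (subtopology Y B1) B (\<phi> e) (disc_class n))"
    "\<And>m. m \<noteq> int n \<Longrightarrow> trivial_group (relative_homology_group m (subtopology Y B1) B)"
    "closedin Y B1"
    using insert.IH insert.prems unfolding B1_def by (auto simp: pairwise_insert)
  have e: "e \<subseteq> topspace Y" "e \<inter> B = {}" "continuous_map ?D Y (\<phi> e)"
      "homeomorphic_map (open_disc n) (subtopology Y e) (\<phi> e)" "\<phi> e ` ?S \<subseteq> B"
    using insert.prems(1) [of e] by auto
  have "e \<inter> e' = {}" if "e' \<in> T" for e'
    using insert.prems(2) insert.hyps(2) that unfolding pairwise_insert disjnt_def by blast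
  then have eB1: "B1 \<inter> e = {}"
    using e(2) unfolding B1_def by blast
  have e_im: "\<phi> e ` topspace (open_disc n) = e"
    using homeomorphic_imp_surjective_map [OF e(4)] e(1) by auto
  have D_im: "\<phi> e ` disc_set n \<subseteq> B1 \<union> e"
  proof
    fix y assume "y \<in> \<phi> e ` disc_set n"
    then obtain x where x: "x \<in> disc_set n" "y = \<phi> e x" by blast
    from x(1) show "y \<in> B1 \<union> e"
      by (cases rule: disc_set_cases) (use x(2) e(5) e_im in \<open>auto simp: B1_def\<close>)
  qed
  have topZ: "topspace Z = B1 \<union> e"
    using e(1) closedin_subset [OF IH(3)] by (auto simp: Z_def)
  have ZB1: "subtopology Z B1 = subtopology Y B1"
    by (simp add: Z_def subtopology_subtopology Int_absorb1 Int_commute Un_upper1)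
  have Ze: "subtopology Z e = subtopology Y e"
    by (simp add: Z_def subtopology_subtopology Int_absorb1 Int_commute Un_upper2)
  have contZ: "continuous_map ?D Z (\<phi> e')" if "e' \<in> insert e T" for e'
  proof -
    have "\<phi> e' ` disc_set n \<subseteq> B1 \<union> e"
    proof
      fix y assume "y \<in> \<phi> e' ` disc_set n"
      then obtain x where x: "x \<in> disc_set n" "y = \<phi> e' x" by blast
      have "\<phi> e' ` topspace (open_disc n) = e'" "\<phi> e' ` ?S \<subseteq> B"
        using homeomorphic_imp_surjective_map insert.prems(1) [OF that] by fastforce+
      with x(1) show "y \<in> B1 \<union> e"
        by (cases rule: disc_set_cases) (use x(2) that in \<open>auto simp: B1_def\<close>)
    qed
    then show ?thesis
      using insert.prems(1) [OF that] by (auto simp: Z_def continuous_map_in_subtopology)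
  qed
  have att: "attaches Z n B1 e (\<phi> e)"
    unfolding attaches_def Ze topZ
    using Y(1) IH(3) eB1 contZ [of e] e by (auto simp: Z_def Hausdorff_space_subtopology closedin_subtopology B1_def)
  note iso = attachment_iso [OF att]
  have b1: "is_basis (relative_homology_group (int n) Z B1) {e} (\<lambda>_. hom_induced (int n) ?D ?S Z B1 (\<phi> e) (disc_class n))"
    using is_basis_iso [OF conjunct1 [OF disc_homology] iso] .
  have t1: "trivial_group (relative_homology_group m Z B1)" if "m \<noteq> int n" for m
    using disc_homology [of n "undefined :: nat"] that iso isomorphic_group_triviality unfolding is_iso_def
    by (metis empty_iff group_relative_homology_group)
  have BB1: "B \<subseteq> B1" by (auto simp: B1_def)
  note ex = triple_kernels [OF BB1, where X = Z, unfolded ZB1]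
  have "is_basis (relative_homology_group (int n) Z B) (T \<union> {e})
      (\<lambda>e. hom_induced (int n) ?D ?S Z B (\<phi> e) (disc_class n))"
  proof (rule is_basis_extension [OF _ _ _ _ _ _ ex(1) IH(1) b1])
    show "inj_on (hom_induced (int n) (subtopology Y B1) B Z B id) (carrier (relative_homology_group (int n) (subtopology Y B1) B))"
    proof -
      have "kernel (relative_homology_group (int n) (subtopology Y B1) B) (relative_homology_group (int n) Z B)
         (hom_induced (int n) (subtopology Y B1) B Z B id) = {\<one>\<^bsub>relative_homology_group (int n) (subtopology Y B1) B\<^esub>}"
      proof -
        have "carrier (relative_homology_group (int n + 1) Z B1) = {\<one>\<^bsub>relative_homology_group (int n + 1) Z B1\<^esub>}"
          using t1 [of "int n + 1"] by (simp add: trivial_group_def)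
        then show ?thesis
          using ex(3) [of "int n + 1"] hom_one [OF group_homomorphism_hom_relboundary, of "int n + 1" Z B1 B]
          by (simp add: ZB1)
      qed
      then show ?thesis
        using group_hom.inj_iff_trivial_ker hom_induced_hom
        by (metis group_hom.intro group_hom_axioms.intro group_relative_homology_group)
    qed
    show "T \<inter> {e} = {}" using insert.hyps by auto
  next
    fix e' assume e': "e' \<in> T"
    then show "hom_induced (int n) ?D ?S Z B (\<phi> e') (disc_class n) = hom_induced (int n) (subtopology Y B1) B Z B id
        (hom_induced (int n) ?D ?S (subtopology Y B1) B (\<phi> e') (disc_class n))"
    proof -
      have *: "\<phi> e' ` topspace (open_disc n) = e'" "\<phi> e' ` ?S \<subseteq> B" "continuous_map ?D Y (\<phi> e')"
        using homeomorphic_imp_surjective_map insert.prems(1) [of e'] e' by fastforce+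
      have "\<phi> e' x \<in> B1" if "x \<in> disc_set n" for x
        using that by (cases rule: disc_set_cases) (use e' * in \<open>auto simp: B1_def\<close>)
      with * have "continuous_map ?D (subtopology Y B1) (\<phi> e')" "\<phi> e' \<in> ?S \<rightarrow> B"
        by (auto simp: continuous_map_in_subtopology)
      moreover have "continuous_map (subtopology Y B1) Z id"
        using ZB1 by (metis continuous_map_from_subtopology continuous_map_id)
      ultimately show ?thesis
        by (subst hom_induced_compose') auto
    qed
  next
    fix e' assume "e' \<in> {e}"
    then show "hom_induced (int n) Z B Z B1 id (hom_induced (int n) ?D ?S Z B (\<phi> e') (disc_class n)) =
      hom_induced (int n) ?D ?S Z B1 (\<phi> e) (disc_class n)"
      using contZ [of e] e(5) BB1 by (subst hom_induced_compose') auto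
  qed (auto simp: hom_induced_hom hom_induced_carrier)
  moreover have "trivial_group (relative_homology_group m Z B)" if "m \<noteq> int n" for m
    using trivial_by_exactness [OF BB1, of m Z] IH(2) [OF that] t1 [OF that] by (simp add: ZB1)
  moreover have "closedin Y (B1 \<union> e)"
  proof -
    have "closedin Y (\<phi> e ` disc_set n)"
      using image_compactin [OF _ e(3), of "disc_set n"] compact_closed_disc [of n] Y(1)
      by (simp add: compact_space_def compactin_imp_closedin)
    have *: "B1 \<union> e = B1 \<union> \<phi> e ` disc_set n"
      using D_im e_im by (auto simp: topspace_open_disc)
    show ?thesis unfolding * using closedin_Un [OF IH(3) \<open>closedin Y (\<phi> e ` disc_set n)\<close>] .
  qed
  ultimately show ?case
    unfolding Zeq unfolding seteq by simp
qed

section \<open>Cellular homology of finite CW complexes\<close>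

abbreviation skel_space :: "'a cell_complex \<Rightarrow> int \<Rightarrow> 'a topology" where
  "skel_space Y n \<equiv> subtopology (underlying Y) (skeleton Y n)"

abbreviation cell_chain :: "'a cell_complex \<Rightarrow> nat \<Rightarrow> ((nat \<Rightarrow> real) \<Rightarrow> 'a) \<Rightarrow> 'a chain set" where
  "cell_chain Y n \<phi> \<equiv> hom_induced (int n) (closed_disc n) (disc_boundary n)
     (skel_space Y (int n)) (skeleton Y (int n - 1)) \<phi> (disc_class n)"

lemma skeleton_mono: "a \<le> b \<Longrightarrow> skeleton Y a \<subseteq> skeleton Y b"
  unfolding skeleton_def by (intro Union_mono) (auto intro: order_trans)

lemma skeleton_neg: "n < 0 \<Longrightarrow> skeleton Y n = {}"
  by (auto simp: skeleton_def)

lemma skeleton_step: "skeleton Y (int n) = skeleton Y (int n - 1) \<union> \<Union>(cells Y n)"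
proof -
  have "{e. \<exists>k. int k \<le> int n \<and> e \<in> cells Y k} = {e. \<exists>k. int k \<le> int n - 1 \<and> e \<in> cells Y k} \<union> cells Y n"
  proof -
    have "int k \<le> int n \<longleftrightarrow> int k \<le> int n - 1 \<or> k = n" for k by auto
    then show ?thesis by auto
  qed
  then show ?thesis unfolding skeleton_def by (simp only: Union_Un_distrib)
qed

lemma skel_space_subspace:
  "a \<le> b \<Longrightarrow> subtopology (skel_space Y b) (skeleton Y a) = skel_space Y a"
  using skeleton_mono [of a b Y] by (simp add: subtopology_subtopology Int_absorb1)

lemma CW_Hausdorff: "finite_CW Y \<Longrightarrow> Hausdorff_space (underlying Y)"
  by (simp add: finite_CW_def)

lemma CW_cell_subset:
  assumes "finite_CW Y" "e \<in> cells Y k"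
  shows "e \<subseteq> topspace (underlying Y)"
  using assms by (auto simp: finite_CW_def)

lemma CW_disjoint:
  assumes "finite_CW Y" "e \<in> cells Y k" "e' \<in> cells Y l" "(k, e) \<noteq> (l, e')"
  shows "e \<inter> e' = {}"
  using assms unfolding finite_CW_def by blast

lemma CW_finite_cells: "finite_CW Y \<Longrightarrow> finite (cells Y k)"
proof -
  assume "finite_CW Y"
  then have "finite (snd ` {(k, e). e \<in> cells Y k})" by (simp add: finite_CW_def)
  moreover have "cells Y k \<subseteq> snd ` {(k, e). e \<in> cells Y k}" by force
  ultimately show ?thesis by (rule finite_subset [rotated])
qed

lemma CW_finite_dimensions: "finite_CW Y \<Longrightarrow> finite {k. cells Y k \<noteq> {}}"
proof -
  assume "finite_CW Y"
  then have "finite (fst ` {(k, e). e \<in> cells Y k})" by (simp add: finite_CW_def)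
  moreover have "{k. cells Y k \<noteq> {}} \<subseteq> fst ` {(k, e). e \<in> cells Y k}" by force
  ultimately show ?thesis by (rule finite_subset [rotated])
qed

lemma CW_characteristic_map:
  assumes "finite_CW Y" "e \<in> cells Y k"
  obtains \<phi> where "characteristic_map Y k e \<phi>"
proof -
  have "\<exists>\<phi>. characteristic_map Y k e \<phi>"
    using assms by (simp add: finite_CW_def)
  then show ?thesis using that by blast
qed

lemma characteristic_map_open_image:
  assumes "finite_CW Y" "e \<in> cells Y k" "characteristic_map Y k e \<phi>"
  shows "\<phi> ` topspace (open_disc k) = e"
  using homeomorphic_imp_surjective_map [of "open_disc k" "subtopology (underlying Y) e" \<phi>] assms
    CW_cell_subset [OF assms(1,2)]
  by (auto simp: characteristic_map_def)

lemma CW_cell_nonempty: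
  assumes "finite_CW Y" "e \<in> cells Y k"
  shows "e \<noteq> {}"
proof -
  obtain \<phi> where "characteristic_map Y k e \<phi>" using CW_characteristic_map [OF assms] .
  from characteristic_map_open_image [OF assms this] show ?thesis
    using zero_in_open_disc by blast
qed

lemma characteristic_map_closed_image:
  assumes "finite_CW Y" "e \<in> cells Y k" "characteristic_map Y k e \<phi>"
  shows "e \<subseteq> \<phi> ` disc_set k" "\<phi> ` disc_set k \<subseteq> skeleton Y (int k)"
proof -
  note im = characteristic_map_open_image [OF assms]
  show "e \<subseteq> \<phi> ` disc_set k"
    unfolding im [symmetric] by (auto simp: topspace_open_disc)
  have "\<phi> ` disc_boundary k \<subseteq> skeleton Y (int k - 1)"
    using assms by (simp add: characteristic_map_def)
  then show "\<phi> ` disc_set k \<subseteq> skeleton Y (int k)"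
    unfolding skeleton_step using im assms(2) disc_set_cases [of _ k] by blast
qed

lemma CW_compact_skeleton:
  assumes "finite_CW Y"
  shows "compactin (underlying Y) (skeleton Y n)"
proof -
  define I where "I = {(k, e). e \<in> cells Y k \<and> int k \<le> n}"
  have "finite I"
    using assms by (auto simp: I_def finite_CW_def intro: finite_subset [rotated])
  have "\<forall>i \<in> I. \<exists>\<phi>. characteristic_map Y (fst i) (snd i) \<phi>"
    using assms by (auto simp: I_def finite_CW_def)
  then obtain \<phi> where \<phi>: "\<And>i. i \<in> I \<Longrightarrow> characteristic_map Y (fst i) (snd i) (\<phi> i)"
    by metis
  have "compactin (underlying Y) (\<phi> i ` disc_set (fst i))" if "i \<in> I" for i
    using image_compactin [of "closed_disc (fst i)" "disc_set (fst i)" "underlying Y" "\<phi> i"]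
      compact_closed_disc [of "fst i"] \<phi> [OF that]
    by (simp add: compact_space_def characteristic_map_def)
  then have "compactin (underlying Y) (\<Union>i\<in>I. \<phi> i ` disc_set (fst i))"
    using \<open>finite I\<close> by (intro compactin_Union) auto
  moreover have "(\<Union>i\<in>I. \<phi> i ` disc_set (fst i)) = skeleton Y n"
  proof
    show "(\<Union>i\<in>I. \<phi> i ` disc_set (fst i)) \<subseteq> skeleton Y n"
    proof (rule UN_least)
      fix i assume i: "i \<in> I"
      then have "snd i \<in> cells Y (fst i)" by (auto simp: I_def)
      then have "\<phi> i ` disc_set (fst i) \<subseteq> skeleton Y (int (fst i))"
        by (rule characteristic_map_closed_image(2) [OF assms _ \<phi> [OF i]])
      also have "\<dots> \<subseteq> skeleton Y n" using i by (intro skeleton_mono) (auto simp: I_def)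
      finally show "\<phi> i ` disc_set (fst i) \<subseteq> skeleton Y n" .
    qed
    show "skeleton Y n \<subseteq> (\<Union>i\<in>I. \<phi> i ` disc_set (fst i))"
    proof
      fix x assume "x \<in> skeleton Y n"
      then obtain k e where ke: "x \<in> e" "e \<in> cells Y k" "int k \<le> n" by (auto simp: skeleton_def)
      then have i: "(k, e) \<in> I" by (simp add: I_def)
      have "e \<subseteq> \<phi> (k, e) ` disc_set k"
        using characteristic_map_closed_image(1) [OF assms ke(2)] \<phi> [OF i] by simp
      then show "x \<in> (\<Union>i\<in>I. \<phi> i ` disc_set (fst i))" using i ke(1) by force
    qed
  qed
  ultimately show ?thesis by simp
qed

lemma CW_closed_skeleton: "finite_CW Y \<Longrightarrow> closedin (underlying Y) (skeleton Y n)"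
  by (simp add: CW_compact_skeleton CW_Hausdorff compactin_imp_closedin)

lemma CW_skeleton_subset: "finite_CW Y \<Longrightarrow> skeleton Y n \<subseteq> topspace (underlying Y)"
  by (simp add: CW_closed_skeleton closedin_subset)

lemma CW_top_skeleton:
  assumes "finite_CW Y"
  obtains N :: nat where "\<And>m. m \<ge> int N \<Longrightarrow> skeleton Y m = topspace (underlying Y)"
proof -
  obtain N where N: "\<And>k. cells Y k \<noteq> {} \<Longrightarrow> k \<le> N"
    using CW_finite_dimensions [OF assms] by (metis (mono_tags) finite_nat_set_iff_bounded_le mem_Collect_eq)
  have "topspace (underlying Y) \<subseteq> skeleton Y m" if "m \<ge> int N" for m
  proof
    fix x assume "x \<in> topspace (underlying Y)"
    moreover have "(\<Union>k. \<Union>(cells Y k)) = topspace (underlying Y)"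
      using assms by (simp only: finite_CW_def)
    ultimately obtain k e where "x \<in> e" "e \<in> cells Y k" by blast
    moreover from this have "int k \<le> m" using N [of k] that by force
    ultimately show "x \<in> skeleton Y m" by (auto simp: skeleton_def)
  qed
  then show ?thesis
    using that CW_skeleton_subset [OF assms] by blast
qed

text \<open>The \<open>n\<close>-skeleton arises from the \<open>(n - 1)\<close>-skeleton by attaching the \<open>n\<close>-cells.\<close>

theorem cellular_basis:
  assumes Y: "finite_CW Y" and \<phi>: "\<And>e. e \<in> cells Y n \<Longrightarrow> characteristic_map Y n e (\<phi> e)"
  shows "is_basis (relative_homology_group (int n) (skel_space Y (int n)) (skeleton Y (int n - 1))) (cells Y n)
      (\<lambda>e. cell_chain Y n (\<phi> e))"
    and "m \<noteq> int n \<Longrightarrow> trivial_group (relative_homology_group m (skel_space Y (int n)) (skeleton Y (int n - 1)))"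
proof -
  have cell: "e \<subseteq> topspace (underlying Y) \<and> e \<inter> skeleton Y (int n - 1) = {} \<and> continuous_map (closed_disc n) (underlying Y) (\<phi> e) \<and>
      homeomorphic_map (open_disc n) (subtopology (underlying Y) e) (\<phi> e) \<and> \<phi> e ` disc_boundary n \<subseteq> skeleton Y (int n - 1)"
    if e: "e \<in> cells Y n" for e
  proof -
    have "e \<inter> e' = {}" if "e' \<in> cells Y k" "int k \<le> int n - 1" for k e'
      using CW_disjoint [OF Y e that(1)] that(2) by auto
    then have "e \<inter> skeleton Y (int n - 1) = {}"
      unfolding skeleton_def by blast
    then show ?thesis
      using \<phi> [OF e] CW_cell_subset [OF Y e] by (simp add: characteristic_map_def)
  qed
  have "pairwise disjnt (cells Y n)"
    using CW_disjoint [OF Y] unfolding pairwise_def disjnt_def by blast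
  note basis = attached_cells_basis [OF CW_Hausdorff [OF Y] CW_closed_skeleton [OF Y] CW_finite_cells [OF Y] cell this]
  from basis show "is_basis (relative_homology_group (int n) (skel_space Y (int n)) (skeleton Y (int n - 1))) (cells Y n)
      (\<lambda>e. cell_chain Y n (\<phi> e))"
    unfolding skeleton_step by simp
  from basis show "trivial_group (relative_homology_group m (skel_space Y (int n)) (skeleton Y (int n - 1)))"
    if "m \<noteq> int n"
    unfolding skeleton_step using that by simp
qed

lemma cellular_trivial:
  assumes Y: "finite_CW Y" and m: "m \<noteq> k"
  shows "trivial_group (relative_homology_group m (skel_space Y k) (skeleton Y (k - 1)))"
proof (cases "k < 0")
  case True
  then show ?thesis by (simp add: trivial_relative_homology_group_empty skeleton_neg)
next
  case False
  then obtain n where k: "k = int n" by (metis int_nat_eq not_le)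
  have "\<forall>e \<in> cells Y n. \<exists>\<phi>. characteristic_map Y n e \<phi>"
    using Y by (simp add: finite_CW_def)
  then obtain \<phi> where "\<And>e. e \<in> cells Y n \<Longrightarrow> characteristic_map Y n e (\<phi> e)" by metis
  from cellular_basis(2) [OF Y this] m show ?thesis unfolding k by blast
qed

lemma skeleton_homology_trivial:
  assumes Y: "finite_CW Y" and m: "m > k"
  shows "trivial_group (homology_group m (skel_space Y k))"
proof -
  have "m > int j - 1 \<longrightarrow> trivial_group (homology_group m (skel_space Y (int j - 1)))" for j
  proof (induction j)
    case 0
    then show ?case by (simp add: trivial_relative_homology_group_empty skeleton_neg)
  next
    case (Suc j)
    show ?case
    proof
      assume m: "m > int (Suc j) - 1"
      have "trivial_group (relative_homology_group m (skel_space Y (int j)) (skeleton Y (int j - 1)))"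
        using m by (intro cellular_trivial [OF Y]) simp
      moreover have "trivial_group (homology_group m (subtopology (skel_space Y (int j)) (skeleton Y (int j - 1))))"
        unfolding skel_space_subspace [of "int j - 1" "int j", simplified] using Suc.IH m by simp
      ultimately show "trivial_group (homology_group m (skel_space Y (int (Suc j) - 1)))"
        using trivial_by_exactness [of "{}" "skeleton Y (int j - 1)" m "skel_space Y (int j)"] by simp
    qed
  qed
  from this [of "nat (k + 1)"] m show ?thesis
    by (cases "k < 0") (auto simp: trivial_relative_homology_group_empty skeleton_neg)
qed

lemma skeleton_homology_step:
  assumes Y: "finite_CW Y" and m: "m < k"
  shows "homology_group m (skel_space Y k) \<cong> homology_group m (skel_space Y (k + 1))"
proof -
  let ?X = "skel_space Y (k + 1)"
  have sub: "subtopology ?X (skeleton Y k) = skel_space Y k"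
    by (rule skel_space_subspace) simp
  have t: "trivial_group (relative_homology_group i ?X (skeleton Y k))" if "i \<le> k" for i
    using cellular_trivial [OF Y, of i "k + 1"] that by simp
  note ex = triple_kernels(3) [of "{}" "skeleton Y k" "m + 1" ?X, simplified sub, simplified]
  have "hom_induced m (skel_space Y k) {} ?X {} id \<in> iso (homology_group m (skel_space Y k)) (homology_group m ?X)"
  proof (rule iso_from_kernel)
    show "carrier (homology_group m ?X) \<subseteq> hom_induced m (skel_space Y k) {} ?X {} id ` carrier (homology_group m (skel_space Y k))"
      using surj_by_exactness [of "{}" "skeleton Y k" m ?X] t [of m] m by (simp add: sub)
    fix x assume "x \<in> carrier (homology_group m (skel_space Y k))" "hom_induced m (skel_space Y k) {} ?X {} id x = \<one>\<^bsub>homology_group m ?X\<^esub>"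
    then have "x \<in> hom_relboundary (m + 1) ?X (skeleton Y k) {} ` carrier (relative_homology_group (m + 1) ?X (skeleton Y k))"
      unfolding ex [symmetric] by (simp add: kernel_def)
    then obtain y where y: "x = hom_relboundary (m + 1) ?X (skeleton Y k) {} y" "y \<in> carrier (relative_homology_group (m + 1) ?X (skeleton Y k))"
      by (rule imageE)
    then have "y = \<one>\<^bsub>relative_homology_group (m + 1) ?X (skeleton Y k)\<^esub>"
      using t [of "m + 1"] m by (simp add: trivial_group_def)
    then show "x = \<one>\<^bsub>homology_group m (skel_space Y k)\<^esub>"
      unfolding y(1)
      using hom_one [OF group_homomorphism_hom_relboundary group_relative_homology_group group_relative_homology_group,
          of "m + 1" ?X "skeleton Y k" "{}"]
      by (simp only: sub add_diff_cancel_right')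
  qed (auto simp: hom_induced_hom)
  then show ?thesis by (auto simp: is_iso_def)
qed

lemma skeleton_homology_iso:
  assumes Y: "finite_CW Y"
  shows "homology_group m (skel_space Y (m + 1)) \<cong> homology_group m (underlying Y)"
proof -
  have *: "homology_group m (skel_space Y (m + 1)) \<cong> homology_group m (skel_space Y (m + 1 + int j))" for j
  proof (induction j)
    case (Suc j)
    have "homology_group m (skel_space Y (m + 1 + int j)) \<cong> homology_group m (skel_space Y (m + 1 + int (Suc j)))"
      using skeleton_homology_step [OF Y, of m "m + 1 + int j"] by (simp add: ac_simps)
    with Suc.IH show ?case by (rule iso_trans)
  qed (simp add: iso_refl)
  obtain N where N: "\<And>i. i \<ge> int N \<Longrightarrow> skeleton Y i = topspace (underlying Y)"
    using CW_top_skeleton [OF Y] by blast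
  have "m + 1 + int (nat (int N - m)) \<ge> int N" by simp
  from N [OF this] show ?thesis
    using * [of "nat (int N - m)"] by simp
qed

lemma cellular_chains_simps:
  "chains (cellular_chains Y) n = relative_homology_group n (skel_space Y n) (skeleton Y (n - 1))"
  "boundary (cellular_chains Y) n = hom_relboundary n (skel_space Y n) (skeleton Y (n - 1)) (skeleton Y (n - 2))"
  by (simp_all add: cellular_chains_def)

lemma cellular_boundary_hom:
  "boundary (cellular_chains Y) n \<in> hom (chains (cellular_chains Y) n) (chains (cellular_chains Y) (n - 1))"
  unfolding cellular_chains_simps
  using group_homomorphism_hom_relboundary [of n "skel_space Y n" "skeleton Y (n - 1)" "skeleton Y (n - 2)"]
  by (simp add: skel_space_subspace)

text \<open>The absolute homology of the \<open>n\<close>-skeleton embeds into the \<open>n\<close>-chains as the group of cycles,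
  and the boundaries of cells correspond to the classes that die in the \<open>(n + 1)\<close>-skeleton.\<close>

lemma cellular_cycles:
  fixes Y :: "'a cell_complex" and n :: int
  assumes Y: "finite_CW Y"
  defines "j \<equiv> hom_induced n (skel_space Y n) {} (skel_space Y n) (skeleton Y (n - 1)) id"
  shows "kernel (chains (cellular_chains Y) n) (chains (cellular_chains Y) (n - 1)) (boundary (cellular_chains Y) n) =
      j ` carrier (homology_group n (skel_space Y n))"
    and "inj_on j (carrier (homology_group n (skel_space Y n)))"
    and "x \<in> carrier (chains (cellular_chains Y) (n + 1)) \<Longrightarrow> boundary (cellular_chains Y) (n + 1) x =
      j (hom_boundary (n + 1) (skel_space Y (n + 1)) (skeleton Y n) x)"
proof -
  let ?X = "skel_space Y n" and ?S = "skeleton Y (n - 1)"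
  have sub: "subtopology ?X ?S = skel_space Y (n - 1)"
    by (rule skel_space_subspace) simp
  interpret j: group_hom "homology_group n ?X" "relative_homology_group n ?X ?S" j
    unfolding j_def by (simp add: group_hom_def group_hom_axioms_def hom_induced_hom)
  show inj: "inj_on j (carrier (homology_group n ?X))"
    unfolding j.inj_on_one_iff
    using inj_by_exactness [of "{}" ?S n ?X] skeleton_homology_trivial [OF Y, of "n - 1" n]
    unfolding sub j_def by simp
  have "hom_relboundary n ?X ?S (skeleton Y (n - 2)) x = \<one>\<^bsub>chains (cellular_chains Y) (n - 1)\<^esub> \<longleftrightarrow>
      hom_relboundary n ?X ?S {} x = \<one>\<^bsub>homology_group (n - 1) (skel_space Y (n - 1))\<^esub>" for x
  proof -
    have sub2: "subtopology (skel_space Y (n - 1)) (skeleton Y (n - 2)) = skel_space Y (n - 2)"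
      by (rule skel_space_subspace) simp
    have eq: "hom_relboundary n ?X ?S (skeleton Y (n - 2)) x =
       hom_induced (n - 1) (skel_space Y (n - 1)) {} (skel_space Y (n - 1)) (skeleton Y (n - 2)) id (hom_relboundary n ?X ?S {} x)"
      unfolding hom_relboundary_empty by (simp add: hom_relboundary_def sub)
    have c: "hom_relboundary n ?X ?S {} x \<in> carrier (homology_group (n - 1) (skel_space Y (n - 1)))"
      using hom_relboundary [of n ?X ?S "{}" x] by (simp add: sub)
    have ch: "chains (cellular_chains Y) (n - 1) = relative_homology_group (n - 1) (skel_space Y (n - 1)) (skeleton Y (n - 2))"
      by (simp add: cellular_chains_simps)
    show ?thesis
      unfolding eq ch
      using inj_by_exactness [of "{}" "skeleton Y (n - 2)" "n - 1" "skel_space Y (n - 1)", OF _ _ c]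
        skeleton_homology_trivial [OF Y, of "n - 2" "n - 1"]
      unfolding sub2 by (auto simp only: hom_induced_one empty_subsetI)
  qed
  then have "kernel (chains (cellular_chains Y) n) (chains (cellular_chains Y) (n - 1)) (boundary (cellular_chains Y) n) =
     kernel (relative_homology_group n ?X ?S) (relative_homology_group (n - 1) (subtopology ?X ?S) {}) (hom_relboundary n ?X ?S {})"
    unfolding kernel_def cellular_chains_simps(1) [of Y n] cellular_chains_simps(2) sub by blast
  then show "kernel (chains (cellular_chains Y) n) (chains (cellular_chains Y) (n - 1)) (boundary (cellular_chains Y) n) =
      j ` carrier (homology_group n (skel_space Y n))"
    unfolding j_def using triple_kernels(2) [of "{}" ?S n ?X] by simp
  show "boundary (cellular_chains Y) (n + 1) x = j (hom_boundary (n + 1) (skel_space Y (n + 1)) (skeleton Y n) x)"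
    if "x \<in> carrier (chains (cellular_chains Y) (n + 1))"
    unfolding cellular_chains_simps(2) j_def by (simp add: hom_relboundary_def skel_space_subspace)
qed

lemma cellular_boundary_boundary:
  assumes Y: "finite_CW Y" and x: "x \<in> carrier (chains (cellular_chains Y) n)"
  shows "boundary (cellular_chains Y) (n - 1) (boundary (cellular_chains Y) n x) = \<one>\<^bsub>chains (cellular_chains Y) (n - 2)\<^esub>"
proof -
  have "hom_boundary n (skel_space Y n) (skeleton Y (n - 1)) x \<in> carrier (homology_group (n - 1) (skel_space Y (n - 1)))"
    using hom_boundary_carrier [of n "skel_space Y n" "skeleton Y (n - 1)" x] by (simp add: skel_space_subspace)
  then have "boundary (cellular_chains Y) n x \<in>
      kernel (chains (cellular_chains Y) (n - 1)) (chains (cellular_chains Y) (n - 1 - 1)) (boundary (cellular_chains Y) (n - 1))"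
    using cellular_cycles(1) [OF Y, of "n - 1"] cellular_cycles(3) [OF Y, of x "n - 1"] x by simp
  then show ?thesis by (simp add: kernel_def)
qed

text \<open>The homology of the \<open>(n + 1)\<close>-skeleton, which in degree \<open>n\<close> is that of the whole complex, is the quotient of the
  homology of the \<open>n\<close>-skeleton by the boundaries of the \<open>(n + 1)\<close>-cells. The embedding of
  \<open>cellular_cycles\<close> identifies this with cycles modulo boundaries.\<close>

theorem cellular_homology:
  assumes Y: "finite_CW Y"
  shows "homology_group n (underlying Y) \<cong> chain_homology (cellular_chains Y) n"
proof -
  let ?X = "skel_space Y n" and ?X1 = "skel_space Y (n + 1)" and ?C = "cellular_chains Y"
  let ?H = "homology_group n ?X"
  define j where "j = hom_induced n ?X {} ?X (skeleton Y (n - 1)) id"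
  define d where "d = hom_boundary (n + 1) ?X1 (skeleton Y n)"
  note cyc = cellular_cycles [OF Y, where n = n, folded j_def d_def]
  define Z where "Z = kernel (chains ?C n) (chains ?C (n - 1)) (boundary ?C n)"
  define B where "B = boundary ?C (n + 1) ` carrier (chains ?C (n + 1))"
  have grp: "group (chains ?C k)" "comm_group (chains ?C k)" for k
    by (simp_all add: cellular_chains_simps)
  have Z: "subgroup Z (chains ?C n)"
    unfolding Z_def by (rule subgroup_kernel [OF grp(1) grp(1) cellular_boundary_hom])
  define G where "G = subgroup_generated (chains ?C n) Z"
  have cG: "carrier G = Z"
    unfolding G_def using Z grp(1) by (simp add: subgroup.carrier_subgroup_generated_subgroup)
  have G: "comm_group G"
    unfolding G_def by (simp add: group.abelian_subgroup_generated grp)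
  have sub1: "subtopology ?X1 (skeleton Y n) = ?X"
    by (rule skel_space_subspace) simp
  have dcar: "d x \<in> carrier ?H" for x
    using hom_boundary_carrier [of "n + 1" ?X1 "skeleton Y n" x] by (simp add: d_def sub1)
  have B_eq: "B = j ` d ` carrier (chains ?C (n + 1))"
    unfolding B_def image_image using cyc(3) by (intro image_cong) auto
  have BZ: "B \<subseteq> Z"
    unfolding B_eq Z_def cyc(1) using dcar by blast
  have B: "subgroup B G"
  proof -
    have "group_hom (chains ?C (n + 1)) (chains ?C n) (boundary ?C (n + 1))"
      using cellular_boundary_hom [of Y "n + 1"] grp by (simp add: group_hom_def group_hom_axioms_def)
    then have "subgroup B (chains ?C n)"
      unfolding B_def by (rule group_hom.img_is_subgroup)
    then show ?thesis
      unfolding G_def using BZ grp(1) by (simp add: group.subgroup_of_subgroup_generated)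
  qed
  have jhom: "j \<in> hom ?H G"
  proof -
    have "j \<in> hom ?H (chains ?C n)"
      unfolding j_def cellular_chains_simps by (rule hom_induced_hom)
    moreover have "j ` carrier ?H \<subseteq> Z" using cyc(1) by (simp add: Z_def)
    ultimately show ?thesis
      using cG unfolding hom_def G_def by auto
  qed
  note q = hom_to_quotient [OF G B]
  let ?i = "hom_induced n ?X {} ?X1 {} id"
  have "homology_group n ?X1 \<cong> G Mod B"
  proof (rule quotient_iso_same_kernel [OF group_relative_homology_group group_relative_homology_group q(1)])
    show "?i \<in> hom ?H (homology_group n ?X1)" by (rule hom_induced_hom)
    show "?i ` carrier ?H = carrier (homology_group n ?X1)"
      using surj_by_exactness [of "{}" "skeleton Y n" n ?X1] cellular_trivial [OF Y, of n "n + 1"] by (simp add: sub1)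
    show "(\<lambda>x. B #>\<^bsub>G\<^esub> x) \<circ> j \<in> hom ?H (G Mod B)"
      using jhom q(2) by (rule hom_compose)
    show "((\<lambda>x. B #>\<^bsub>G\<^esub> x) \<circ> j) ` carrier ?H = carrier (G Mod B)"
      using q(3) unfolding cG Z_def cyc(1) image_comp .
    have "kernel ?H (homology_group n ?X1) ?i = d ` carrier (chains ?C (n + 1))"
      using triple_kernels(3) [of "{}" "skeleton Y n" "n + 1" ?X1] unfolding hom_relboundary_empty
      by (simp add: sub1 d_def cellular_chains_simps)
    moreover have kerq: "x \<in> kernel ?H (G Mod B) ((\<lambda>x. B #>\<^bsub>G\<^esub> x) \<circ> j) \<longleftrightarrow> x \<in> d ` carrier (chains ?C (n + 1))" for x
    proof (cases "x \<in> carrier ?H")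
      case True
      then have "j x \<in> carrier G" using jhom by (auto simp: hom_def)
      then have "x \<in> kernel ?H (G Mod B) ((\<lambda>x. B #>\<^bsub>G\<^esub> x) \<circ> j) \<longleftrightarrow> j x \<in> B"
        using True q(4) by (simp add: kernel_def)
      also have "\<dots> \<longleftrightarrow> x \<in> d ` carrier (chains ?C (n + 1))"
      proof
        assume "j x \<in> B"
        then obtain y where y: "y \<in> carrier (chains ?C (n + 1))" "j x = j (d y)"
          unfolding B_eq by blast
        then have "x = d y" using inj_onD [OF cyc(2) y(2) True dcar] by simp
        then show "x \<in> d ` carrier (chains ?C (n + 1))" using y(1) by blast
      qed (auto simp: B_eq)
      finally show ?thesis .
    next
      case False
      then show ?thesis using dcar by (auto simp: kernel_def)
    qed
    ultimately show "kernel ?H (homology_group n ?X1) ?i = kernel ?H (G Mod B) ((\<lambda>x. B #>\<^bsub>G\<^esub> x) \<circ> j)"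
      using Set.set_eqI [OF kerq] by (simp only:)
  qed
  moreover have "G Mod B = chain_homology ?C n"
    unfolding chain_homology_def G_def Z_def B_def by (rule refl)
  moreover have "homology_group n (underlying Y) \<cong> homology_group n ?X1"
    using skeleton_homology_iso [OF Y, of n] by (simp add: group.iso_sym)
  ultimately show ?thesis using iso_trans by metis
qed

section \<open>The cell structure of the double mapping cylinder\<close>

text \<open>A map from the compact disc to a Hausdorff space is closed. As no boundary point is mapped
  into \<open>e\<close>, the open disc is the whole preimage of \<open>e\<close>, and the restriction to it is closed as well.\<close>

lemma homeomorphic_map_open_disc:
  assumes Y: "Hausdorff_space Y" and \<phi>: "continuous_map (closed_disc n) Y \<phi>"
    and inj: "inj_on \<phi> (topspace (open_disc n))" and im: "\<phi> ` topspace (open_disc n) = e"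
    and bd: "\<phi> ` disc_boundary n \<inter> e = {}"
  shows "homeomorphic_map (open_disc n) (subtopology Y e) \<phi>"
proof (rule bijective_closed_imp_homeomorphic_map)
  have sub: "topspace (open_disc n) \<subseteq> disc_set n" by (auto simp: topspace_open_disc)
  have pre: "{x \<in> topspace (closed_disc n). \<phi> x \<in> e} = topspace (open_disc n)"
  proof
    show "{x \<in> topspace (closed_disc n). \<phi> x \<in> e} \<subseteq> topspace (open_disc n)"
    proof
      fix x assume "x \<in> {x \<in> topspace (closed_disc n). \<phi> x \<in> e}"
      then have x: "x \<in> disc_set n" "\<phi> x \<in> e" by auto
      from x(1) show "x \<in> topspace (open_disc n)"
        by (cases rule: disc_set_cases) (use x(2) bd in auto)
    qed
    show "topspace (open_disc n) \<subseteq> {x \<in> topspace (closed_disc n). \<phi> x \<in> e}"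
      using sub im by auto
  qed
  have "closed_map (closed_disc n) Y \<phi>"
    by (intro continuous_imp_closed_map compact_closed_disc Y \<phi>)
  from closed_map_restriction [OF this pre]
  show "closed_map (open_disc n) (subtopology Y e) \<phi>"
    by (simp add: open_disc_subtopology [symmetric])
  have "continuous_map (subtopology (closed_disc n) (topspace (open_disc n))) (subtopology Y e) \<phi>"
    using \<phi> im sub by (auto simp: continuous_map_in_subtopology continuous_map_from_subtopology)
  then show "continuous_map (open_disc n) (subtopology Y e) \<phi>"
    by (simp add: open_disc_subtopology [symmetric])
  have "e \<subseteq> topspace Y"
    using im sub \<phi> by (auto simp: continuous_map_def)
  then show "\<phi> ` topspace (open_disc n) = topspace (subtopology Y e)"
    using im by auto
qed (rule inj)

definition disc_to_cylinder :: "nat \<Rightarrow> (nat \<Rightarrow> real) \<Rightarrow> (nat \<Rightarrow> real) \<times> real" where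
  "disc_to_cylinder n = inv_into (disc_set n \<times> {0..1}) (cylinder_to_disc n)"

lemma disc_to_cylinder:
  shows "z \<in> disc_set n \<times> {0..1} \<Longrightarrow> disc_to_cylinder n (cylinder_to_disc n z) = z"
    and "y \<in> disc_set (Suc n) \<Longrightarrow> disc_to_cylinder n y \<in> disc_set n \<times> {0..1}"
    and "y \<in> disc_set (Suc n) \<Longrightarrow> cylinder_to_disc n (disc_to_cylinder n y) = y"
    and "continuous_map (closed_disc (Suc n)) (cylinder (closed_disc n)) (disc_to_cylinder n)"
    and "y \<in> disc_set (Suc n) \<Longrightarrow> y \<in> disc_boundary (Suc n) \<longleftrightarrow>
      disc_to_cylinder n y \<in> cylinder_boundary (closed_disc n) (disc_boundary n)"
proof -
  have top: "topspace (cylinder (closed_disc n)) = disc_set n \<times> {0..1}" by simp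
  have inj: "inj_on (cylinder_to_disc n) (disc_set n \<times> {0..1})"
    using homeomorphic_imp_injective_map [OF cylinder_to_disc(1)] by simp
  have im: "cylinder_to_disc n ` (disc_set n \<times> {0..1}) = disc_set (Suc n)"
    using homeomorphic_imp_surjective_map [OF cylinder_to_disc(1)] by simp
  show 1: "disc_to_cylinder n (cylinder_to_disc n z) = z" if "z \<in> disc_set n \<times> {0..1}" for z
    unfolding disc_to_cylinder_def using inj that by (rule inv_into_f_f)
  show 2: "disc_to_cylinder n y \<in> disc_set n \<times> {0..1}" if "y \<in> disc_set (Suc n)" for y
    using that unfolding disc_to_cylinder_def im [symmetric] by (rule inv_into_into)
  show 3: "cylinder_to_disc n (disc_to_cylinder n y) = y" if "y \<in> disc_set (Suc n)" for y
    using that unfolding disc_to_cylinder_def im [symmetric] by (rule f_inv_into_f)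
  obtain g where g: "homeomorphic_maps (cylinder (closed_disc n)) (closed_disc (Suc n)) (cylinder_to_disc n) g"
    using cylinder_to_disc(1) homeomorphic_map_maps by blast
  have "g y = disc_to_cylinder n y" if "y \<in> topspace (closed_disc (Suc n))" for y
  proof -
    have y: "y \<in> disc_set (Suc n)" using that by simp
    have "\<forall>x \<in> topspace (cylinder (closed_disc n)). g (cylinder_to_disc n x) = x"
      using g unfolding homeomorphic_maps_def by (elim conjE)
    then have "g (cylinder_to_disc n (disc_to_cylinder n y)) = disc_to_cylinder n y"
      using 2 [OF y, folded top] by (rule bspec)
    then show ?thesis by (simp only: 3 [OF y])
  qed
  moreover have "continuous_map (closed_disc (Suc n)) (cylinder (closed_disc n)) g"
    using g by (simp add: homeomorphic_maps_def)
  ultimately show "continuous_map (closed_disc (Suc n)) (cylinder (closed_disc n)) (disc_to_cylinder n)"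
    by (rule continuous_map_eq [rotated])
  show "y \<in> disc_boundary (Suc n) \<longleftrightarrow>
      disc_to_cylinder n y \<in> cylinder_boundary (closed_disc n) (disc_boundary n)" if y: "y \<in> disc_set (Suc n)" for y
  proof
    assume "y \<in> disc_boundary (Suc n)"
    then obtain z where z: "y = cylinder_to_disc n z" "z \<in> cylinder_boundary (closed_disc n) (disc_boundary n)"
      unfolding cylinder_to_disc(2) [symmetric] by blast
    then have "z \<in> disc_set n \<times> {0..1}" by (auto simp: cylinder_boundary_def)
    then show "disc_to_cylinder n y \<in> cylinder_boundary (closed_disc n) (disc_boundary n)"
      using z 1 by simp
  next
    assume "disc_to_cylinder n y \<in> cylinder_boundary (closed_disc n) (disc_boundary n)"
    then have "cylinder_to_disc n (disc_to_cylinder n y) \<in> disc_boundary (Suc n)"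
      unfolding cylinder_to_disc(2) [symmetric] by (rule imageI)
    then show "y \<in> disc_boundary (Suc n)" by (simp only: 3 [OF y])
  qed
qed

text \<open>\<open>M\<close> and \<open>N\<close> are the bases \<open>B\<^sub>-\<close> and \<open>B\<^sub>+\<close>, and \<open>p\<close> and \<open>r\<close> the maps \<open>p\<^sub>-\<close> and \<open>p\<^sub>+\<close>. The quotient map is
  \<open>pt\<close>; its restrictions to the two bases and to the cylinder over \<open>P\<close> are \<open>inm\<close>, \<open>inp\<close> and \<open>inc\<close>.\<close>

locale double_mapping_cylinder =
  fixes P :: "'a cell_complex" and M :: "'b cell_complex" and N :: "'c cell_complex"
    and p :: "'a \<Rightarrow> 'b" and r :: "'a \<Rightarrow> 'c"
  assumes P: "finite_CW P" and M: "finite_CW M" and N: "finite_CW N"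
    and p: "cellular_map P M p" and r: "cellular_map P N r"
begin

abbreviation "glue \<equiv> dmc_glue (underlying P) p r"
abbreviation "summands \<equiv> dmc_summands (underlying P) (underlying M) (underlying N)"
abbreviation "D \<equiv> DMC P M N p r"
abbreviation "DX \<equiv> underlying D"

definition pt :: "'b + ('a \<times> real) + 'c \<Rightarrow> ('b + ('a \<times> real) + 'c) set" where
  "pt z = glue `` {z}"

definition inm :: "'b \<Rightarrow> ('b + ('a \<times> real) + 'c) set" where "inm b = pt (Inl b)"
definition inp :: "'c \<Rightarrow> ('b + ('a \<times> real) + 'c) set" where "inp c = pt (Inr (Inr c))"
definition inc :: "'a \<times> real \<Rightarrow> ('b + ('a \<times> real) + 'c) set" where "inc z = pt (Inr (Inl z))"

text \<open>The normal form of a point, in which the ends of the cylinder are replaced by their images in the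
  bases. It makes the generated equivalence relation explicit.\<close>

fun nf :: "'b + ('a \<times> real) + 'c \<Rightarrow> 'b + ('a \<times> real) + 'c" where
  "nf (Inl b) = Inl b"
| "nf (Inr (Inl (x, t))) =
    (if x \<in> topspace (underlying P) \<and> t = 0 then Inl (p x)
     else if x \<in> topspace (underlying P) \<and> t = 1 then Inr (Inr (r x)) else Inr (Inl (x, t)))"
| "nf (Inr (Inr c)) = Inr (Inr c)"

lemma glue_iff: "(z, z') \<in> glue \<longleftrightarrow> nf z = nf z'"
proof
  assume "(z, z') \<in> glue"
  then show "nf z = nf z'"
    unfolding dmc_glue_def Let_def by (induction rule: rtrancl_induct) auto
next
  let ?G = "(\<lambda>x. (Inr (Inl (x, 0)), Inl (p x))) ` topspace (underlying P) \<union>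
     (\<lambda>x. (Inr (Inl (x, 1)), Inr (Inr (r x)))) ` topspace (underlying P)
     :: (('b + ('a \<times> real) + 'c) \<times> ('b + ('a \<times> real) + 'c)) set"
  have nf: "w = nf w \<or> (w, nf w) \<in> ?G" for w
    by (cases w rule: nf.cases) auto
  then have "(w, nf w) \<in> (?G \<union> ?G\<inverse>)\<^sup>*" "(nf w, w) \<in> (?G \<union> ?G\<inverse>)\<^sup>*" for w
    by (metis (no_types, lifting) UnI1 UnI2 converseI r_into_rtrancl rtrancl.rtrancl_refl)+
  moreover assume "nf z = nf z'"
  ultimately show "(z, z') \<in> glue"
    unfolding dmc_glue_def Let_def by (metis (no_types, lifting) rtrancl_trans)
qed

lemma pt_eq_iff: "pt z = pt z' \<longleftrightarrow> nf z = nf z'"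
proof -
  have "pt w = {v. nf w = nf v}" for w by (auto simp: pt_def glue_iff)
  then show ?thesis by auto
qed

lemma inm_eq_iff [simp]: "inm b = inm b' \<longleftrightarrow> b = b'"
  and inp_eq_iff [simp]: "inp c = inp c' \<longleftrightarrow> c = c'"
  and inm_neq_inp [simp]: "inm b \<noteq> inp c" "inp c \<noteq> inm b"
  and inc_eq_iff: "\<lbrakk>t \<in> {0<..<1}; t' \<in> {0<..<1}\<rbrakk> \<Longrightarrow> inc (x, t) = inc (x', t') \<longleftrightarrow> x = x' \<and> t = t'"
  and inc_neq: "t \<in> {0<..<1} \<Longrightarrow> inc (x, t) \<noteq> inm b" "t \<in> {0<..<1} \<Longrightarrow> inc (x, t) \<noteq> inp c"
  and inc_0: "x \<in> topspace (underlying P) \<Longrightarrow> inc (x, 0) = inm (p x)"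
  and inc_1: "x \<in> topspace (underlying P) \<Longrightarrow> inc (x, 1) = inp (r x)"
  by (auto simp: inm_def inp_def inc_def pt_eq_iff)

lemma p_continuous: "continuous_map (underlying P) (underlying M) p"
  and r_continuous: "continuous_map (underlying P) (underlying N) r"
  using p r by (auto simp: cellular_map_def)

lemma p_top: "x \<in> topspace (underlying P) \<Longrightarrow> p x \<in> topspace (underlying M)"
  and r_top: "x \<in> topspace (underlying P) \<Longrightarrow> r x \<in> topspace (underlying N)"
  using p_continuous r_continuous by (auto simp: continuous_map_def)

lemma p_skeleton: "x \<in> skeleton P n \<Longrightarrow> p x \<in> skeleton M n"
  and r_skeleton: "x \<in> skeleton P n \<Longrightarrow> r x \<in> skeleton N n"
  using p r unfolding cellular_map_def by blast+

lemma topspace_summands: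
  "topspace summands = Inl ` topspace (underlying M) \<union> Inr ` Inl ` (topspace (underlying P) \<times> {0..1})
     \<union> Inr ` Inr ` topspace (underlying N)" (is "_ = ?T")
proof
  show "topspace summands \<subseteq> ?T"
  proof
    fix z assume z: "z \<in> topspace summands"
    have "openin summands (topspace summands)" by simp
    then have o: "openin (underlying M) {b. Inl b \<in> topspace summands}"
      "openin (cylinder (underlying P)) {y. Inr (Inl y) \<in> topspace summands}"
      "openin (underlying N) {c. Inr (Inr c) \<in> topspace summands}"
      unfolding openin_dmc_summands by blast+
    have "{b. Inl b \<in> topspace summands} \<subseteq> topspace (underlying M)"
      "{y. Inr (Inl y) \<in> topspace summands} \<subseteq> topspace (underlying P) \<times> {0..1}"
      "{c. Inr (Inr c) \<in> topspace summands} \<subseteq> topspace (underlying N)"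
      using openin_subset [OF o(1)] openin_subset [OF o(2)] openin_subset [OF o(3)] by simp_all
    with z show "z \<in> ?T" by (cases z rule: nf.cases) auto
  qed
  have "{b. Inl b \<in> ?T} = topspace (underlying M)" "{y. Inr (Inl y) \<in> ?T} = topspace (cylinder (underlying P))"
    "{c. Inr (Inr c) \<in> ?T} = topspace (underlying N)" by auto
  then have "openin summands ?T"
    unfolding openin_dmc_summands by (simp only: openin_topspace simp_thms)
  then show "?T \<subseteq> topspace summands" by (rule openin_subset)
qed

lemma DX_eq: "DX = quotient_topology summands glue"
  by (simp add: DMC_def Let_def)

lemma pt_quotient_map: "quotient_map summands DX pt"
  unfolding DX_eq pt_def by (rule quotient_map_quotient_topology)

lemma cells_D:
  "cells D n = (\<lambda>e. inm ` e) ` cells M n \<union> (\<lambda>e. inp ` e) ` cells N n \<union>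
     (case n of 0 \<Rightarrow> {} | Suc k \<Rightarrow> (\<lambda>e. inc ` (e \<times> {0<..<1})) ` cells P k)"
  by (cases n) (simp_all add: DMC_def Let_def inm_def inp_def inc_def pt_def image_image)

lemma inm_continuous: "continuous_map (underlying M) DX inm"
  and inp_continuous: "continuous_map (underlying N) DX inp"
  and inc_continuous: "continuous_map (cylinder (underlying P)) DX inc"
proof -
  have pt: "continuous_map summands DX pt"
    by (rule quotient_imp_continuous_map [OF pt_quotient_map])
  have "continuous_map (underlying M) summands Inl"
    unfolding continuous_map_def
  proof (intro conjI allI impI)
    fix U assume "openin summands U"
    then have o: "openin (underlying M) {b. Inl b \<in> U}" by (simp add: openin_dmc_summands)
    moreover have "{b \<in> topspace (underlying M). Inl b \<in> U} = {b. Inl b \<in> U}"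
      using openin_subset [OF o] by auto
    ultimately show "openin (underlying M) {b \<in> topspace (underlying M). Inl b \<in> U}" by simp
  qed (auto simp: topspace_summands)
  from continuous_map_compose [OF this pt] show "continuous_map (underlying M) DX inm"
    by (simp add: comp_def inm_def [abs_def])
  have "continuous_map (underlying N) summands (\<lambda>c. Inr (Inr c))"
    unfolding continuous_map_def
  proof (intro conjI allI impI)
    fix U assume "openin summands U"
    then have o: "openin (underlying N) {b. Inr (Inr b) \<in> U}" by (simp add: openin_dmc_summands)
    moreover have "{b \<in> topspace (underlying N). Inr (Inr b) \<in> U} = {b. Inr (Inr b) \<in> U}"
      using openin_subset [OF o] by auto
    ultimately show "openin (underlying N) {b \<in> topspace (underlying N). Inr (Inr b) \<in> U}" by simp
  qed (auto simp: topspace_summands)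
  from continuous_map_compose [OF this pt] show "continuous_map (underlying N) DX inp"
    by (simp add: comp_def inp_def [abs_def])
  have "continuous_map (cylinder (underlying P)) summands (\<lambda>c. Inr (Inl c))"
    unfolding continuous_map_def
  proof (intro conjI allI impI)
    fix U assume "openin summands U"
    then have o: "openin (cylinder (underlying P)) {b. Inr (Inl b) \<in> U}" by (simp add: openin_dmc_summands)
    moreover have "{b \<in> topspace (cylinder (underlying P)). Inr (Inl b) \<in> U} = {b. Inr (Inl b) \<in> U}"
      using openin_subset [OF o] by blast
    ultimately show "openin (cylinder (underlying P)) {b \<in> topspace (cylinder (underlying P)). Inr (Inl b) \<in> U}" by simp
  qed (auto simp: topspace_summands)
  from continuous_map_compose [OF this pt] show "continuous_map (cylinder (underlying P)) DX inc"
    by (simp add: comp_def inc_def [abs_def])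
qed

lemma topspace_DX_pt: "topspace DX = pt ` topspace summands"
  using quotient_imp_surjective_map [OF pt_quotient_map] by simp

lemma topspace_DX:
  "topspace DX = inm ` topspace (underlying M) \<union> inp ` topspace (underlying N) \<union>
     inc ` (topspace (underlying P) \<times> {0<..<1})" (is "_ = ?R")
proof
  have eq: "topspace DX = inm ` topspace (underlying M) \<union> inc ` (topspace (underlying P) \<times> {0..1}) \<union> inp ` topspace (underlying N)"
    unfolding topspace_DX_pt topspace_summands image_Un image_image inm_def inp_def inc_def ..
  then show "?R \<subseteq> topspace DX" by auto
  have "inc (x, t) \<in> ?R" if x: "x \<in> topspace (underlying P)" and t: "t \<in> {0..1}" for x t
  proof -
    consider "t = 0" | "t = 1" | "t \<in> {0<..<1}" using t by fastforce
    then show ?thesis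
      using x p_top r_top by cases (auto simp: inc_0 inc_1)
  qed
  then show "topspace DX \<subseteq> ?R" unfolding eq by blast
qed

subsection \<open>The Hausdorff property\<close>

text \<open>A set is a union of fibres of the quotient map if it contains a point exactly when it contains its
  normal form.\<close>

lemma saturated_open:
  assumes "openin summands V" and sat: "\<And>z. z \<in> topspace summands \<Longrightarrow> z \<in> V \<longleftrightarrow> nf z \<in> V"
  shows "openin DX (pt ` V)" and "z \<in> topspace summands \<Longrightarrow> pt z \<in> pt ` V \<longleftrightarrow> z \<in> V"
proof -
  have V: "V \<subseteq> topspace summands" using assms(1) by (rule openin_subset)
  show pre: "pt z \<in> pt ` V \<longleftrightarrow> z \<in> V" if "z \<in> topspace summands" for z
  proof
    assume "pt z \<in> pt ` V"
    then obtain w where w: "w \<in> V" "nf z = nf w" by (auto simp: pt_eq_iff)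
    then have "nf w \<in> V" using sat V by blast
    then show "z \<in> V" using sat [OF that] w by simp
  qed auto
  have "{z \<in> topspace summands. pt z \<in> pt ` V} = V" using pre V by auto
  moreover have "openin summands {z \<in> topspace summands. pt z \<in> pt ` V} \<longleftrightarrow> openin DX (pt ` V)"
    using pt_quotient_map image_mono [OF V, of pt] unfolding quotient_map_def topspace_DX_pt by blast
  ultimately show "openin DX (pt ` V)"
    using assms(1) by simp
qed

lemma nf_topspace: "z \<in> topspace summands \<Longrightarrow> nf z \<in> topspace summands"
  unfolding topspace_summands using p_top r_top by (cases z rule: nf.cases) auto

lemma nf_nf: "nf (nf z) = nf z"
  by (cases z rule: nf.cases) auto

lemma separate:
  assumes z: "z \<in> topspace summands" "z' \<in> topspace summands"
    and V: "openin summands V" "\<And>w. w \<in> topspace summands \<Longrightarrow> w \<in> V \<longleftrightarrow> nf w \<in> V"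
    and V': "openin summands V'" "\<And>w. w \<in> topspace summands \<Longrightarrow> w \<in> V' \<longleftrightarrow> nf w \<in> V'"
    and "z \<in> V" "z' \<in> V'" "V \<inter> V' = {}"
  shows "\<exists>U U'. openin DX U \<and> openin DX U' \<and> pt z \<in> U \<and> pt z' \<in> U' \<and> disjnt U U'"
proof (intro exI conjI)
  show "openin DX (pt ` V)" "openin DX (pt ` V')"
    using saturated_open(1) V V' by auto
  show "disjnt (pt ` V) (pt ` V')"
    unfolding disjnt_def
  proof (rule ccontr)
    assume "pt ` V \<inter> pt ` V' \<noteq> {}"
    then obtain w where w: "w \<in> V" "pt w \<in> pt ` V'" by blast
    then have "w \<in> topspace summands" using V(1) openin_subset by blast
    then have "w \<in> V'" using saturated_open(2) [OF V'] w(2) by blast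
    then show False using w(1) assms(9) by blast
  qed
qed (use assms in auto)

fun height :: "'b + ('a \<times> real) + 'c \<Rightarrow> real" where
  "height (Inl b) = 0"
| "height (Inr (Inl (x, t))) = t"
| "height (Inr (Inr c)) = 1"

lemma height_nf: "height (nf z) = height z"
  by (cases z rule: nf.cases) auto

lemma snd_continuous: "continuous_map (cylinder X) euclideanreal snd"
  by (meson continuous_map_into_fulltopology continuous_map_snd)

text \<open>The height is compatible with the gluing and separates points of different heights. Two points of the same
  base are separated by their neighbourhoods in that base, each enlarged by the part of the cylinder that lies
  over it, without the opposite end. Two points of the same height strictly between the ends are
  separated by open sets of \<open>P\<close> times the open interval.\<close>

lemma Hausdorff_DX: "Hausdorff_space DX"
  unfolding Hausdorff_space_def
proof (intro allI impI, elim conjE)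
  fix a a' assume a: "a \<in> topspace DX" "a' \<in> topspace DX" "a \<noteq> a'"
  then obtain w w' where w: "w \<in> topspace summands" "w' \<in> topspace summands" "a = pt w" "a' = pt w'"
    unfolding topspace_DX_pt by blast
  define z where "z = nf w"
  define z' where "z' = nf w'"
  have z: "z \<in> topspace summands" "z' \<in> topspace summands" "a = pt z" "a' = pt z'" "nf z = z" "nf z' = z'"
    using w nf_topspace nf_nf by (auto simp: z_def z'_def pt_eq_iff)
  then have "z \<noteq> z'" using a(3) by auto
  show "\<exists>U V. openin DX U \<and> openin DX V \<and> a \<in> U \<and> a' \<in> V \<and> disjnt U V"
  proof (cases "height z = height z'")
    case False
    then obtain J J' where J: "open J" "open J'" "height z \<in> J" "height z' \<in> J'" "J \<inter> J' = {}"
      using hausdorff by metis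
    have op: "openin summands {u \<in> topspace summands. height u \<in> J}" if "open J" for J
    proof -
      have "{b. Inl b \<in> topspace summands \<and> height (Inl b) \<in> J} = (if 0 \<in> J then topspace (underlying M) else {})"
        "{c. Inr (Inr c) \<in> topspace summands \<and> height (Inr (Inr c)) \<in> J} = (if 1 \<in> J then topspace (underlying N) else {})"
        "{y. Inr (Inl y) \<in> topspace summands \<and> height (Inr (Inl y)) \<in> J} = {y \<in> topspace (cylinder (underlying P)). snd y \<in> J}"
        by (auto simp: topspace_summands)
      moreover have "openin (cylinder (underlying P)) {y \<in> topspace (cylinder (underlying P)). snd y \<in> J}"
        using openin_continuous_map_preimage [OF snd_continuous] that by auto
      ultimately show ?thesis
        unfolding openin_dmc_summands mem_Collect_eq by simp
    qed
    show ?thesis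
      unfolding z(3,4)
    proof (rule separate [OF z(1,2)])
      show "openin summands {u \<in> topspace summands. height u \<in> J}" "openin summands {u \<in> topspace summands. height u \<in> J'}"
        using op J by auto
      show "{u \<in> topspace summands. height u \<in> J} \<inter> {u \<in> topspace summands. height u \<in> J'} = {}"
        using J(5) by blast
    qed (use z J height_nf nf_topspace in auto)
  next
    case True
    consider (fm) b b' where "z = Inl b" "z' = Inl b'" | (fn) c c' where "z = Inr (Inr c)" "z' = Inr (Inr c')"
      | (fp) x t x' where "z = Inr (Inl (x, t))" "z' = Inr (Inl (x', t))" "t \<in> {0<..<1}"
    proof -
      have *: "t \<in> {0<..<1}" if "Inr (Inl (x, t)) = z \<or> Inr (Inl (x, t)) = z'" for x t
        using that z unfolding topspace_summands by (auto split: if_splits)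
      show ?thesis
        using True * that by (cases z rule: height.cases; cases z' rule: height.cases) force+
    qed
    then show ?thesis
    proof cases
      case fm
      then have "b \<in> topspace (underlying M)" "b' \<in> topspace (underlying M)" "b \<noteq> b'"
        using z \<open>z \<noteq> z'\<close> by (auto simp: topspace_summands)
      then obtain U U' where U: "openin (underlying M) U" "openin (underlying M) U'" "b \<in> U" "b' \<in> U'" "disjnt U U'"
        using CW_Hausdorff [OF M] unfolding Hausdorff_space_def by metis
      define W :: "'b set \<Rightarrow> ('b + ('a \<times> real) + 'c) set" where "W U = Inl ` U \<union> Inr ` Inl ` {y \<in> topspace (cylinder (underlying P)). p (fst y) \<in> U \<and> snd y \<in> {..<1}}"
        for U :: "'b set"
      have op: "openin summands (W U)" if "openin (underlying M) U" for U
      proof -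
        have "{b. Inl b \<in> W U} = U" "{c. Inr (Inr c) \<in> W U} = {}"
          "{y. Inr (Inl y) \<in> W U} = {y \<in> topspace (cylinder (underlying P)). (p \<circ> fst) y \<in> U} \<inter>
             {y \<in> topspace (cylinder (underlying P)). snd y \<in> {..<1}}"
          by (auto simp: W_def)
        moreover have "openin (cylinder (underlying P)) {y \<in> topspace (cylinder (underlying P)). (p \<circ> fst) y \<in> U}"
          using that by (rule openin_continuous_map_preimage [OF continuous_map_compose [OF continuous_map_fst p_continuous]])
        moreover have "openin (cylinder (underlying P)) {y \<in> topspace (cylinder (underlying P)). snd y \<in> {..<1}}"
          by (rule openin_continuous_map_preimage [OF snd_continuous]) simp
        ultimately show ?thesis
          unfolding openin_dmc_summands using that by (simp add: openin_Int)
      qed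
      have sat: "u \<in> W U \<longleftrightarrow> nf u \<in> W U" if "u \<in> topspace summands" for u U
        using that unfolding topspace_summands W_def by (cases u rule: nf.cases) auto
      show ?thesis
        unfolding z(3,4)
        by (rule separate [OF z(1,2) op [OF U(1)] sat op [OF U(2)] sat]) (use fm U in \<open>auto simp: W_def disjnt_def\<close>)
    next
      case fn
      then have "c \<in> topspace (underlying N)" "c' \<in> topspace (underlying N)" "c \<noteq> c'"
        using z \<open>z \<noteq> z'\<close> by (auto simp: topspace_summands)
      then obtain U U' where U: "openin (underlying N) U" "openin (underlying N) U'" "c \<in> U" "c' \<in> U'" "disjnt U U'"
        using CW_Hausdorff [OF N]
        unfolding Hausdorff_space_def by metis
      define W :: "'c set \<Rightarrow> ('b + ('a \<times> real) + 'c) set" where "W U = Inr ` Inr ` U \<union> Inr ` Inl ` {y \<in> topspace (cylinder (underlying P)). r (fst y) \<in> U \<and> snd y \<in> {0<..}}"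
        for U :: "'c set"
      have op: "openin summands (W U)" if "openin (underlying N) U" for U
      proof -
        have "{b. Inl b \<in> W U} = {}" "{c. Inr (Inr c) \<in> W U} = U"
          "{y. Inr (Inl y) \<in> W U} = {y \<in> topspace (cylinder (underlying P)). (r \<circ> fst) y \<in> U} \<inter>
             {y \<in> topspace (cylinder (underlying P)). snd y \<in> {0<..}}"
          by (auto simp: W_def)
        moreover have "openin (cylinder (underlying P)) {y \<in> topspace (cylinder (underlying P)). (r \<circ> fst) y \<in> U}"
          using that by (rule openin_continuous_map_preimage [OF continuous_map_compose [OF continuous_map_fst r_continuous]])
        moreover have "openin (cylinder (underlying P)) {y \<in> topspace (cylinder (underlying P)). snd y \<in> {0<..}}"
          by (rule openin_continuous_map_preimage [OF snd_continuous]) simp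
        ultimately show ?thesis
          unfolding openin_dmc_summands using that by (simp add: openin_Int)
      qed
      have sat: "u \<in> W U \<longleftrightarrow> nf u \<in> W U" if "u \<in> topspace summands" for u U
        using that unfolding topspace_summands W_def by (cases u rule: nf.cases) auto
      show ?thesis
        unfolding z(3,4)
        by (rule separate [OF z(1,2) op [OF U(1)] sat op [OF U(2)] sat]) (use fn U in \<open>auto simp: W_def disjnt_def\<close>)
    next
      case fp
      then have "x \<in> topspace (underlying P)" "x' \<in> topspace (underlying P)" "x \<noteq> x'"
        using z \<open>z \<noteq> z'\<close> by (auto simp: topspace_summands)
      then obtain U U' where U: "openin (underlying P) U" "openin (underlying P) U'" "x \<in> U" "x' \<in> U'" "disjnt U U'"
        using CW_Hausdorff [OF P]
        unfolding Hausdorff_space_def by metis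
      define W :: "'a set \<Rightarrow> ('b + ('a \<times> real) + 'c) set" where "W U = Inr ` Inl ` {y \<in> topspace (cylinder (underlying P)). fst y \<in> U \<and> snd y \<in> {0<..<1}}"
        for U :: "'a set"
      have op: "openin summands (W U)" if "openin (underlying P) U" for U
      proof -
        have "{b. Inl b \<in> W U} = {}" "{c. Inr (Inr c) \<in> W U} = {}"
          "{y. Inr (Inl y) \<in> W U} = {y \<in> topspace (cylinder (underlying P)). fst y \<in> U} \<inter>
             {y \<in> topspace (cylinder (underlying P)). snd y \<in> {0<..<1}}"
          by (auto simp: W_def)
        moreover have "openin (cylinder (underlying P)) {y \<in> topspace (cylinder (underlying P)). fst y \<in> U}"
          using that by (rule openin_continuous_map_preimage [OF continuous_map_fst])
        moreover have "openin (cylinder (underlying P)) {y \<in> topspace (cylinder (underlying P)). snd y \<in> {0<..<1}}"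
          by (rule openin_continuous_map_preimage [OF snd_continuous]) simp
        ultimately show ?thesis
          unfolding openin_dmc_summands by (simp add: openin_Int)
      qed
      have sat: "u \<in> W U \<longleftrightarrow> nf u \<in> W U" if "u \<in> topspace summands" for u U
        using that unfolding topspace_summands W_def by (cases u rule: nf.cases) auto
      show ?thesis
        unfolding z(3,4)
      proof (rule separate [OF z(1,2) op [OF U(1)] sat op [OF U(2)] sat])
        show "z \<in> W U" "z' \<in> W U'"
          using fp U \<open>x \<in> topspace (underlying P)\<close> \<open>x' \<in> topspace (underlying P)\<close> by (auto simp: W_def)
        show "W U \<inter> W U' = ({} :: ('b + ('a \<times> real) + 'c) set)"
          using U(5) by (auto simp: W_def disjnt_def)
      qed
    qed
  qed
qed

subsection \<open>Cells and characteristic maps\<close>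

lemma skeleton_D:
  "skeleton D n = inm ` skeleton M n \<union> inp ` skeleton N n \<union> inc ` (skeleton P (n - 1) \<times> {0<..<1})"
proof
  show "skeleton D n \<subseteq> inm ` skeleton M n \<union> inp ` skeleton N n \<union> inc ` (skeleton P (n - 1) \<times> {0<..<1})"
  proof
    fix y assume "y \<in> skeleton D n"
    then obtain k c where k: "int k \<le> n" "c \<in> cells D k" "y \<in> c" by (auto simp: skeleton_def)
    then consider (fm) e where "e \<in> cells M k" "c = inm ` e" | (fn) e where "e \<in> cells N k" "c = inp ` e"
      | (fp) l e where "k = Suc l" "e \<in> cells P l" "c = inc ` (e \<times> {0<..<1})"
      unfolding cells_D by (auto split: nat.splits)
    then show "y \<in> inm ` skeleton M n \<union> inp ` skeleton N n \<union> inc ` (skeleton P (n - 1) \<times> {0<..<1})"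
    proof cases
      case fm
      then have "e \<subseteq> skeleton M n" using k by (auto simp: skeleton_def)
      then show ?thesis using fm k by blast
    next
      case fn
      then have "e \<subseteq> skeleton N n" using k by (auto simp: skeleton_def)
      then show ?thesis using fn k by blast
    next
      case fp
      then have "int l \<le> n - 1" using k by simp
      with fp have "e \<subseteq> skeleton P (n - 1)" by (auto simp: skeleton_def)
      then show ?thesis using fp k by blast
    qed
  qed
  have "inm ` skeleton M n \<subseteq> skeleton D n"
  proof
    fix y assume "y \<in> inm ` skeleton M n"
    then obtain k e b where "int k \<le> n" "e \<in> cells M k" "b \<in> e" "y = inm b" by (auto simp: skeleton_def)
    moreover from this have "inm ` e \<in> cells D k" unfolding cells_D by blast
    ultimately show "y \<in> skeleton D n" unfolding skeleton_def by blast
  qed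
  moreover have "inp ` skeleton N n \<subseteq> skeleton D n"
  proof
    fix y assume "y \<in> inp ` skeleton N n"
    then obtain k e b where "int k \<le> n" "e \<in> cells N k" "b \<in> e" "y = inp b" by (auto simp: skeleton_def)
    moreover from this have "inp ` e \<in> cells D k" unfolding cells_D by blast
    ultimately show "y \<in> skeleton D n" unfolding skeleton_def by blast
  qed
  moreover have "inc ` (skeleton P (n - 1) \<times> {0<..<1}) \<subseteq> skeleton D n"
  proof
    fix y assume "y \<in> inc ` (skeleton P (n - 1) \<times> {0<..<1})"
    then obtain k e x t where k: "int k \<le> n - 1" "e \<in> cells P k" "x \<in> e" "y = inc (x, t)" "t \<in> {0<..<1}"
      by (auto simp: skeleton_def)
    then have "inc ` (e \<times> {0<..<1}) \<in> cells D (Suc k)" "int (Suc k) \<le> n" unfolding cells_D by auto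
    then have "inc ` (e \<times> {0<..<1}) \<subseteq> skeleton D n"
      unfolding skeleton_def by (intro Union_upper) blast
    moreover have "y \<in> inc ` (e \<times> {0<..<1})" using k(3-5) by simp
    ultimately show "y \<in> skeleton D n" by blast
  qed
  ultimately show "inm ` skeleton M n \<union> inp ` skeleton N n \<union> inc ` (skeleton P (n - 1) \<times> {0<..<1}) \<subseteq> skeleton D n"
    by (intro Un_least)
qed

lemma inc_skeleton:
  assumes "x \<in> skeleton P n" "t \<in> {0..1}"
  shows "inc (x, t) \<in> skeleton D (n + 1)"
    and "t = 0 \<or> t = 1 \<Longrightarrow> inc (x, t) \<in> skeleton D n"
proof -
  have x: "x \<in> topspace (underlying P)" using assms CW_skeleton_subset [OF P] by blast
  show ends: "inc (x, t) \<in> skeleton D n" if "t = 0 \<or> t = 1"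
    using that
  proof
    assume "t = 0"
    then show ?thesis unfolding skeleton_D using p_skeleton [OF assms(1)] by (simp add: inc_0 [OF x])
  next
    assume "t = 1"
    then show ?thesis unfolding skeleton_D using r_skeleton [OF assms(1)] by (simp add: inc_1 [OF x])
  qed
  show "inc (x, t) \<in> skeleton D (n + 1)"
  proof (cases "t = 0 \<or> t = 1")
    case True
    then show ?thesis using ends skeleton_mono [of n "n + 1" D] by auto
  next
    case False
    then have "t \<in> {0<..<1}" using assms(2) by auto
    then show ?thesis using assms(1) unfolding skeleton_D by auto
  qed
qed

lemma characteristic_map_inm:
  assumes e: "e \<in> cells M n" and \<phi>: "characteristic_map M n e \<phi>"
  shows "characteristic_map D n (inm ` e) (inm \<circ> \<phi>)"
  unfolding characteristic_map_def
proof (intro conjI)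
  have c: "continuous_map (closed_disc n) (underlying M) \<phi>" and b: "\<phi> ` disc_boundary n \<subseteq> skeleton M (int n - 1)"
    and h: "homeomorphic_map (open_disc n) (subtopology (underlying M) e) \<phi>"
    using \<phi> by (auto simp: characteristic_map_def)
  show c': "continuous_map (closed_disc n) DX (inm \<circ> \<phi>)"
    using c inm_continuous by (rule continuous_map_compose)
  show "(inm \<circ> \<phi>) ` disc_boundary n \<subseteq> skeleton D (int n - 1)"
    using b unfolding skeleton_D by auto
  have im: "\<phi> ` topspace (open_disc n) = e"
    by (rule characteristic_map_open_image [OF M e \<phi>])
  have "skeleton M (int n - 1) \<inter> e = {}"
    using CW_disjoint [OF M _ e] by (force simp: skeleton_def)
  then have "\<phi> ` disc_boundary n \<inter> e = {}" using b by blast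
  then have "(inm \<circ> \<phi>) ` disc_boundary n \<inter> inm ` e = {}" by auto
  moreover have "inj_on (inm \<circ> \<phi>) (topspace (open_disc n))"
    using homeomorphic_imp_injective_map [OF h] by (auto simp: inj_on_def)
  moreover have "(inm \<circ> \<phi>) ` topspace (open_disc n) = inm ` e"
    unfolding image_comp [symmetric] im ..
  ultimately show "homeomorphic_map (open_disc n) (subtopology DX (inm ` e)) (inm \<circ> \<phi>)"
    by (intro homeomorphic_map_open_disc [OF Hausdorff_DX c'])
qed

lemma characteristic_map_inp:
  assumes e: "e \<in> cells N n" and \<phi>: "characteristic_map N n e \<phi>"
  shows "characteristic_map D n (inp ` e) (inp \<circ> \<phi>)"
  unfolding characteristic_map_def
proof (intro conjI)
  have c: "continuous_map (closed_disc n) (underlying N) \<phi>" and b: "\<phi> ` disc_boundary n \<subseteq> skeleton N (int n - 1)"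
    and h: "homeomorphic_map (open_disc n) (subtopology (underlying N) e) \<phi>"
    using \<phi> by (auto simp: characteristic_map_def)
  show c': "continuous_map (closed_disc n) DX (inp \<circ> \<phi>)"
    using c inp_continuous by (rule continuous_map_compose)
  show "(inp \<circ> \<phi>) ` disc_boundary n \<subseteq> skeleton D (int n - 1)"
    using b unfolding skeleton_D by auto
  have im: "\<phi> ` topspace (open_disc n) = e"
    by (rule characteristic_map_open_image [OF N e \<phi>])
  have "skeleton N (int n - 1) \<inter> e = {}"
    using CW_disjoint [OF N _ e] by (force simp: skeleton_def)
  then have "\<phi> ` disc_boundary n \<inter> e = {}" using b by blast
  then have "(inp \<circ> \<phi>) ` disc_boundary n \<inter> inp ` e = {}" by auto
  moreover have "inj_on (inp \<circ> \<phi>) (topspace (open_disc n))"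
    using homeomorphic_imp_injective_map [OF h] by (auto simp: inj_on_def)
  moreover have "(inp \<circ> \<phi>) ` topspace (open_disc n) = inp ` e"
    unfolding image_comp [symmetric] im ..
  ultimately show "homeomorphic_map (open_disc n) (subtopology DX (inp ` e)) (inp \<circ> \<phi>)"
    by (intro homeomorphic_map_open_disc [OF Hausdorff_DX c'])
qed

text \<open>The disc of dimension \<open>n + 1\<close> is viewed as the cylinder over the \<open>n\<close>-disc. The ends of that cylinder go to the
  bases, and its side goes to prisms over cells of lower dimension.\<close>

lemma characteristic_map_inc:
  assumes e: "e \<in> cells P n" and \<phi>: "characteristic_map P n e \<phi>"
  shows "characteristic_map D (Suc n) (inc ` (e \<times> {0<..<1})) (inc \<circ> map_prod \<phi> id \<circ> disc_to_cylinder n)"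
proof -
  let ?\<psi> = "inc \<circ> map_prod \<phi> id \<circ> disc_to_cylinder n" and ?e = "inc ` (e \<times> {0<..<1})"
  have c: "continuous_map (closed_disc n) (underlying P) \<phi>" and b: "\<phi> ` disc_boundary n \<subseteq> skeleton P (int n - 1)"
    and h: "homeomorphic_map (open_disc n) (subtopology (underlying P) e) \<phi>"
    using \<phi> by (auto simp: characteristic_map_def)
  have im: "\<phi> ` topspace (open_disc n) = e"
    by (rule characteristic_map_open_image [OF P e \<phi>])
  have inj: "inj_on \<phi> (topspace (open_disc n))"
    by (rule homeomorphic_imp_injective_map [OF h])
  have D_skel: "\<phi> x \<in> skeleton P (int n)" if "x \<in> disc_set n" for x
    using characteristic_map_closed_image(2) [OF P e \<phi>] that by blast
  have c': "continuous_map (closed_disc (Suc n)) DX ?\<psi>"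
    by (intro continuous_map_compose [OF disc_to_cylinder(4)] continuous_map_compose [OF continuous_map_cylinder [OF c] inc_continuous])
  have e_skel: "skeleton P (int n - 1) \<inter> e = {}"
    using CW_disjoint [OF P _ e] by (force simp: skeleton_def)
  have bd: "?\<psi> y \<in> skeleton D (int n) \<and> ?\<psi> y \<notin> ?e" if y: "y \<in> disc_boundary (Suc n)" for y
  proof -
    have "y \<in> disc_set (Suc n)" using y by (simp add: disc_boundary_alt)
    then have "disc_to_cylinder n y \<in> cylinder_boundary (closed_disc n) (disc_boundary n)"
      using disc_to_cylinder(5) y by blast
    then obtain x t where xt: "disc_to_cylinder n y = (x, t)" "x \<in> disc_set n" "t \<in> {0..1}" "t = 0 \<or> t = 1 \<or> x \<in> disc_boundary n"
      unfolding cylinder_boundary_def by auto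
    have eq: "?\<psi> y = inc (\<phi> x, t)" by (simp add: xt(1))
    have top: "\<phi> x \<in> topspace (underlying P)" using c xt(2) by (auto simp: continuous_map_def)
    show ?thesis
    proof (cases "t = 0 \<or> t = 1")
      case True
      then have "inc (\<phi> x, t) = inm (p (\<phi> x)) \<or> inc (\<phi> x, t) = inp (r (\<phi> x))"
        using top by (auto simp: inc_0 inc_1)
      moreover have "inc (\<phi> x, t) \<noteq> inm b \<and> inc (\<phi> x, t) \<noteq> inp c" if mem: "inc (\<phi> x, t) \<in> ?e" for b c
      proof -
        obtain z where "inc (\<phi> x, t) = inc z" "z \<in> e \<times> {0<..<1}" using mem by (rule imageE)
        then show ?thesis using inc_neq by (cases z) simp
      qed
      ultimately have "inc (\<phi> x, t) \<notin> ?e" by blast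
      then show ?thesis
        unfolding eq using inc_skeleton(2) [OF D_skel [OF xt(2)] xt(3) True] by blast
    next
      case False
      then have t: "t \<in> {0<..<1}" and x: "\<phi> x \<in> skeleton P (int n - 1)" using xt b by auto
      then have "\<phi> x \<notin> e" using e_skel by blast
      then have "inc (\<phi> x, t) \<notin> ?e" using inc_eq_iff [OF t] by auto
      then show ?thesis
        unfolding eq using inc_skeleton(1) [OF x xt(3)] by simp
    qed
  qed
  have op: "\<exists>x t. disc_to_cylinder n y = (x, t) \<and> x \<in> topspace (open_disc n) \<and> t \<in> {0<..<1}"
    if y: "y \<in> topspace (open_disc (Suc n))" for y
  proof -
    have y': "y \<in> disc_set (Suc n)" "y \<notin> disc_boundary (Suc n)" using y by (auto simp: topspace_open_disc disc_boundary_alt)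
    obtain x t where xt: "disc_to_cylinder n y = (x, t)" by fastforce
    have "(x, t) \<in> disc_set n \<times> {0..1}" "(x, t) \<notin> cylinder_boundary (closed_disc n) (disc_boundary n)"
      using disc_to_cylinder(2,5) [OF y'(1)] y'(2) unfolding xt by auto
    then have "x \<in> disc_set n" "x \<notin> disc_boundary n" "t \<in> {0<..<1}"
      unfolding cylinder_boundary_def by auto
    then show ?thesis using xt by (auto simp: disc_boundary_def)
  qed
  have "inj_on ?\<psi> (topspace (open_disc (Suc n)))"
  proof (rule inj_onI)
    fix y y' assume y: "y \<in> topspace (open_disc (Suc n))" "y' \<in> topspace (open_disc (Suc n))" "?\<psi> y = ?\<psi> y'"
    obtain x t x' t' where xt: "disc_to_cylinder n y = (x, t)" "x \<in> topspace (open_disc n)" "t \<in> {0<..<1}"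
      "disc_to_cylinder n y' = (x', t')" "x' \<in> topspace (open_disc n)" "t' \<in> {0<..<1}"
      using op [OF y(1)] op [OF y(2)] by blast
    then have "\<phi> x = \<phi> x'" "t = t'"
      using y(3) inc_eq_iff [OF xt(3,6)] by auto
    then have "disc_to_cylinder n y = disc_to_cylinder n y'"
      using inj_onD [OF inj _ xt(2,5)] xt by simp
    moreover have "y \<in> disc_set (Suc n)" "y' \<in> disc_set (Suc n)"
      using y by (auto simp: topspace_open_disc)
    ultimately show "y = y'" using disc_to_cylinder(3) by metis
  qed
  moreover have "?\<psi> ` topspace (open_disc (Suc n)) = ?e"
  proof
    show "?\<psi> ` topspace (open_disc (Suc n)) \<subseteq> ?e"
      using op im by fastforce
    show "?e \<subseteq> ?\<psi> ` topspace (open_disc (Suc n))"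
    proof
      fix y assume "y \<in> ?e"
      then obtain x t where xt: "x \<in> topspace (open_disc n)" "t \<in> {0<..<1}" "y = inc (\<phi> x, t)"
        unfolding im [symmetric] by auto
      let ?y = "cylinder_to_disc n (x, t)"
      have z: "(x, t) \<in> disc_set n \<times> {0..1}" using xt by (auto simp: topspace_open_disc)
      have d: "disc_to_cylinder n ?y = (x, t)" by (rule disc_to_cylinder(1) [OF z])
      have y: "?y \<in> disc_set (Suc n)"
        using homeomorphic_imp_surjective_map [OF cylinder_to_disc(1)] z by fastforce
      have "x \<notin> disc_boundary n" using xt(1) by (auto simp: topspace_open_disc disc_boundary_alt)
      then have "(x, t) \<notin> cylinder_boundary (closed_disc n) (disc_boundary n)"
        using xt(2) by (auto simp: cylinder_boundary_def)
      then have "?y \<notin> disc_boundary (Suc n)"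
        using disc_to_cylinder(5) [OF y] unfolding d by blast
      then have "?y \<in> topspace (open_disc (Suc n))" using y by (auto simp: disc_boundary_def)
      moreover have "?\<psi> ?y = y" by (simp add: d xt(3))
      ultimately show "y \<in> ?\<psi> ` topspace (open_disc (Suc n))" by (metis (no_types) image_eqI)
    qed
  qed
  moreover have "?\<psi> ` disc_boundary (Suc n) \<inter> ?e = {}" using bd by blast
  ultimately have "homeomorphic_map (open_disc (Suc n)) (subtopology DX ?e) ?\<psi>"
    by (rule homeomorphic_map_open_disc [OF Hausdorff_DX c'])
  then show ?thesis
    unfolding characteristic_map_def using c' bd by auto
qed

lemma cells_D_cases:
  assumes "c \<in> cells D n"
  obtains (fm) e where "e \<in> cells M n" "c = inm ` e" | (fn) e where "e \<in> cells N n" "c = inp ` e"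
    | (fp) k e where "n = Suc k" "e \<in> cells P k" "c = inc ` (e \<times> {0<..<1})"
  using assms unfolding cells_D by (auto split: nat.splits)

lemma image_disjoint:
  "inc ` (e \<times> {0<..<1}) \<inter> inm ` e' = {}" "inm ` e' \<inter> inc ` (e \<times> {0<..<1}) = {}"
  "inc ` (e \<times> {0<..<1}) \<inter> inp ` e'' = {}" "inp ` e'' \<inter> inc ` (e \<times> {0<..<1}) = {}"
  "inm ` e' \<inter> inp ` e'' = {}" "inp ` e'' \<inter> inm ` e' = {}"
proof -
  have *: "inc z \<noteq> inm b" "inc z \<noteq> inp c" if "z \<in> e \<times> {0<..<1}" for z b c
    using that inc_neq by (cases z; simp)+
  show 1: "inc ` (e \<times> {0<..<1}) \<inter> inm ` e' = {}"
  proof (rule equals0I)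
    fix y assume "y \<in> inc ` (e \<times> {0<..<1}) \<inter> inm ` e'"
    then obtain z b where "y = inc z" "z \<in> e \<times> {0<..<1}" "y = inm b" by (elim IntE imageE)
    then show False using *(1) by metis
  qed
  show 2: "inc ` (e \<times> {0<..<1}) \<inter> inp ` e'' = {}"
  proof (rule equals0I)
    fix y assume "y \<in> inc ` (e \<times> {0<..<1}) \<inter> inp ` e''"
    then obtain z b where "y = inc z" "z \<in> e \<times> {0<..<1}" "y = inp b" by (elim IntE imageE)
    then show False using *(2) by metis
  qed
  from 1 2 show "inm ` e' \<inter> inc ` (e \<times> {0<..<1}) = {}" "inp ` e'' \<inter> inc ` (e \<times> {0<..<1}) = {}"
    by (simp_all only: Int_commute)
qed auto

lemma inc_image_Int: "inc ` (e \<times> {0<..<1}) \<inter> inc ` (e' \<times> {0<..<1}) = inc ` ((e \<inter> e') \<times> {0<..<1})"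
  using inc_eq_iff by auto

theorem finite_CW_D: "finite_CW D"
  unfolding finite_CW_def
proof (intro conjI allI ballI impI)
  show "Hausdorff_space DX" by (rule Hausdorff_DX)
  have "{(k, c). c \<in> cells D k} \<subseteq> (\<lambda>(k, e). (k, inm ` e)) ` {(k, e). e \<in> cells M k} \<union>
      (\<lambda>(k, e). (k, inp ` e)) ` {(k, e). e \<in> cells N k} \<union>
      (\<lambda>(k, e). (Suc k, inc ` (e \<times> {0<..<1}))) ` {(k, e). e \<in> cells P k}"
    by (auto elim!: cells_D_cases)
  moreover have "finite {(k, e). e \<in> cells M k}" "finite {(k, e). e \<in> cells N k}" "finite {(k, e). e \<in> cells P k}"
    using M N P by (simp_all add: finite_CW_def)
  ultimately show "finite {(k, c). c \<in> cells D k}"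
    by (meson finite_UnI finite_imageI finite_subset)
next
  fix k l c c' assume c: "c \<in> cells D k \<and> c' \<in> cells D l \<and> (k, c) \<noteq> (l, c')"
  then have ck: "c \<in> cells D k" "c' \<in> cells D l" by auto
  from ck(1) show "c \<inter> c' = {}"
  proof (cases rule: cells_D_cases)
    case m: (fm e)
    from ck(2) show ?thesis
    proof (cases rule: cells_D_cases)
      case m': (fm e')
      have "e \<inter> e' = {}" using CW_disjoint [OF M m(1) m'(1)] c m(2) m'(2) by blast
      then show ?thesis unfolding m(2) m'(2) by auto
    qed (use m in \<open>simp_all add: image_disjoint\<close>)
  next
    case n: (fn e)
    from ck(2) show ?thesis
    proof (cases rule: cells_D_cases)
      case n': (fn e')
      have "e \<inter> e' = {}" using CW_disjoint [OF N n(1) n'(1)] c n(2) n'(2) by blast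
      then show ?thesis unfolding n(2) n'(2) by auto
    qed (use n in \<open>simp_all add: image_disjoint\<close>)
  next
    case q: (fp k' e)
    from ck(2) show ?thesis
    proof (cases rule: cells_D_cases)
      case q': (fp l' e')
      have "e \<inter> e' = {}" using CW_disjoint [OF P q(2) q'(2)] c q q' by blast
      then show ?thesis unfolding q(3) q'(3) inc_image_Int by simp
    qed (use q in \<open>simp_all add: image_disjoint\<close>)
  qed
next
  have U: "(\<Union>k. \<Union>(cells Y k)) = topspace (underlying Y)" if "finite_CW Y" for Y :: "'x cell_complex"
    using that by (simp only: finite_CW_def)
  have "(\<Union>k. \<Union>(cells D k)) = inm ` (\<Union>k. \<Union>(cells M k)) \<union> inp ` (\<Union>k. \<Union>(cells N k)) \<union>
      inc ` ((\<Union>k. \<Union>(cells P k)) \<times> {0<..<1})" (is "?L = ?R")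
  proof
    show "?L \<subseteq> ?R"
    proof (intro UN_least Union_least)
      fix k c assume "c \<in> cells D k"
      then show "c \<subseteq> ?R"
      proof (cases rule: cells_D_cases)
        case (fm e)
        then have "e \<subseteq> (\<Union>k. \<Union>(cells M k))" by blast
        then show ?thesis unfolding fm(2) by (intro le_supI1 image_mono)
      next
        case (fn e)
        then have "e \<subseteq> (\<Union>k. \<Union>(cells N k))" by blast
        then show ?thesis unfolding fn(2) by (intro le_supI1 le_supI2 image_mono)
      next
        case (fp l e)
        then have "e \<subseteq> (\<Union>k. \<Union>(cells P k))" by blast
        then have "e \<times> {0<..<1::real} \<subseteq> (\<Union>k. \<Union>(cells P k)) \<times> {0<..<1}" by blast
        then show ?thesis unfolding fp(3) by (intro le_supI2 image_mono)
      qed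
    qed
    have m: "inm ` e \<subseteq> ?L" if "e \<in> cells M k" for e k
    proof -
      have "inm ` e \<in> cells D k" using that by (simp add: cells_D)
      then show ?thesis by blast
    qed
    have n: "inp ` e \<subseteq> ?L" if "e \<in> cells N k" for e k
    proof -
      have "inp ` e \<in> cells D k" using that by (simp add: cells_D)
      then show ?thesis by blast
    qed
    have q: "inc ` (e \<times> {0<..<1}) \<subseteq> ?L" if "e \<in> cells P k" for e k
    proof -
      have "inc ` (e \<times> {0<..<1}) \<in> cells D (Suc k)" using that by (simp add: cells_D)
      then show ?thesis by blast
    qed
    have "(\<Union>k. \<Union>e\<in>cells M k. inm ` e) \<subseteq> ?L" "(\<Union>k. \<Union>e\<in>cells N k. inp ` e) \<subseteq> ?L"
      "(\<Union>k. \<Union>e\<in>cells P k. inc ` (e \<times> {0<..<1})) \<subseteq> ?L"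
      by (intro UN_least m n q; assumption)+
    moreover have "inm ` (\<Union>k. \<Union>(cells M k)) = (\<Union>k. \<Union>e\<in>cells M k. inm ` e)"
      "inp ` (\<Union>k. \<Union>(cells N k)) = (\<Union>k. \<Union>e\<in>cells N k. inp ` e)"
      "(\<Union>k. \<Union>(cells P k)) \<times> {0<..<1::real} = (\<Union>k. \<Union>e\<in>cells P k. e \<times> {0<..<1})"
      by blast+
    ultimately show "?R \<subseteq> ?L"
      by (simp only: image_UN Un_least)
  qed
  then show "(\<Union>k. \<Union>(cells D k)) = topspace DX"
    unfolding U [OF M] U [OF N] U [OF P] topspace_DX .
next
  fix k c assume "c \<in> cells D k"
  then show "\<exists>\<phi>. characteristic_map D k c \<phi>"
  proof (cases rule: cells_D_cases)
    case (fm e)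
    then show ?thesis using CW_characteristic_map [OF M fm(1)] characteristic_map_inm by metis
  next
    case (fn e)
    then show ?thesis using CW_characteristic_map [OF N fn(1)] characteristic_map_inp by metis
  next
    case (fp k' e)
    then show ?thesis using CW_characteristic_map [OF P fp(2)] characteristic_map_inc by metis
  qed
qed

end

section \<open>The cellular chains of the double mapping cylinder\<close>

lemma hom_pair:
  assumes G: "comm_group G" and f: "f \<in> hom A G" and g: "g \<in> hom B G"
  shows "(\<lambda>(x, y). f x \<otimes>\<^bsub>G\<^esub> g y) \<in> hom (A \<times>\<times> B) G"
proof -
  interpret comm_group G by fact
  have f': "f x \<in> carrier G" if "x \<in> carrier A" for x using f that by (auto simp: hom_def)
  have g': "g x \<in> carrier G" if "x \<in> carrier B" for x using g that by (auto simp: hom_def)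
  show ?thesis
    using f g by (auto simp: hom_def f' g' m_ac)
qed

context double_mapping_cylinder
begin

abbreviation "CP \<equiv> cellular_chains P"
abbreviation "CM \<equiv> cellular_chains M"
abbreviation "CN \<equiv> cellular_chains N"
abbreviation "CD \<equiv> cellular_chains D"
abbreviation "mcone \<equiv> DMC_cone P M N p r"

lemma inm_skeleton: "inm \<in> skeleton M n \<rightarrow> skeleton D n"
  and inp_skeleton: "inp \<in> skeleton N n \<rightarrow> skeleton D n"
  by (auto simp: skeleton_D)

lemma inm_skel_continuous: "continuous_map (skel_space M n) (skel_space D n) inm"
  using inm_continuous inm_skeleton [of n]
  by (auto simp: continuous_map_in_subtopology continuous_map_from_subtopology)

lemma inp_skel_continuous: "continuous_map (skel_space N n) (skel_space D n) inp"
  using inp_continuous inp_skeleton [of n]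
  by (auto simp: continuous_map_in_subtopology continuous_map_from_subtopology)

lemma inc_skel_continuous: "continuous_map (cylinder (skel_space P (n - 1))) (skel_space D n) inc"
proof -
  have "inc z \<in> skeleton D n" if "z \<in> topspace (cylinder (skel_space P (n - 1)))" for z
    using that inc_skeleton(1) [of "fst z" "n - 1" "snd z"] by auto
  moreover have "continuous_map (cylinder (skel_space P (n - 1))) DX inc"
    unfolding prod_topology_subtopology(1) using inc_continuous by (rule continuous_map_from_subtopology)
  ultimately show ?thesis
    by (simp add: continuous_map_in_subtopology image_subset_iff_funcset [symmetric] image_subset_iff)
qed

lemma inc_cylinder_boundary:
  "inc \<in> cylinder_boundary (skel_space P (n - 1)) (skeleton P (n - 2)) \<rightarrow> skeleton D (n - 1)"
proof
  fix z assume "z \<in> cylinder_boundary (skel_space P (n - 1)) (skeleton P (n - 2))"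
  then obtain x t where z: "z = (x, t)" "x \<in> skeleton P (n - 1)" "t \<in> {0..1}" "t = 0 \<or> t = 1 \<or> x \<in> skeleton P (n - 2)"
    by (auto simp: cylinder_boundary_def)
  then show "inc z \<in> skeleton D (n - 1)"
    using inc_skeleton(2) [OF z(2,3)] inc_skeleton(1) [of x "n - 2" t] by auto
qed

definition base_chain_m :: "int \<Rightarrow> 'b chain set \<Rightarrow> ('b + ('a \<times> real) + 'c) set chain set" where
  "base_chain_m n = hom_induced n (skel_space M n) (skeleton M (n - 1)) (skel_space D n) (skeleton D (n - 1)) inm"

definition base_chain_p :: "int \<Rightarrow> 'c chain set \<Rightarrow> ('b + ('a \<times> real) + 'c) set chain set" where
  "base_chain_p n = hom_induced n (skel_space N n) (skeleton N (n - 1)) (skel_space D n) (skeleton D (n - 1)) inp"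

definition prism_chain :: "int \<Rightarrow> 'a chain set \<Rightarrow> ('b + ('a \<times> real) + 'c) set chain set" where
  "prism_chain n a = hom_induced n (cylinder (skel_space P (n - 1)))
     (cylinder_boundary (skel_space P (n - 1)) (skeleton P (n - 2))) (skel_space D n) (skeleton D (n - 1)) inc
     (susp (n - 1) (skel_space P (n - 1)) (skeleton P (n - 2)) a)"

text \<open>The prism over a chain of \<open>P\<close>, plus the images of chains of the two bases.\<close>

definition cone_map :: "int \<Rightarrow> 'a chain set \<times> 'b chain set \<times> 'c chain set \<Rightarrow> ('b + ('a \<times> real) + 'c) set chain set" where
  "cone_map n = (\<lambda>(a, bc). prism_chain n a \<otimes>\<^bsub>chains CD n\<^esub>
     (case bc of (b, c) \<Rightarrow> base_chain_m n b \<otimes>\<^bsub>chains CD n\<^esub> base_chain_p n c))"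

lemma base_chain_m_hom: "base_chain_m n \<in> hom (chains CM n) (chains CD n)"
  and base_chain_p_hom: "base_chain_p n \<in> hom (chains CN n) (chains CD n)"
  unfolding base_chain_m_def base_chain_p_def cellular_chains_simps by (rule hom_induced_hom)+

lemma prism_chain_hom: "prism_chain n \<in> hom (chains CP (n - 1)) (chains CD n)"
proof -
  have "susp (n - 1) (skel_space P (n - 1)) (skeleton P (n - 2)) \<in> hom (chains CP (n - 1))
     (relative_homology_group n (cylinder (skel_space P (n - 1))) (cylinder_boundary (skel_space P (n - 1)) (skeleton P (n - 2))))"
    using susp_hom [of "n - 1" "skel_space P (n - 1)" "skeleton P (n - 2)"] by (simp add: cellular_chains_simps)
  from hom_compose [OF this hom_induced_hom] show ?thesis
    unfolding prism_chain_def [abs_def] cellular_chains_simps comp_def .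
qed

lemma chains_comm: "comm_group (chains (cellular_chains Y) n)"
  by (simp add: cellular_chains_simps)

lemma chains_cone: "chains mcone n = chains CP (n - 1) \<times>\<times> (chains CM n \<times>\<times> chains CN n)"
  by (simp add: DMC_cone_def Cone_def direct_sum_complex_def)

lemma boundary_cone:
  "boundary mcone n (a, b, c) = (inv\<^bsub>chains CP (n - 2)\<^esub> (boundary CP (n - 1) a),
     cellular_chain_map P M p (n - 1) a \<otimes>\<^bsub>chains CM (n - 1)\<^esub> boundary CM n b,
     inv\<^bsub>chains CN (n - 1)\<^esub> (cellular_chain_map P N r (n - 1) a) \<otimes>\<^bsub>chains CN (n - 1)\<^esub> boundary CN n c)"
  by (simp add: DMC_cone_def Cone_def direct_sum_complex_def difference_chain_map_def)

lemma cone_comm: "comm_group (chains mcone n)"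
  unfolding chains_cone by (intro DirProd_comm_group chains_comm)

lemma cone_map_hom: "cone_map n \<in> hom (chains mcone n) (chains CD n)"
  unfolding cone_map_def chains_cone
  by (intro hom_pair chains_comm prism_chain_hom base_chain_m_hom base_chain_p_hom)

lemma cellular_chain_map_hom: "cellular_chain_map Y Z f n \<in> hom (chains (cellular_chains Y) n) (chains (cellular_chains Z) n)"
  unfolding cellular_chain_map_def cellular_chains_simps by (rule hom_induced_hom)

lemma boundary_closed:
  "x \<in> carrier (chains (cellular_chains Y) n) \<Longrightarrow> boundary (cellular_chains Y) n x \<in> carrier (chains (cellular_chains Y) (n - 1))"
  using cellular_boundary_hom [of Y n] by (auto simp: hom_def)

lemma chain_map_closed:
  "x \<in> carrier (chains (cellular_chains Y) n) \<Longrightarrow> cellular_chain_map Y Z f n x \<in> carrier (chains (cellular_chains Z) n)"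
  using cellular_chain_map_hom [of Y Z f n] by (auto simp: hom_def)

lemma cone_boundary_closed:
  assumes "x \<in> carrier (chains mcone n)"
  shows "boundary mcone n x \<in> carrier (chains mcone (n - 1))"
proof -
  obtain a b c where x: "x = (a, b, c)" by (cases x)
  have abc: "a \<in> carrier (chains CP (n - 1))" "b \<in> carrier (chains CM n)" "c \<in> carrier (chains CN n)"
    using assms unfolding chains_cone x by auto
  have grp: "group (chains (cellular_chains Y) k)" for Y :: "'x cell_complex" and k
    by (simp add: cellular_chains_simps)
  have "boundary CP (n - 1) a \<in> carrier (chains CP (n - 2))"
    using boundary_closed [OF abc(1)] by simp
  then show ?thesis
    unfolding chains_cone x boundary_cone
    using abc
    by (auto intro!: group.inv_closed [OF grp] monoid.m_closed [OF group.is_monoid [OF grp]]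
        boundary_closed chain_map_closed)
qed

subsection \<open>Compatibility with the boundary maps\<close>

lemma base_chain_m_boundary: "boundary CD n (base_chain_m n b) = base_chain_m (n - 1) (boundary CM n b)"
  using naturality_hom_induced_relboundary [OF inm_skel_continuous inm_skeleton [of "n - 1"] inm_skeleton [of "n - 2"], of n n]
  by (simp add: fun_eq_iff base_chain_m_def cellular_chains_simps skel_space_subspace)

lemma base_chain_p_boundary: "boundary CD n (base_chain_p n b) = base_chain_p (n - 1) (boundary CN n b)"
  using naturality_hom_induced_relboundary [OF inp_skel_continuous inp_skeleton [of "n - 1"] inp_skeleton [of "n - 2"], of n n]
  by (simp add: fun_eq_iff base_chain_p_def cellular_chains_simps skel_space_subspace)

text \<open>The image of \<open>hom_relboundary_susp\<close> under the quotient map, which on the bottom and the top of the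
  cylinder is given by the two maps.\<close>

lemma prism_chain_boundary:
  assumes a: "a \<in> carrier (chains CP (n - 1))"
  shows "boundary CD n (prism_chain n a) =
    (base_chain_m (n - 1) (cellular_chain_map P M p (n - 1) a)
      \<otimes>\<^bsub>chains CD (n - 1)\<^esub> inv\<^bsub>chains CD (n - 1)\<^esub> (base_chain_p (n - 1) (cellular_chain_map P N r (n - 1) a)))
    \<otimes>\<^bsub>chains CD (n - 1)\<^esub> inv\<^bsub>chains CD (n - 1)\<^esub> (prism_chain (n - 1) (boundary CP (n - 1) a))"
proof -
  let ?X = "skel_space P (n - 1)" and ?A = "skeleton P (n - 2)" and ?B = "skeleton P (n - 3)"
  let ?D = "skel_space D (n - 1)" and ?E = "skeleton D (n - 2)"
  define W where "W = subtopology (cylinder ?X) (cylinder_boundary ?X ?A)"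
  define T where "T = cylinder_boundary (subtopology ?X ?A) ?B"
  have XA: "subtopology ?X ?A = skel_space P (n - 2)"
    by (rule skel_space_subspace) simp
  have T: "T = cylinder_boundary (skel_space P (n - 2)) ?B"
    unfolding T_def XA ..
  have a': "a \<in> carrier (relative_homology_group (n - 1) ?X ?A)"
    using a by (simp add: cellular_chains_simps)
  have incT: "inc \<in> T \<rightarrow> ?E"
    unfolding T using inc_cylinder_boundary [of "n - 1"] by simp
  have incW: "continuous_map W ?D inc"
  proof -
    have "continuous_map W DX inc"
      unfolding W_def using inc_skel_continuous [of n]
      by (auto simp: continuous_map_in_subtopology intro: continuous_map_from_subtopology)
    then show ?thesis
      using inc_cylinder_boundary [of n] unfolding W_def by (auto simp: continuous_map_in_subtopology)
  qed
  define K where "K = hom_induced (n - 1) W T ?D ?E inc"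
  interpret K: group_hom "relative_homology_group (n - 1) W T" "chains CD (n - 1)" K
    unfolding K_def group_hom_def group_hom_axioms_def
    using hom_induced_hom [of "n - 1" W T ?D ?E inc] by (simp add: cellular_chains_simps)
  have DD: "subtopology (skel_space D n) (skeleton D (n - 1)) = ?D"
    by (rule skel_space_subspace) simp
  have "boundary CD n (prism_chain n a) =
      K (hom_relboundary n (cylinder ?X) (cylinder_boundary ?X ?A) T (susp (n - 1) ?X ?A a))"
    using naturality_hom_induced_relboundary [OF inc_skel_continuous [of n] inc_cylinder_boundary [of n] incT, of n]
    unfolding DD W_def [symmetric]
    by (simp add: fun_eq_iff prism_chain_def cellular_chains_simps K_def)
  also have "hom_relboundary n (cylinder ?X) (cylinder_boundary ?X ?A) T (susp (n - 1) ?X ?A a) =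
     (hom_induced (n - 1) ?X ?A W T (\<lambda>x. (x, 0)) a
      \<otimes>\<^bsub>relative_homology_group (n - 1) W T\<^esub>
      inv\<^bsub>relative_homology_group (n - 1) W T\<^esub> (hom_induced (n - 1) ?X ?A W T (\<lambda>x. (x, 1)) a))
    \<otimes>\<^bsub>relative_homology_group (n - 1) W T\<^esub>
      inv\<^bsub>relative_homology_group (n - 1) W T\<^esub>
        (hom_induced (n - 1) (cylinder (subtopology ?X ?A)) T W T id
          (susp (n - 1 - 1) (subtopology ?X ?A) ?B (hom_relboundary (n - 1) ?X ?A ?B a)))"
    using hom_relboundary_susp [OF _ _ a', of ?B, folded W_def T_def] skeleton_mono [of "n - 3" "n - 2" P]
      skeleton_mono [of "n - 2" "n - 1" P] CW_skeleton_subset [OF P, of "n - 1"]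
    by auto
  also have "K \<dots> = (K (hom_induced (n - 1) ?X ?A W T (\<lambda>x. (x, 0)) a)
      \<otimes>\<^bsub>chains CD (n - 1)\<^esub> inv\<^bsub>chains CD (n - 1)\<^esub> K (hom_induced (n - 1) ?X ?A W T (\<lambda>x. (x, 1)) a))
    \<otimes>\<^bsub>chains CD (n - 1)\<^esub> inv\<^bsub>chains CD (n - 1)\<^esub>
      K (hom_induced (n - 1) (cylinder (subtopology ?X ?A)) T W T id
          (susp (n - 1 - 1) (subtopology ?X ?A) ?B (hom_relboundary (n - 1) ?X ?A ?B a)))"
    by (simp add: hom_induced_carrier)
  also have "K (hom_induced (n - 1) ?X ?A W T (\<lambda>x. (x, 0)) a) = base_chain_m (n - 1) (cellular_chain_map P M p (n - 1) a)"
  proof -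
    have i: "continuous_map ?X W (\<lambda>x. (x, 0))" "(\<lambda>x. (x, 0)) \<in> ?A \<rightarrow> T"
    proof -
      show "continuous_map ?X W (\<lambda>x. (x, 0))" unfolding W_def by (rule continuous_map_cylinder_boundary(1))
    qed (use CW_skeleton_subset [OF P] in \<open>auto simp: T cylinder_boundary_def\<close>)
    have p': "continuous_map ?X (skel_space M (n - 1)) p" "p \<in> ?A \<rightarrow> skeleton M (n - 2)"
      using p_continuous p_skeleton by (auto simp: continuous_map_in_subtopology continuous_map_from_subtopology)
    have "K (hom_induced (n - 1) ?X ?A W T (\<lambda>x. (x, 0)) a) = hom_induced (n - 1) ?X ?A ?D ?E (inc \<circ> (\<lambda>x. (x, 0))) a"
      unfolding K_def by (rule hom_induced_compose' [OF i incW incT])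
    also have "\<dots> = hom_induced (n - 1) ?X ?A ?D ?E (inm \<circ> p) a"
      by (rule arg_cong [OF hom_induced_eq, of _ _ _ "\<lambda>f. f a"]) (simp add: inc_0)
    also have "\<dots> = base_chain_m (n - 1) (cellular_chain_map P M p (n - 1) a)"
      using hom_induced_compose' [OF p' inm_skel_continuous inm_skeleton, of "n - 1" a]
      by (simp add: base_chain_m_def cellular_chain_map_def)
    finally show ?thesis .
  qed
  also have "K (hom_induced (n - 1) ?X ?A W T (\<lambda>x. (x, 1)) a) = base_chain_p (n - 1) (cellular_chain_map P N r (n - 1) a)"
  proof -
    have i: "continuous_map ?X W (\<lambda>x. (x, 1))" "(\<lambda>x. (x, 1)) \<in> ?A \<rightarrow> T"
    proof -
      show "continuous_map ?X W (\<lambda>x. (x, 1))" unfolding W_def by (rule continuous_map_cylinder_boundary(2))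
    qed (use CW_skeleton_subset [OF P] in \<open>auto simp: T cylinder_boundary_def\<close>)
    have r': "continuous_map ?X (skel_space N (n - 1)) r" "r \<in> ?A \<rightarrow> skeleton N (n - 2)"
      using r_continuous r_skeleton by (auto simp: continuous_map_in_subtopology continuous_map_from_subtopology)
    have "K (hom_induced (n - 1) ?X ?A W T (\<lambda>x. (x, 1)) a) = hom_induced (n - 1) ?X ?A ?D ?E (inc \<circ> (\<lambda>x. (x, 1))) a"
      unfolding K_def by (rule hom_induced_compose' [OF i incW incT])
    also have "\<dots> = hom_induced (n - 1) ?X ?A ?D ?E (inp \<circ> r) a"
      by (rule arg_cong [OF hom_induced_eq, of _ _ _ "\<lambda>f. f a"]) (simp add: inc_1)
    also have "\<dots> = base_chain_p (n - 1) (cellular_chain_map P N r (n - 1) a)"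
      using hom_induced_compose' [OF r' inp_skel_continuous inp_skeleton, of "n - 1" a]
      by (simp add: base_chain_p_def cellular_chain_map_def)
    finally show ?thesis .
  qed
  also have "K (hom_induced (n - 1) (cylinder (subtopology ?X ?A)) T W T id
          (susp (n - 1 - 1) (subtopology ?X ?A) ?B (hom_relboundary (n - 1) ?X ?A ?B a))) = prism_chain (n - 1) (boundary CP (n - 1) a)"
  proof -
    have i: "continuous_map (cylinder (subtopology ?X ?A)) W id" "id \<in> T \<rightarrow> T"
      unfolding W_def using continuous_map_cylinder_boundary(3) by auto
    show ?thesis
      unfolding K_def hom_induced_compose' [OF i incW incT]
      by (simp add: prism_chain_def cellular_chains_simps XA T)
  qed
  finally show ?thesis .
qed

lemma cone_map_boundary:
  assumes x: "x \<in> carrier (chains mcone n)"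
  shows "cone_map (n - 1) (boundary mcone n x) = boundary CD n (cone_map n x)"
proof -
  obtain a b c where x': "x = (a, b, c)" by (cases x)
  have abc: "a \<in> carrier (chains CP (n - 1))" "b \<in> carrier (chains CM n)" "c \<in> carrier (chains CN n)"
    using x unfolding chains_cone x' by auto
  let ?G = "chains CD (n - 1)"
  have grp: "group (chains (cellular_chains Y) k)" for Y :: "'x cell_complex" and k
    by (simp add: cellular_chains_simps)
  interpret G: comm_group ?G by (rule chains_comm)
  interpret m: group_hom "chains CM (n - 1)" ?G "base_chain_m (n - 1)"
    by (simp add: group_hom_def group_hom_axioms_def grp base_chain_m_hom)
  interpret np: group_hom "chains CN (n - 1)" ?G "base_chain_p (n - 1)"
    by (simp add: group_hom_def group_hom_axioms_def grp base_chain_p_hom)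
  interpret s: group_hom "chains CP (n - 2)" ?G "prism_chain (n - 1)"
    using prism_chain_hom [of "n - 1"] by (simp add: group_hom_def group_hom_axioms_def grp)
  interpret d: group_hom "chains CD n" ?G "boundary CD n"
    by (simp add: group_hom_def group_hom_axioms_def grp cellular_boundary_hom)
  have da: "boundary CP (n - 1) a \<in> carrier (chains CP (n - 2))"
    using boundary_closed [OF abc(1)] by simp
  have car: "prism_chain n a \<in> carrier (chains CD n)" "base_chain_m n b \<in> carrier (chains CD n)" "base_chain_p n c \<in> carrier (chains CD n)"
    using prism_chain_hom [of n] base_chain_m_hom [of n] base_chain_p_hom [of n] abc by (auto simp: hom_def)
  note cl = da boundary_closed [OF abc(2)] boundary_closed [OF abc(3)] chain_map_closed [OF abc(1)]
  have comm: "inv\<^bsub>?G\<^esub> s \<otimes>\<^bsub>?G\<^esub> ((u \<otimes>\<^bsub>?G\<^esub> b') \<otimes>\<^bsub>?G\<^esub> (inv\<^bsub>?G\<^esub> v \<otimes>\<^bsub>?G\<^esub> c')) =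
     ((u \<otimes>\<^bsub>?G\<^esub> inv\<^bsub>?G\<^esub> v) \<otimes>\<^bsub>?G\<^esub> inv\<^bsub>?G\<^esub> s) \<otimes>\<^bsub>?G\<^esub> (b' \<otimes>\<^bsub>?G\<^esub> c')"
    if "s \<in> carrier ?G" "u \<in> carrier ?G" "v \<in> carrier ?G" "b' \<in> carrier ?G" "c' \<in> carrier ?G" for s u v b' c'
    using that by (simp add: G.m_ac)
  have "cone_map (n - 1) (boundary mcone n x) =
    inv\<^bsub>?G\<^esub> prism_chain (n - 1) (boundary CP (n - 1) a) \<otimes>\<^bsub>?G\<^esub>
      ((base_chain_m (n - 1) (cellular_chain_map P M p (n - 1) a) \<otimes>\<^bsub>?G\<^esub> base_chain_m (n - 1) (boundary CM n b)) \<otimes>\<^bsub>?G\<^esub>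
       (inv\<^bsub>?G\<^esub> base_chain_p (n - 1) (cellular_chain_map P N r (n - 1) a) \<otimes>\<^bsub>?G\<^esub> base_chain_p (n - 1) (boundary CN n c)))"
    unfolding x' boundary_cone cone_map_def by (simp add: cl)
  also have "\<dots> = ((base_chain_m (n - 1) (cellular_chain_map P M p (n - 1) a) \<otimes>\<^bsub>?G\<^esub>
        inv\<^bsub>?G\<^esub> base_chain_p (n - 1) (cellular_chain_map P N r (n - 1) a)) \<otimes>\<^bsub>?G\<^esub>
        inv\<^bsub>?G\<^esub> prism_chain (n - 1) (boundary CP (n - 1) a)) \<otimes>\<^bsub>?G\<^esub>
      (base_chain_m (n - 1) (boundary CM n b) \<otimes>\<^bsub>?G\<^esub> base_chain_p (n - 1) (boundary CN n c))"
    by (rule comm) (simp_all add: cl)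
  also have "\<dots> = boundary CD n (prism_chain n a) \<otimes>\<^bsub>?G\<^esub> (boundary CD n (base_chain_m n b) \<otimes>\<^bsub>?G\<^esub> boundary CD n (base_chain_p n c))"
    unfolding prism_chain_boundary [OF abc(1)] base_chain_m_boundary base_chain_p_boundary ..
  also have "\<dots> = boundary CD n (cone_map n x)"
    unfolding x' cone_map_def using car by simp
  finally show ?thesis .
qed

subsection \<open>Bases\<close>

definition cells_m :: "nat \<Rightarrow> ('b + ('a \<times> real) + 'c) set set set" where
  "cells_m n = (\<lambda>e. inm ` e) ` cells M n"
definition cells_p :: "nat \<Rightarrow> ('b + ('a \<times> real) + 'c) set set set" where
  "cells_p n = (\<lambda>e. inp ` e) ` cells N n"
definition cells_c :: "nat \<Rightarrow> ('b + ('a \<times> real) + 'c) set set set" where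
  "cells_c n = (case n of 0 \<Rightarrow> {} | Suc k \<Rightarrow> (\<lambda>e. inc ` (e \<times> {0<..<1})) ` cells P k)"

lemma cells_D_split: "cells D n = cells_c n \<union> (cells_m n \<union> cells_p n)"
  unfolding cells_D cells_m_def cells_p_def cells_c_def by blast

lemma inj_cells:
  "inj_on (\<lambda>e. inm ` e) A" "inj_on (\<lambda>e. inp ` e) B" "inj_on (\<lambda>e. inc ` (e \<times> {0<..<1})) C"
proof -
  have "inj inm" "inj inp" by (auto simp: inj_def)
  then show "inj_on (\<lambda>e. inm ` e) A" "inj_on (\<lambda>e. inp ` e) B"
    by (auto simp: inj_on_def inj_image_eq_iff)
  have iff: "x \<in> e \<longleftrightarrow> inc (x, 1/2) \<in> inc ` (e \<times> {0<..<1})" for x e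
    using inc_eq_iff [of "1/2"] by force
  show "inj_on (\<lambda>e. inc ` (e \<times> {0<..<1})) C"
  proof (intro inj_onI)
    fix e e' assume eq: "inc ` (e \<times> {0<..<1}) = inc ` (e' \<times> {0<..<1})"
    have "x \<in> e \<longleftrightarrow> x \<in> e'" for x
      using iff [of x e] iff [of x e'] unfolding eq by blast
    then show "e = e'" by (rule Set.set_eqI)
  qed
qed

lemma cells_disjoint: "cells_c n \<inter> (cells_m n \<union> cells_p n) = {}" "cells_m n \<inter> cells_p n = {}"
proof -
  have ne: "c \<noteq> {}" if "c \<in> cells D n" for c
    using CW_cell_nonempty [OF finite_CW_D that] .
  have "c \<inter> c' = {}" if c: "c \<in> cells_c n" and c': "c' \<in> cells_m n \<union> cells_p n" for c c'
  proof -
    obtain e where e: "c = inc ` (e \<times> {0<..<1})" using c by (auto simp: cells_c_def split: nat.splits)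
    from c' consider e' where "c' = inm ` e'" | e' where "c' = inp ` e'"
      by (auto simp: cells_m_def cells_p_def)
    then show ?thesis unfolding e by cases (simp_all only: image_disjoint)
  qed
  then show "cells_c n \<inter> (cells_m n \<union> cells_p n) = {}"
    using ne unfolding cells_D_split by blast
  have "c \<inter> c' = {}" if c: "c \<in> cells_m n" and c': "c' \<in> cells_p n" for c c'
  proof -
    obtain e e' where "c = inm ` e" "c' = inp ` e'"
      using c c' by (auto simp: cells_m_def cells_p_def)
    then show ?thesis by (simp only: image_disjoint)
  qed
  then show "cells_m n \<inter> cells_p n = {}"
    using ne unfolding cells_D_split by blast
qed

lemma card_cells_D:
  "card (cells D n) = card (cells M n) + card (cells N n) + (case n of 0 \<Rightarrow> 0 | Suc k \<Rightarrow> card (cells P k))"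
proof -
  have fin: "finite (cells_c n)" "finite (cells_m n)" "finite (cells_p n)"
    using CW_finite_cells [OF finite_CW_D, of n] unfolding cells_D_split by auto
  have "card (cells_m n) = card (cells M n)" "card (cells_p n) = card (cells N n)"
    "card (cells_c n) = (case n of 0 \<Rightarrow> 0 | Suc k \<Rightarrow> card (cells P k))"
    unfolding cells_m_def cells_p_def cells_c_def by (auto simp: card_image inj_cells split: nat.split)
  then show ?thesis
    unfolding cells_D_split using fin cells_disjoint [of n] by (simp add: card_Un_disjoint)
qed

text \<open>The generator for the \<open>(k + 1)\<close>-disc is by definition the suspension of the one for the \<open>k\<close>-disc, and
  suspension is natural for characteristic maps; hence basis elements of \<open>P\<close> turn into basis elements
  for the prism cells.\<close>

lemma prism_chain_disc:
  assumes e: "e \<in> cells P k" and \<phi>: "characteristic_map P k e \<phi>"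
  shows "prism_chain (int (Suc k))
      (cell_chain P k \<phi>) =
    hom_induced (int (Suc k)) (closed_disc (Suc k)) (disc_boundary (Suc k)) (skel_space D (int (Suc k))) (skeleton D (int k))
      (inc \<circ> map_prod \<phi> id \<circ> disc_to_cylinder k) (disc_class (Suc k))"
proof -
  let ?X = "skel_space P (int k)" and ?A = "skeleton P (int k - 1)"
  let ?C = "closed_disc k" and ?S = "disc_boundary k"
  let ?D = "skel_space D (int (Suc k))" and ?E = "skeleton D (int k)"
  have \<phi>': "continuous_map ?C ?X \<phi>" "\<phi> \<in> ?S \<rightarrow> ?A"
    using \<phi> characteristic_map_closed_image(2) [OF P e \<phi>]
    by (auto simp: characteristic_map_def continuous_map_in_subtopology)
  have inc': "continuous_map (cylinder ?X) ?D inc" "inc \<in> cylinder_boundary ?X ?A \<rightarrow> ?E"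
    using inc_skel_continuous [of "int (Suc k)"] inc_cylinder_boundary [of "int (Suc k)"] by simp_all
  have prod: "continuous_map (cylinder ?C) (cylinder ?X) (map_prod \<phi> id)" "map_prod \<phi> id \<in> cylinder_boundary ?C ?S \<rightarrow> cylinder_boundary ?X ?A"
    using continuous_map_cylinder [OF \<phi>'(1)] map_prod_cylinder_boundary [OF \<phi>'] by auto
  have dc: "disc_class k \<in> carrier (relative_homology_group (int k) ?C ?S)"
    using is_basis_closed [OF conjunct1 [OF disc_homology [of k "()"]]] by simp
  let ?s = "susp (int k) ?C ?S (disc_class k)"
  have "prism_chain (int (Suc k)) (hom_induced (int k) ?C ?S ?X ?A \<phi> (disc_class k)) =
     hom_induced (int k + 1) (cylinder ?X) (cylinder_boundary ?X ?A) ?D ?E inc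
       (susp (int k) ?X ?A (hom_induced (int k) ?C ?S ?X ?A \<phi> (disc_class k)))"
    by (simp add: prism_chain_def add.commute)
  also have "\<dots> = hom_induced (int k + 1) (cylinder ?X) (cylinder_boundary ?X ?A) ?D ?E inc
      (hom_induced (int k + 1) (cylinder ?C) (cylinder_boundary ?C ?S) (cylinder ?X) (cylinder_boundary ?X ?A) (map_prod \<phi> id) ?s)"
    by (simp only: susp_natural [OF \<phi>' dc])
  also have "\<dots> = hom_induced (int k + 1) (cylinder ?C) (cylinder_boundary ?C ?S) ?D ?E (inc \<circ> map_prod \<phi> id) ?s"
    by (rule hom_induced_compose' [OF prod inc'])
  also have "\<dots> = hom_induced (int k + 1) (cylinder ?C) (cylinder_boundary ?C ?S) ?D ?E
      ((inc \<circ> map_prod \<phi> id \<circ> disc_to_cylinder k) \<circ> cylinder_to_disc k) ?s"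
    by (rule arg_cong [OF hom_induced_eq, of _ _ _ "\<lambda>f. f ?s"]) (auto simp: disc_to_cylinder(1))
  also have "\<dots> = hom_induced (int k + 1) (closed_disc (Suc k)) (disc_boundary (Suc k)) ?D ?E
      (inc \<circ> map_prod \<phi> id \<circ> disc_to_cylinder k) (disc_class (Suc k))"
  proof -
    have 1: "continuous_map (cylinder ?C) (closed_disc (Suc k)) (cylinder_to_disc k)"
      by (rule homeomorphic_imp_continuous_map [OF cylinder_to_disc(1)])
    have 2: "cylinder_to_disc k \<in> cylinder_boundary ?C ?S \<rightarrow> disc_boundary (Suc k)"
      using cylinder_to_disc(2) by blast
    have char: "characteristic_map D (Suc k) (inc ` (e \<times> {0<..<1})) (inc \<circ> map_prod \<phi> id \<circ> disc_to_cylinder k)"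
      by (rule characteristic_map_inc [OF e \<phi>])
    have 3: "continuous_map (closed_disc (Suc k)) ?D (inc \<circ> map_prod \<phi> id \<circ> disc_to_cylinder k)"
      by (intro continuous_map_compose [OF disc_to_cylinder(4)] continuous_map_compose [OF prod(1) inc'(1)])
    have 4: "inc \<circ> map_prod \<phi> id \<circ> disc_to_cylinder k \<in> disc_boundary (Suc k) \<rightarrow> ?E"
      using char by (auto simp: characteristic_map_def)
    show ?thesis
      unfolding disc_class.simps(2) hom_induced_compose' [OF 1 2 3 4] ..
  qed
  finally show ?thesis by (simp add: add.commute)
qed

text \<open>The basis of the cone is reindexed by the cells of the double mapping cylinder; \<open>fm\<close>, \<open>fp\<close> and \<open>fc\<close>
  recover the cell of \<open>M\<close>, \<open>N\<close> or \<open>P\<close> from which a cell comes. As there are no prism cells for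
  \<open>n = 0\<close>, the truncated difference \<open>n - 1\<close> does no harm.\<close>

lemma cone_map_basis:
  obtains b where "is_basis (chains mcone (int n)) (cells D n) b" "cone_map (int n) \<in> iso (chains mcone (int n)) (chains CD (int n))"
proof -
  have "\<forall>e\<in>cells M n. \<exists>\<phi>. characteristic_map M n e \<phi>" "\<forall>e\<in>cells N n. \<exists>\<phi>. characteristic_map N n e \<phi>"
    "\<forall>e\<in>cells P (n - 1). \<exists>\<phi>. characteristic_map P (n - 1) e \<phi>"
    using M N P by (simp_all add: finite_CW_def)
  then obtain \<phi>m \<phi>p \<phi>c where \<phi>m: "\<And>e. e \<in> cells M n \<Longrightarrow> characteristic_map M n e (\<phi>m e)"
    and \<phi>p: "\<And>e. e \<in> cells N n \<Longrightarrow> characteristic_map N n e (\<phi>p e)"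
    and \<phi>c: "\<And>e. e \<in> cells P (n - 1) \<Longrightarrow> characteristic_map P (n - 1) e (\<phi>c e)"
    unfolding bchoice_iff by blast
  define fm where "fm = inv_into (cells M n) (\<lambda>e. inm ` e)"
  define fp where "fp = inv_into (cells N n) (\<lambda>e. inp ` e)"
  define fc where "fc = inv_into (cells P (n - 1)) (\<lambda>e. inc ` (e \<times> {0<..<1}))"
  have fm: "bij_betw fm (cells_m n) (cells M n)" and fp: "bij_betw fp (cells_p n) (cells N n)"
    unfolding fm_def fp_def cells_m_def cells_p_def by (intro bij_betw_inv_into inj_on_imp_bij_betw inj_cells)+
  have fc: "bij_betw fc (cells_c n) (cells P (n - 1))" if "n > 0"
  proof -
    have "cells_c n = (\<lambda>e. inc ` (e \<times> {0<..<1})) ` cells P (n - 1)"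
      using that by (cases n) (auto simp: cells_c_def)
    then show ?thesis
      unfolding fc_def by (simp only:) (intro bij_betw_inv_into inj_on_imp_bij_betw inj_cells)
  qed
  have fm': "c = inm ` fm c" "fm c \<in> cells M n" if "c \<in> cells_m n" for c
    using that unfolding fm_def cells_m_def by (auto simp: f_inv_into_f [symmetric] inv_into_into)
  have fp': "c = inp ` fp c" "fp c \<in> cells N n" if "c \<in> cells_p n" for c
    using that unfolding fp_def cells_p_def by (auto simp: f_inv_into_f [symmetric] inv_into_into)
  have fc': "n > 0" "c = inc ` (fc c \<times> {0<..<1})" "fc c \<in> cells P (n - 1)" if "c \<in> cells_c n" for c
  proof -
    show "n > 0" using that by (cases n) (auto simp: cells_c_def)
    then have c: "c \<in> (\<lambda>e. inc ` (e \<times> {0<..<1})) ` cells P (n - 1)"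
      using that by (cases n) (auto simp: cells_c_def)
    show "c = inc ` (fc c \<times> {0<..<1})"
      using f_inv_into_f [OF c] unfolding fc_def by simp
    show "fc c \<in> cells P (n - 1)"
      using inv_into_into [OF c] unfolding fc_def .
  qed
  define bm where "bm c = cell_chain M n (\<phi>m (fm c))" for c
  define bp where "bp c = cell_chain N n (\<phi>p (fp c))" for c
  define bc where "bc c = cell_chain P (n - 1) (\<phi>c (fc c))" for c
  have bm: "is_basis (chains CM (int n)) (cells_m n) bm"
    unfolding bm_def [abs_def] cellular_chains_simps
    by (rule is_basis_reindex [OF _ cellular_basis(1) [OF M \<phi>m] fm]) simp_all
  have bp: "is_basis (chains CN (int n)) (cells_p n) bp"
    unfolding bp_def [abs_def] cellular_chains_simps
    by (rule is_basis_reindex [OF _ cellular_basis(1) [OF N \<phi>p] fp]) simp_all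
  have bc: "is_basis (chains CP (int n - 1)) (cells_c n) bc"
  proof (cases "n > 0")
    case True
    then have eq: "int n - 1 = int (n - 1)" by linarith
    show ?thesis
      unfolding bc_def [abs_def] cellular_chains_simps eq
      by (rule is_basis_reindex [OF _ cellular_basis(1) [OF P \<phi>c] fc [OF True]]) simp_all
  next
    case False
    then show ?thesis by (simp add: cells_c_def cellular_chains_simps is_basis_empty)
  qed
  note bmp = is_basis_DirProd [OF chains_comm chains_comm bm bp cells_disjoint(2)]
  note b = is_basis_DirProd [OF chains_comm DirProd_comm_group [OF chains_comm chains_comm] bc bmp cells_disjoint(1),
      folded cells_D_split chains_cone]
  let ?b = "\<lambda>c. if c \<in> cells_c n then (bc c, \<one>\<^bsub>chains CM (int n) \<times>\<times> chains CN (int n)\<^esub>)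
     else (\<one>\<^bsub>chains CP (int n - 1)\<^esub>, if c \<in> cells_m n then (bm c, \<one>\<^bsub>chains CN (int n)\<^esub>) else (\<one>\<^bsub>chains CM (int n)\<^esub>, bp c))"
  define \<psi> where "\<psi> c = (if c \<in> cells_c n then inc \<circ> map_prod (\<phi>c (fc c)) id \<circ> disc_to_cylinder (n - 1)
     else if c \<in> cells_m n then inm \<circ> \<phi>m (fm c) else inp \<circ> \<phi>p (fp c))" for c
  have \<psi>: "characteristic_map D n c (\<psi> c)" if "c \<in> cells D n" for c
  proof -
    consider "c \<in> cells_c n" | "c \<in> cells_m n" "c \<notin> cells_c n" | "c \<in> cells_p n" "c \<notin> cells_c n" "c \<notin> cells_m n"
      using \<open>c \<in> cells D n\<close> cells_disjoint [of n] unfolding cells_D_split by blast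
    then show ?thesis
    proof cases
      case 1
      have "Suc (n - 1) = n" using fc'(1) [OF 1] by simp
      then show ?thesis
        using characteristic_map_inc [OF fc'(3) [OF 1] \<phi>c [OF fc'(3) [OF 1]]] fc'(2) [OF 1] 1 by (simp add: \<psi>_def)
    next
      case 2
      then show ?thesis
        using characteristic_map_inm [OF fm'(2) [OF 2(1)] \<phi>m [OF fm'(2) [OF 2(1)]]] fm'(1) [OF 2(1)] by (simp add: \<psi>_def)
    next
      case 3
      then show ?thesis
        using characteristic_map_inp [OF fp'(2) [OF 3(1)] \<phi>p [OF fp'(2) [OF 3(1)]]] fp'(1) [OF 3(1)] by (simp add: \<psi>_def)
    qed
  qed
  note bD = cellular_basis(1) [OF finite_CW_D \<psi>, folded cellular_chains_simps(1)]
  have "cone_map (int n) \<in> iso (chains mcone (int n)) (chains CD (int n))"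
  proof (rule hom_basis_iso [OF _ _ b bD cone_map_hom])
    show "group (chains mcone (int n))" using cone_comm by (rule comm_group.axioms(2))
    show grpD: "group (chains CD (int n))" by (simp add: cellular_chains_simps)
    interpret G: comm_group "chains CD (int n)" by (rule chains_comm)
    have one: "base_chain_m (int n) \<one>\<^bsub>chains CM (int n)\<^esub> = \<one>\<^bsub>chains CD (int n)\<^esub>"
      "base_chain_p (int n) \<one>\<^bsub>chains CN (int n)\<^esub> = \<one>\<^bsub>chains CD (int n)\<^esub>"
      "prism_chain (int n) \<one>\<^bsub>chains CP (int n - 1)\<^esub> = \<one>\<^bsub>chains CD (int n)\<^esub>"
      using hom_one [OF base_chain_m_hom] hom_one [OF base_chain_p_hom] hom_one [OF prism_chain_hom]
      by (simp_all only: cellular_chains_simps(1) group_relative_homology_group simp_thms)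
    fix c assume c: "c \<in> cells D n"
    let ?r = "cell_chain D n (\<psi> c)"
    have rc: "?r \<in> carrier (chains CD (int n))"
      unfolding cellular_chains_simps by (rule hom_induced_carrier)
    consider "c \<in> cells_c n" | "c \<in> cells_m n" "c \<notin> cells_c n" | "c \<in> cells_p n" "c \<notin> cells_c n" "c \<notin> cells_m n"
      using c cells_disjoint [of n] unfolding cells_D_split by blast
    then show "cone_map (int n) (?b c) = ?r"
    proof cases
      case 1
      obtain k where n: "n = Suc k" using fc'(1) [OF 1] by (cases n) auto
      have "fc c \<in> cells P k" using fc'(3) [OF 1] n by simp
      then have "prism_chain (int n) (bc c) = ?r"
        using prism_chain_disc [of "fc c" k "\<phi>c (fc c)"] \<phi>c [of "fc c"] 1 by (simp add: n bc_def \<psi>_def)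
      then show ?thesis using 1 rc by (simp add: cone_map_def one)
    next
      case 2
      note e = fm'(2) [OF 2(1)]
      have "continuous_map (closed_disc n) (skel_space M (int n)) (\<phi>m (fm c))" "\<phi>m (fm c) \<in> disc_boundary n \<rightarrow> skeleton M (int n - 1)"
        using \<phi>m [OF e] characteristic_map_closed_image(2) [OF M e \<phi>m [OF e]]
        by (auto simp: characteristic_map_def continuous_map_in_subtopology)
      from hom_induced_compose' [OF this inm_skel_continuous inm_skeleton]
      have "base_chain_m (int n) (bm c) = ?r"
        using 2 by (simp add: base_chain_m_def bm_def \<psi>_def)
      then show ?thesis using 2 rc by (simp add: cone_map_def one)
    next
      case 3
      note e = fp'(2) [OF 3(1)]
      have "continuous_map (closed_disc n) (skel_space N (int n)) (\<phi>p (fp c))" "\<phi>p (fp c) \<in> disc_boundary n \<rightarrow> skeleton N (int n - 1)"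
        using \<phi>p [OF e] characteristic_map_closed_image(2) [OF N e \<phi>p [OF e]]
        by (auto simp: characteristic_map_def continuous_map_in_subtopology)
      from hom_induced_compose' [OF this inp_skel_continuous inp_skeleton]
      have "base_chain_p (int n) (bp c) = ?r"
        using 3 by (simp add: base_chain_p_def bp_def \<psi>_def)
      then show ?thesis using 3 rc by (simp add: cone_map_def one)
    qed
  qed
  with b show ?thesis using that by blast
qed

lemma cone_negative: "n < 0 \<Longrightarrow> trivial_group (chains mcone n)"
proof -
  assume n: "n < 0"
  have "trivial_group (chains CP (n - 1))" "trivial_group (chains CM n)" "trivial_group (chains CN n)"
    using n by (simp_all add: cellular_chains_simps)
  then show ?thesis
    unfolding chains_cone trivial_group_def by (auto simp: DirProd_group)
qed

theorem cone_chain_isomorphism: "chain_isomorphism mcone CD cone_map"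
  unfolding chain_isomorphism_def
proof (intro conjI allI ballI)
  fix n
  show "cone_map n \<in> iso (chains mcone n) (chains CD n)"
  proof (cases "n < 0")
    case True
    moreover have "trivial_group (chains CD n)" using True by (simp add: cellular_chains_simps)
    ultimately show ?thesis using cone_negative cone_map_hom iso_trivial_groups by blast
  next
    case False
    then obtain k where "n = int k" by (metis int_nat_eq not_le)
    then show ?thesis using cone_map_basis [of k] by blast
  qed
qed (rule cone_map_boundary)

theorem cellular_chains_D_iso: "CD \<cong>\<^sub>c mcone"
  using chain_isomorphism_sym [OF cone_chain_isomorphism] cone_comm cone_boundary_closed
  by (simp add: comm_group.axioms(2))

theorem homology_D: "homology_group n DX \<cong> chain_homology mcone n"
proof -
  have "chain_homology CD n \<cong> chain_homology mcone n"
  proof (rule chain_homology_iso [OF cone_chain_isomorphism])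
    show "group (chains mcone k)" for k using cone_comm by (rule comm_group.axioms(2))
  qed (use cone_boundary_closed chains_comm cellular_boundary_hom cellular_boundary_boundary [OF finite_CW_D] in auto)
  with cellular_homology [OF finite_CW_D] show ?thesis by (rule iso_trans)
qed

theorem cone_free: "finitely_generated_free mcone"
  unfolding finitely_generated_free_def
proof
  fix n
  have grp: "group (chains mcone n)" using cone_comm by (rule comm_group.axioms(2))
  show "\<exists>k::nat. chains mcone n \<cong> free_Abelian_group {..<k}"
  proof (cases "n < 0")
    case True
    then have "is_basis (chains mcone n) {} (\<lambda>_ :: nat. undefined)"
      using cone_negative by (simp add: is_basis_empty grp)
    then show ?thesis using is_basis_finite_rank(1) [OF grp] by blast
  next
    case False
    then obtain k where "n = int k" by (metis int_nat_eq not_le)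
    then show ?thesis
      using cone_map_basis [of k] is_basis_finite_rank(1) [OF grp] CW_finite_cells [OF finite_CW_D] by metis
  qed
qed

lemma free_rank_cone: "free_rank (chains mcone (int k)) = card (cells D k)"
  using cone_map_basis [of k] is_basis_finite_rank(2) [OF comm_group.axioms(2) [OF cone_comm]] CW_finite_cells [OF finite_CW_D]
  by metis

end

lemma coeff_cell_polynomial:
  assumes "finite_CW Y"
  shows "coeff (cell_polynomial Y) k = card (cells Y k)"
  unfolding cell_polynomial_def coeff_sum
  using CW_finite_dimensions [OF assms] by (simp add: sum.delta)

context double_mapping_cylinder
begin

theorem cell_polynomial_D: "cell_polynomial D = cell_polynomial M + cell_polynomial N + [:0, 1:] * cell_polynomial P"
proof (rule poly_eqI)
  fix k
  show "coeff (cell_polynomial D) k = coeff (cell_polynomial M + cell_polynomial N + [:0, 1:] * cell_polynomial P) k"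
    by (cases k) (simp_all add: coeff_cell_polynomial [OF finite_CW_D] coeff_cell_polynomial [OF M]
        coeff_cell_polynomial [OF N] coeff_cell_polynomial [OF P] card_cells_D)
qed

theorem generator_polynomial_cone: "generator_polynomial mcone = cell_polynomial D"
  unfolding generator_polynomial_def cell_polynomial_def free_rank_cone
  using CW_finite_cells [OF finite_CW_D] by (simp add: card_eq_0_iff)

end

section \<open>Dependence on the chain maps\<close>

definition discrete_complex :: "'a set \<Rightarrow> 'a cell_complex" where
  "discrete_complex S = \<lparr> underlying = discrete_topology S, cells = (\<lambda>n. if n = 0 then (\<lambda>x. {x}) ` S else {}) \<rparr>"

lemma skeleton_discrete: "skeleton (discrete_complex S) n = (if n < 0 then {} else S)"
  by (auto simp: skeleton_def discrete_complex_def split: if_splits intro!: exI [of _ "{_}"])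

lemma finite_CW_discrete:
  assumes "finite S"
  shows "finite_CW (discrete_complex S)"
  unfolding finite_CW_def
proof (intro conjI allI ballI impI)
  have "{(k, e). e \<in> cells (discrete_complex S) k} = (\<lambda>x. (0, {x})) ` S"
    by (auto simp: discrete_complex_def split: if_splits)
  then show "finite {(k, e). e \<in> cells (discrete_complex S) k}" using assms by simp
next
  fix k e assume "e \<in> cells (discrete_complex S) k"
  then obtain x where x: "k = 0" "x \<in> S" "e = {x}"
    by (auto simp: discrete_complex_def split: if_splits)
  have top: "topspace (open_disc 0) = {\<lambda>_. 0}"
    by (auto simp: topspace_open_disc disc_set_def)
  have c: "continuous_map (closed_disc 0) (underlying (discrete_complex S)) (\<lambda>_. x)"
    using x by (simp add: discrete_complex_def)
  have "homeomorphic_map (open_disc 0) (subtopology (underlying (discrete_complex S)) {x}) (\<lambda>_. x)"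
    by (rule homeomorphic_map_open_disc [OF _ c]) (auto simp: top disc_boundary_0 discrete_complex_def)
  then show "\<exists>\<phi>. characteristic_map (discrete_complex S) k e \<phi>"
    unfolding characteristic_map_def x using c by (intro exI [of _ "\<lambda>_. x"]) (auto simp: disc_boundary_0)
qed (auto simp: discrete_complex_def split: if_splits)

lemma cellular_map_discrete:
  "f \<in> S \<rightarrow> T \<Longrightarrow> cellular_map (discrete_complex S) (discrete_complex T) f"
  unfolding cellular_map_def skeleton_discrete by (auto simp: discrete_complex_def)

text \<open>Two points joined by an arc each to a third point form a connected space; when both arcs start
  at the same point the other one remains isolated.\<close>

lemma homology_depends_on_maps:
  fixes a b :: 'x
  assumes ab: "a \<noteq> b"
  defines "Q \<equiv> discrete_complex {a, b}" and "A \<equiv> discrete_complex {a}"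
  shows "\<not> homology_group 0 (underlying (DMC Q Q A id (\<lambda>_. a))) \<cong> homology_group 0 (underlying (DMC Q Q A (\<lambda>_. a) (\<lambda>_. a)))"
proof -
  have Q: "finite_CW Q" "finite_CW A" by (simp_all add: Q_def A_def finite_CW_discrete)
  have maps: "cellular_map Q Q id" "cellular_map Q Q (\<lambda>_. a)" "cellular_map Q A (\<lambda>_. a)"
    unfolding Q_def A_def by (rule cellular_map_discrete; simp)+
  have top: "topspace (underlying Q) = {a, b}" "topspace (underlying A) = {a}"
    by (simp_all add: Q_def A_def discrete_complex_def)
  interpret c: double_mapping_cylinder Q Q A id "\<lambda>_. a"
    by unfold_locales (use Q maps in auto)
  interpret d: double_mapping_cylinder Q Q A "\<lambda>_. a" "\<lambda>_. a"
    by unfold_locales (use Q maps in auto)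
  have conn: "path_connected_space c.DX"
  proof -
    have seg: "path_connectedin c.DX (c.inc ` ({x} \<times> {0..1}))" if "x \<in> {a, b}" for x
    proof (rule path_connectedin_continuous_map_image [OF c.inc_continuous])
      have "path_connectedin (underlying Q) {x}" using that top by (simp add: path_connectedin_singleton)
      moreover have "path_connectedin (top_of_set {0..1::real}) {0..1}"
        by (simp add: path_connectedin_subtopology convex_imp_path_connected)
      ultimately show "path_connectedin (cylinder (underlying Q)) ({x} \<times> {0..1})"
        by (simp add: path_connectedin_Times)
    qed
    have eq: "c.inc (x, 0) = c.inm x" "c.inc (x, 1) = c.inp a" if "x \<in> {a, b}" for x
      using that top by (auto simp: c.inc_0 c.inc_1)
    have common: "c.inp a \<in> c.inc ` ({x} \<times> {0..1})" if "x \<in> {a, b}" for x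
      using eq(2) [OF that] by (intro image_eqI [of _ _ "(x, 1)"]) auto
    then have "c.inp a \<in> c.inc ` ({a} \<times> {0..1}) \<inter> c.inc ` ({b} \<times> {0..1})" by blast
    then have "path_connectedin c.DX (c.inc ` ({a} \<times> {0..1}) \<union> c.inc ` ({b} \<times> {0..1}))"
      by (intro path_connectedin_Un seg) blast+
    moreover have "c.inc ` ({a} \<times> {0..1}) \<union> c.inc ` ({b} \<times> {0..1}) = topspace c.DX" (is "?L = _")
    proof
      have "c.inm x \<in> c.inc ` ({x} \<times> {0..1})" if "x \<in> {a, b}" for x
        using eq(1) [OF that] by (intro image_eqI [of _ _ "(x, 0)"]) auto
      moreover have "c.inp a \<in> c.inc ` ({a} \<times> {0..1})"
        using eq(2) [of a] by (intro image_eqI [of _ _ "(a, 1)"]) auto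
      moreover have "c.inc ` ({a, b} \<times> {0<..<1}) \<subseteq> ?L" by auto
      ultimately show "topspace c.DX \<subseteq> ?L"
        unfolding c.topspace_DX top by auto
      have "path_connectedin c.DX ?L" by fact
      then show "?L \<subseteq> topspace c.DX" by (rule path_connectedin_subset_topspace)
    qed
    ultimately show ?thesis
      by (simp add: path_connectedin_topspace)
  qed
  have "\<not> path_connected_space d.DX"
  proof
    assume "path_connected_space d.DX"
    then have con: "connected_space d.DX" by (rule path_connected_imp_connected_space)
    let ?V = "{Inl b} :: ('x + ('x \<times> real) + 'x) set"
    have Vo: "openin d.summands ?V"
      unfolding openin_dmc_summands using ab by (auto simp: Q_def A_def discrete_complex_def)
    have sat: "z \<in> ?V \<longleftrightarrow> d.nf z \<in> ?V" for z
      using ab by (cases z rule: d.nf.cases) auto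
    have o: "openin d.DX {d.inm b}"
      using d.saturated_open(1) [OF Vo sat] by (simp add: d.inm_def)
    have "d.inm b \<in> topspace d.DX" "d.inm a \<in> topspace d.DX"
      unfolding d.topspace_DX top by auto
    moreover have "closedin d.DX {d.inm b}"
      using d.Hausdorff_DX calculation(1) by (simp add: closedin_Hausdorff_singleton)
    ultimately show False
      using con o ab unfolding connected_space_clopen_in by (metis d.inm_eq_iff insert_not_empty singletonD)
  qed
  with conn show ?thesis
    using isomorphic_homology_imp_path_connectedness by blast
qed

theorem theorem12p1:
  fixes P :: "'a cell_complex" and B\<^sub>m :: "'b cell_complex" and B\<^sub>p :: "'c cell_complex"
    and p\<^sub>m :: "'a \<Rightarrow> 'b" and p\<^sub>p :: "'a \<Rightarrow> 'c"
  assumes "finite_CW P" and "finite_CW B\<^sub>m" and "finite_CW B\<^sub>p"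
    and "cellular_map P B\<^sub>m p\<^sub>m" and "cellular_map P B\<^sub>p p\<^sub>p"
  shows "finite_CW (DMC P B\<^sub>m B\<^sub>p p\<^sub>m p\<^sub>p)
    \<and> cellular_chains (DMC P B\<^sub>m B\<^sub>p p\<^sub>m p\<^sub>p) \<cong>\<^sub>c DMC_cone P B\<^sub>m B\<^sub>p p\<^sub>m p\<^sub>p
    \<and> cell_polynomial (DMC P B\<^sub>m B\<^sub>p p\<^sub>m p\<^sub>p) =
        cell_polynomial B\<^sub>m + cell_polynomial B\<^sub>p + [:0, 1:] * cell_polynomial P
    \<and> finitely_generated_free (DMC_cone P B\<^sub>m B\<^sub>p p\<^sub>m p\<^sub>p)
    \<and> generator_polynomial (DMC_cone P B\<^sub>m B\<^sub>p p\<^sub>m p\<^sub>p) =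
        cell_polynomial B\<^sub>m + cell_polynomial B\<^sub>p + [:0, 1:] * cell_polynomial P
    \<and> (\<forall>n. homology_group n (underlying (DMC P B\<^sub>m B\<^sub>p p\<^sub>m p\<^sub>p)) \<cong>
            chain_homology (DMC_cone P B\<^sub>m B\<^sub>p p\<^sub>m p\<^sub>p) n)
    \<and> (\<exists>(Q :: (nat \<Rightarrow> real) cell_complex) (A\<^sub>m :: (nat \<Rightarrow> real) cell_complex)
          (A\<^sub>p :: (nat \<Rightarrow> real) cell_complex) q\<^sub>m q\<^sub>p r\<^sub>m r\<^sub>p.
          finite_CW Q \<and> finite_CW A\<^sub>m \<and> finite_CW A\<^sub>p \<and>
          cellular_map Q A\<^sub>m q\<^sub>m \<and> cellular_map Q A\<^sub>p q\<^sub>p \<and>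
          cellular_map Q A\<^sub>m r\<^sub>m \<and> cellular_map Q A\<^sub>p r\<^sub>p \<and>
          (\<exists>n. \<not> homology_group n (underlying (DMC Q A\<^sub>m A\<^sub>p q\<^sub>m q\<^sub>p)) \<cong>
                   homology_group n (underlying (DMC Q A\<^sub>m A\<^sub>p r\<^sub>m r\<^sub>p))))"
proof -
  interpret double_mapping_cylinder P B\<^sub>m B\<^sub>p p\<^sub>m p\<^sub>p
    by unfold_locales (use assms in auto)
  let ?a = "\<lambda>_ :: nat. 0 :: real" and ?b = "\<lambda>_ :: nat. 1 :: real"
  let ?Q = "discrete_complex {?a, ?b}" and ?A = "discrete_complex {?a}"
  have "?a \<noteq> ?b" by (simp add: fun_eq_iff)
  then have "\<not> homology_group 0 (underlying (DMC ?Q ?Q ?A id (\<lambda>_. ?a))) \<cong> homology_group 0 (underlying (DMC ?Q ?Q ?A (\<lambda>_. ?a) (\<lambda>_. ?a)))"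
    by (rule homology_depends_on_maps)
  moreover have "finite_CW ?Q" "finite_CW ?A" by (simp_all add: finite_CW_discrete)
  moreover have "cellular_map ?Q ?Q id" "cellular_map ?Q ?Q (\<lambda>_. ?a)" "cellular_map ?Q ?A (\<lambda>_. ?a)"
    by (rule cellular_map_discrete; simp)+
  ultimately have "\<exists>(Q :: (nat \<Rightarrow> real) cell_complex) (A\<^sub>m :: (nat \<Rightarrow> real) cell_complex)
          (A\<^sub>p :: (nat \<Rightarrow> real) cell_complex) q\<^sub>m q\<^sub>p r\<^sub>m r\<^sub>p.
          finite_CW Q \<and> finite_CW A\<^sub>m \<and> finite_CW A\<^sub>p \<and>
          cellular_map Q A\<^sub>m q\<^sub>m \<and> cellular_map Q A\<^sub>p q\<^sub>p \<and>
          cellular_map Q A\<^sub>m r\<^sub>m \<and> cellular_map Q A\<^sub>p r\<^sub>p \<and>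
          (\<exists>n. \<not> homology_group n (underlying (DMC Q A\<^sub>m A\<^sub>p q\<^sub>m q\<^sub>p)) \<cong>
                   homology_group n (underlying (DMC Q A\<^sub>m A\<^sub>p r\<^sub>m r\<^sub>p)))"
    by (intro exI conjI)
  then show ?thesis
    using finite_CW_D cellular_chains_D_iso cell_polynomial_D cone_free generator_polynomial_cone homology_D
    by simp
qed

end
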